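(* Let $A$ be an associative TC-algebra (over $H=\Bbbk[T_1,\dots,T_n]$) with finite faithful representation. Then the Jacobson radical of $A$ is nilpotent.
   Context: $\Bbbk$ is an algebraically closed field of characteristic zero (with discrete topology). $H=\Bbbk[T_1,\dots,T_n]$ is a topological algebra whose basic neighborhoods of zero are the powers of the augmentation ideal $(T_1,\dots,T_n)$. TC-algebras. Let $A$ be a Hausdorff topological algebra endowed with continuous derivations $\partial_1,\dots,\partial_n$. A linear map $a:H\to A$ is T-invariant if $a\left(\frac{\partial f}{\partial T_i}\right)=\partial_i(a(f))$ for all $f\in H$, $i=1,\dots,n$. Let $\mathcal F(A)$ be the set of all continuous T-invariant maps $H\to A$. $A$ is called a TC-algebra if $A=\{a(f)\mid a\in\mathcal F(A),\ f\in H\}$. Representations. For an $H$-module $M$, $\operatorname{End}_{\Bbbk}M$ carries the finite topology, with basic neighborhoods of zero $\{\psi\mid \psi u_j=0,\ j=1,\dots,N\}$ for $u_1,\dots,u_N\in M$, and the derivations $\partial_i=[\cdot,T_i]$. A TC-representation of $A$ on $M$ is a continuous representation $\rho:A\to\operatorname{End}_{\Bbbk}M$ with $\rho(\partial_i x)=[\rho(x),T_i]$ for all $x\in A$ and all $i$. "With finite faithful representation" means that $A$ has a faithful TC-representation on some finitely generated $H$-module. *)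

theory Defs
  imports
    "HOL-Analysis.Abstract_Topology"
    "HOL-Library.Poly_Mapping"
    "HOL-Computational_Algebra.Polynomial"
begin

section \<open>Polynomials in the variables indexed by a finite type\<close>

text \<open>
  Exponent vectors are finitely supported functions, and multiplication of
  \<^typ>\<open>('n \<Rightarrow>\<^sub>0 nat) \<Rightarrow>\<^sub>0 'k\<close> is the convolution product, so this type is the polynomial ring
  over \<^typ>\<open>'k\<close> whose number of variables is the cardinality of \<^typ>\<open>'n\<close>.
\<close>

type_synonym ('n, 'k) polys = "('n \<Rightarrow>\<^sub>0 nat) \<Rightarrow>\<^sub>0 'k"

definition Const :: "'k \<Rightarrow> ('n, 'k::zero) polys"
  where "Const c = Poly_Mapping.single 0 c"

definition Var :: "'n \<Rightarrow> ('n, 'k::zero_neq_one) polys"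
  where "Var i = Poly_Mapping.single (Poly_Mapping.single i 1) 1"

text \<open>
  The subtraction of exponents is truncated, which is harmless: a monomial in which the
  variable does not occur is multiplied by 0.
\<close>

definition partial_deriv :: "'n \<Rightarrow> ('n, 'k::comm_ring_1) polys \<Rightarrow> ('n, 'k) polys"
  where "partial_deriv i f =
    (\<Sum>m\<in>Poly_Mapping.keys f.
      Poly_Mapping.single (m - Poly_Mapping.single i 1)
        (of_nat (Poly_Mapping.lookup m i) * Poly_Mapping.lookup f m))"

lemma lookup_partial_deriv:
  fixes f :: "('n, 'k::comm_ring_1) polys"
  shows "Poly_Mapping.lookup (partial_deriv i f) m =
    of_nat (Poly_Mapping.lookup m i + 1) *
      Poly_Mapping.lookup f (m + Poly_Mapping.single i 1)"
proof -
  let ?e = "Poly_Mapping.single i (1::nat)"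
  have shift: "p = m + ?e" if "p - ?e = m" "Poly_Mapping.lookup p i \<noteq> 0" for p
  proof (rule poly_mapping_eqI)
    fix j
    have "Poly_Mapping.lookup m j = Poly_Mapping.lookup p j - Poly_Mapping.lookup ?e j"
      using that(1) by (auto simp flip: lookup_minus)
    with that(2) show "Poly_Mapping.lookup p j = Poly_Mapping.lookup (m + ?e) j"
      by (cases "j = i") (auto simp: lookup_add lookup_single when_def)
  qed
  have "Poly_Mapping.lookup (partial_deriv i f) m =
      (\<Sum>p\<in>Poly_Mapping.keys f. of_nat (Poly_Mapping.lookup p i) * Poly_Mapping.lookup f p
        when p - ?e = m)"
    by (simp add: partial_deriv_def lookup_sum lookup_single)
  also have "\<dots> = (\<Sum>p\<in>Poly_Mapping.keys f. if p = m + ?e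
      then of_nat (Poly_Mapping.lookup p i) * Poly_Mapping.lookup f p else 0)"
  proof (rule sum.cong[OF refl])
    fix p
    show "(of_nat (Poly_Mapping.lookup p i) * Poly_Mapping.lookup f p when p - ?e = m) =
      (if p = m + ?e then of_nat (Poly_Mapping.lookup p i) * Poly_Mapping.lookup f p else 0)"
    proof (cases "Poly_Mapping.lookup p i = 0")
      case True
      then have "p \<noteq> m + ?e" by (auto simp: lookup_add)
      with True show ?thesis by simp
    next
      case False
      then have "p - ?e = m \<longleftrightarrow> p = m + ?e"
        using shift by (metis add_diff_cancel_right')
      then show ?thesis by (simp only: when_def)
    qed
  qed
  also have "\<dots> = of_nat (Poly_Mapping.lookup m i + 1) *
      Poly_Mapping.lookup f (m + ?e)"
    by (auto simp: lookup_add in_keys_iff)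
  finally show ?thesis .
qed

definition restrict_scalars ::
    "(('n, 'k::zero) polys \<Rightarrow> 'm \<Rightarrow> 'm) \<Rightarrow> 'k \<Rightarrow> 'm \<Rightarrow> 'm"
  where "restrict_scalars act c u = act (Const c) u"

lemma vector_space_restrict_scalars:
  fixes act :: "('n, 'k::field) polys \<Rightarrow> 'm::ab_group_add \<Rightarrow> 'm"
  assumes "module act"
  shows "vector_space (restrict_scalars act)"
proof -
  interpret module act by fact
  have add: "Const (a + b) = Const a + (Const b :: ('n, 'k) polys)" for a b
    by (simp add: Const_def single_add)
  have mult: "Const (a * b) = Const a * (Const b :: ('n, 'k) polys)" for a b
    by (simp add: Const_def mult_single)
  have one: "Const 1 = (1 :: ('n, 'k) polys)"
    by (simp add: Const_def)
  show ?thesis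
    unfolding vector_space_def restrict_scalars_def add mult one
    by (simp add: scale_right_distrib scale_left_distrib)
qed


section \<open>Ideals of possibly non-unital rings\<close>

definition ideal_prod :: "'r::ring set \<Rightarrow> 'r set \<Rightarrow> 'r set"
  where "ideal_prod I J =
    {(\<Sum>k<l. x k * y k) | (l::nat) x y. \<forall>k<l. x k \<in> I \<and> y k \<in> J}"

fun ideal_power :: "'r::ring set \<Rightarrow> nat \<Rightarrow> 'r set"
  where
    "ideal_power I 0 = UNIV"
  | "ideal_power I (Suc 0) = I"
  | "ideal_power I (Suc (Suc k)) = ideal_prod (ideal_power I (Suc k)) I"

definition nilpotent_ideal :: "'r::ring set \<Rightarrow> bool"
  where "nilpotent_ideal I \<longleftrightarrow> (\<exists>k>0. ideal_power I k = {0})"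

definition left_ideal :: "'r::ring set \<Rightarrow> bool"
  where "left_ideal L \<longleftrightarrow>
    0 \<in> L \<and> (\<forall>x\<in>L. \<forall>y\<in>L. x + y \<in> L) \<and> (\<forall>x. \<forall>y\<in>L. x * y \<in> L)
      \<and> (\<forall>x\<in>L. - x \<in> L)"

definition maximal_left_ideal :: "'r::ring set \<Rightarrow> bool"
  where "maximal_left_ideal L \<longleftrightarrow>
    left_ideal L \<and> L \<noteq> UNIV \<and> (\<forall>L'. left_ideal L' \<and> L \<subseteq> L' \<longrightarrow> L' = L \<or> L' = UNIV)"

definition modular_left_ideal :: "'r::ring set \<Rightarrow> bool"
  where "modular_left_ideal L \<longleftrightarrow> left_ideal L \<and> (\<exists>e. \<forall>x. x - x * e \<in> L)"

text \<open>
  No unit is assumed, so the Jacobson radical is the intersection of the maximal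
  \<^emph>\<open>modular\<close> left ideals (the whole ring if there are none); in a unital ring every left
  ideal is modular.  A maximal modular left ideal of an algebra over a field is
  automatically a subspace, so there is no difference between the radical of an algebra
  and that of its underlying ring.
\<close>

definition jacobson_radical :: "'r::ring set"
  where "jacobson_radical = \<Inter>{L. maximal_left_ideal L \<and> modular_left_ideal L}"


section \<open>The topologies on polynomials and on endomorphisms\<close>

definition augmentation_ideal :: "('n, 'k::comm_ring_1) polys set"
  where "augmentation_ideal = module.span (*) (range Var)"

definition polys_topology :: "('n, 'k::comm_ring_1) polys topology"
  where "polys_topology =
    topology (\<lambda>U. \<forall>f\<in>U. \<exists>k. \<forall>g\<in>ideal_power augmentation_ideal k. f + g \<in> U)"

lemma subset_ideal_power_Suc:
  assumes "module.subspace (*) (I :: 'r::comm_ring_1 set)"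
  shows "module.subspace (*) (ideal_power I k)" "ideal_power I (Suc k) \<subseteq> ideal_power I k"
proof -
  interpret module "(*) :: 'r \<Rightarrow> 'r \<Rightarrow> 'r"
    by unfold_locales (simp_all add: algebra_simps)
  have prod_sub: "ideal_prod J I \<subseteq> J" if "subspace J" for J
    unfolding ideal_prod_def
  proof clarify
    fix l :: nat and x y :: "nat \<Rightarrow> 'r"
    assume xy: "\<forall>k<l. x k \<in> J \<and> y k \<in> I"
    show "(\<Sum>k<l. x k * y k) \<in> J"
    proof (rule subspace_sum[OF that])
      fix k assume "k \<in> {..<l}"
      with xy have "y k * x k \<in> J" by (intro subspace_scale[OF that]) simp
      then show "x k * y k \<in> J" by (simp add: mult.commute)
    qed
  qed
  have sub_prod: "subspace (ideal_prod J I)" if J: "subspace J" for J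
    unfolding subspace_def
  proof (intro conjI ballI allI)
    show "0 \<in> ideal_prod J I"
      unfolding ideal_prod_def by (auto intro!: exI[of _ "0::nat"])
  next
    fix u v assume "u \<in> ideal_prod J I" "v \<in> ideal_prod J I"
    then obtain l l' :: nat and x y x' y' where
      u: "u = (\<Sum>k<l. x k * y k)" "\<forall>k<l. x k \<in> J \<and> y k \<in> I" and
      v: "v = (\<Sum>k<l'. x' k * y' k)" "\<forall>k<l'. x' k \<in> J \<and> y' k \<in> I"
      unfolding ideal_prod_def by blast
    let ?x = "\<lambda>k. if k < l then x k else x' (k - l)"
    let ?y = "\<lambda>k. if k < l then y k else y' (k - l)"
    have "u + v = (\<Sum>k<l + l'. ?x k * ?y k)"
      unfolding u(1) v(1)
      by (induction l') (simp_all add: add.assoc)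
    moreover have "\<forall>k<l + l'. ?x k \<in> J \<and> ?y k \<in> I"
      using u(2) v(2) by auto
    ultimately show "u + v \<in> ideal_prod J I"
      unfolding ideal_prod_def mem_Collect_eq by (intro exI conjI)
  next
    fix c u assume "u \<in> ideal_prod J I"
    then obtain l :: nat and x y where
      u: "u = (\<Sum>k<l. x k * y k)" "\<forall>k<l. x k \<in> J \<and> y k \<in> I"
      unfolding ideal_prod_def by blast
    have "c * u = (\<Sum>k<l. (c * x k) * y k)"
      unfolding u(1) by (simp add: sum_distrib_left)
    moreover have "\<forall>k<l. c * x k \<in> J \<and> y k \<in> I"
      using u(2) J by (auto intro: subspace_scale)
    ultimately show "c * u \<in> ideal_prod J I"
      unfolding ideal_prod_def mem_Collect_eq by (intro exI conjI)
  qed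
  show sub: "subspace (ideal_power I k)"
  proof (induction k)
    case 0
    show ?case by simp
  next
    case (Suc k)
    then show ?case by (cases k) (simp_all add: assms sub_prod)
  qed
  show "ideal_power I (Suc k) \<subseteq> ideal_power I k"
    using prod_sub[OF sub] by (cases k) auto
qed

lemma openin_polys_topology:
  fixes U :: "('n, 'k::comm_ring_1) polys set"
  shows "openin polys_topology U \<longleftrightarrow>
    (\<forall>f\<in>U. \<exists>k. \<forall>g\<in>ideal_power augmentation_ideal k. f + g \<in> U)"
proof -
  interpret module "(*) :: ('n, 'k) polys \<Rightarrow> _ \<Rightarrow> _"
    by unfold_locales (simp_all add: algebra_simps)
  let ?P = "ideal_power (augmentation_ideal :: ('n, 'k) polys set)"
  have "subspace (augmentation_ideal :: ('n, 'k) polys set)"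
    unfolding augmentation_ideal_def by (rule subspace_span)
  note anti = lift_Suc_antimono_le[of ?P, OF subset_ideal_power_Suc(2)[OF this]]
  let ?open = "\<lambda>U. \<forall>f\<in>U. \<exists>k. \<forall>g\<in>?P k. f + g \<in> U"
  have "istopology ?open"
    unfolding istopology_def
  proof (intro conjI allI impI ballI)
    fix S T f assume "?open S" "?open T" "f \<in> S \<inter> T"
    then obtain k l where "\<forall>g\<in>?P k. f + g \<in> S" "\<forall>g\<in>?P l. f + g \<in> T"
      by blast
    then have "\<forall>g\<in>?P (max k l). f + g \<in> S \<inter> T"
      using anti[of k "max k l"] anti[of l "max k l"] by (auto simp: subset_iff)
    then show "\<exists>k. \<forall>g\<in>?P k. f + g \<in> S \<inter> T" ..
  next
    fix \<K> f assume "\<forall>K\<in>\<K>. ?open K" "f \<in> \<Union>\<K>"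
    then show "\<exists>k. \<forall>g\<in>?P k. f + g \<in> \<Union>\<K>" by (metis Union_iff)
  qed
  then show ?thesis
    unfolding polys_topology_def by simp
qed

definition End :: "('k::field \<Rightarrow> 'm::ab_group_add \<Rightarrow> 'm) \<Rightarrow> ('m \<Rightarrow> 'm) set"
  where "End s = {\<psi>. Vector_Spaces.linear s s \<psi>}"

definition finite_topology :: "('k::field \<Rightarrow> 'm::ab_group_add \<Rightarrow> 'm) \<Rightarrow> ('m \<Rightarrow> 'm) topology"
  where "finite_topology s =
    topology (\<lambda>U. U \<subseteq> End s \<and>
      (\<forall>\<phi>\<in>U. \<exists>F. finite F \<and> (\<forall>\<psi>\<in>End s. (\<forall>u\<in>F. \<psi> u - \<phi> u = 0) \<longrightarrow> \<psi> \<in> U)))"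

lemma openin_finite_topology:
  "openin (finite_topology s) U \<longleftrightarrow> U \<subseteq> End s \<and>
    (\<forall>\<phi>\<in>U. \<exists>F. finite F \<and> (\<forall>\<psi>\<in>End s. (\<forall>u\<in>F. \<psi> u - \<phi> u = 0) \<longrightarrow> \<psi> \<in> U))"
proof -
  let ?nb = "\<lambda>U \<phi>. \<exists>F. finite F \<and> (\<forall>\<psi>\<in>End s. (\<forall>u\<in>F. \<psi> u - \<phi> u = 0) \<longrightarrow> \<psi> \<in> U)"
  have "istopology (\<lambda>U. U \<subseteq> End s \<and> (\<forall>\<phi>\<in>U. ?nb U \<phi>))"
    unfolding istopology_def
  proof (intro conjI allI impI ballI)
    fix S T \<phi>
    assume "S \<subseteq> End s \<and> (\<forall>\<phi>\<in>S. ?nb S \<phi>)" "T \<subseteq> End s \<and> (\<forall>\<phi>\<in>T. ?nb T \<phi>)" "\<phi> \<in> S \<inter> T"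
    then obtain F G where
      "finite F" "\<forall>\<psi>\<in>End s. (\<forall>u\<in>F. \<psi> u - \<phi> u = 0) \<longrightarrow> \<psi> \<in> S"
      "finite G" "\<forall>\<psi>\<in>End s. (\<forall>u\<in>G. \<psi> u - \<phi> u = 0) \<longrightarrow> \<psi> \<in> T"
      by blast
    then show "?nb (S \<inter> T) \<phi>"
      by (intro exI[of _ "F \<union> G"]) auto
  next
    fix \<K> \<phi> assume "\<forall>K\<in>\<K>. K \<subseteq> End s \<and> (\<forall>\<phi>\<in>K. ?nb K \<phi>)" "\<phi> \<in> \<Union>\<K>"
    then show "?nb (\<Union>\<K>) \<phi>" by (metis Union_iff)
  qed auto
  then show ?thesis
    unfolding finite_topology_def by simp
qed


section \<open>TC-algebras and their representations\<close>

text \<open>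
  The ground field is discrete, so joint continuity of the scalar multiplication means
  continuity of the multiplication by each scalar.
\<close>

locale topological_algebra = vector_space scale
  for scale :: "'k::field \<Rightarrow>
    'a::{ring, topological_ab_group_add, topological_semigroup_mult} \<Rightarrow> 'a" +
  assumes scale_mult_left: "scale c x * y = scale c (x * y)"
    and scale_mult_right: "x * scale c y = scale c (x * y)"
    and continuous_scale: "continuous_on UNIV (scale c)"

definition T_invariant_maps ::
    "('k::field \<Rightarrow> 'a::{ab_group_add, topological_space} \<Rightarrow> 'a) \<Rightarrow> ('n \<Rightarrow> 'a \<Rightarrow> 'a)
      \<Rightarrow> (('n, 'k) polys \<Rightarrow> 'a) set"
  where "T_invariant_maps scale D =
    {a. Vector_Spaces.linear (restrict_scalars (*)) scale a \<and>
        continuous_map polys_topology euclidean a \<and>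
        (\<forall>i f. a (partial_deriv i f) = D i (a f))}"

locale TC_algebra = topological_algebra scale
  for scale :: "'k::field \<Rightarrow>
    'a::{ring, topological_ab_group_add, topological_semigroup_mult, t2_space} \<Rightarrow> 'a" +
  fixes D :: "'n::finite \<Rightarrow> 'a \<Rightarrow> 'a"
  assumes linear_D: "Vector_Spaces.linear scale scale (D i)"
    and derivation_D: "D i (x * y) = D i x * y + x * D i y"
    and continuous_D: "continuous_on UNIV (D i)"
    and generated: "UNIV = {a f | a f. a \<in> T_invariant_maps scale D}"

definition finitely_generated ::
    "('r::comm_ring_1 \<Rightarrow> 'm::ab_group_add \<Rightarrow> 'm) \<Rightarrow> bool"
  where "finitely_generated act \<longleftrightarrow> (\<exists>B. finite B \<and> module.span act B = UNIV)"

locale TC_representation = TC_algebra scale D + M: module act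
  for scale :: "'k::field \<Rightarrow>
    'a::{ring, topological_ab_group_add, topological_semigroup_mult, t2_space} \<Rightarrow> 'a"
    and D :: "'n::finite \<Rightarrow> 'a \<Rightarrow> 'a"
    and act :: "('n, 'k) polys \<Rightarrow> 'm::ab_group_add \<Rightarrow> 'm" +
  fixes \<rho> :: "'a \<Rightarrow> 'm \<Rightarrow> 'm"
  assumes rep_End: "\<rho> x \<in> End (restrict_scalars act)"
    and rep_add: "\<rho> (x + y) u = \<rho> x u + \<rho> y u"
    and rep_scale: "\<rho> (scale c x) u = restrict_scalars act c (\<rho> x u)"
    and rep_mult: "\<rho> (x * y) = \<rho> x \<circ> \<rho> y"
    and rep_continuous:
      "continuous_map euclidean (finite_topology (restrict_scalars act)) \<rho>"
    and rep_D: "\<rho> (D i x) u = \<rho> x (act (Var i) u) - act (Var i) (\<rho> x u)"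

end

theory Submission
  imports Defs
begin

text \<open>
  Let \<open>H\<close> be the polynomial ring, \<open>J\<close> the radical of the algebra \<open>A\<close>, and write \<open>x m\<close> for the
  action of \<open>x\<close> in \<open>A\<close> on \<open>m\<close> in \<open>M\<close>.  For a continuous T-invariant map \<open>a\<close>, the elements
  \<open>b \<alpha> = a (T^\<alpha> / \<alpha>!)\<close> satisfy \<open>D i (b \<alpha>) = b (\<alpha> - e i)\<close>, where \<open>e i\<close> is the \<open>i\<close>-th unit vector,
  and all but finitely many of them kill a given vector.  So \<open>A\<close> acts on \<open>M\<close> by differential
  operators, the order of an element being measured by the derivations \<open>D i\<close>.  The exponentials
  \<open>exp (t D i)\<close> are automorphisms of \<open>A\<close>, whence \<open>J\<close> is stable under all \<open>D i\<close>
  (\<open>jacobson_radical_derivation\<close>).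

  \<^bold>\<open>Reduction to simple sections.\<close>  The submodules \<open>N\<close> of \<open>M\<close> that are stable under \<open>A\<close> and such that
  \<open>M / N\<close> is torsion-free form a set in which all chains are finite, by a rank argument
  (\<open>corank_strict_mono\<close>).  The least one is the torsion submodule, and \<open>A\<close> annihilates it: the
  conditions on a whole family \<open>b\<close> force \<open>b \<alpha> m = 0\<close> as soon as \<open>f m = 0\<close> for some
  \<open>f \<noteq> 0\<close> (\<open>torsion_lemma\<close>).  It therefore suffices to show \<open>J A M1 \<subseteq> M2\<close> for two such submodules
  \<open>M2 \<subset> M1\<close> with none strictly between; then \<open>J\<^sup>2\<close> maps \<open>M1\<close> into \<open>M2\<close>, and a power of \<open>J\<close> kills
  the faithful module \<open>M\<close>.

  \<^bold>\<open>Simple sections.\<close>  Suppose that \<open>J A M1\<close> is not contained in \<open>M2\<close>, and choose \<open>x\<close> in \<open>J\<close> of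
  minimal order such that \<open>x A M1\<close> is not contained in \<open>M2\<close>; then \<open>(D i x) A M1 \<subseteq> M2\<close> for
  all \<open>i\<close>.  Consider the fibre of \<open>M1 / M2\<close> at a general point \<open>p\<close>.  The elements of \<open>J\<close> that
  are \<open>H\<close>-linear on \<open>M1 / M2\<close> act on this fibre, and because \<open>1 - y\<close> is invertible for each of
  them, they have a common zero \<open>v \<noteq> 0\<close> in it (\<open>exists_common_zero\<close>).  The operators
  \<open>\<theta> = \<Sum>\<alpha>. (p - T)^\<alpha> x (b \<alpha>)\<close>
  satisfy \<open>\<theta> (f m) = f(p) \<theta> m\<close> modulo \<open>M2\<close>, so they are defined on the fibre at \<open>p\<close>.  The vectors
  \<open>\<theta> v\<close> and \<open>A \<theta> v\<close> vanish at \<open>p\<close>, since their values there are given by the elements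
  \<open>\<Sum>\<beta> + \<alpha> = \<delta>. (-1)^|\<alpha>| (b' \<beta>) x (b \<alpha>)\<close>, which lie in \<open>J\<close> and are \<open>H\<close>-linear on \<open>M1 / M2\<close>
  (\<open>alternating_sum_in_A0\<close>).  But if \<open>p\<close> is general and \<open>M1 / M2\<close> simple, an element \<open>w\<close> of \<open>M1\<close>
  such that \<open>w\<close> and \<open>A w\<close> vanish at \<open>p\<close> must lie in \<open>M2\<close>.  Thus \<open>\<theta> v\<close> lies in \<open>M2\<close> for all families \<open>b\<close>.
  On the other hand, the coordinates of the vectors \<open>\<theta> m\<close> are polynomials in \<open>p\<close> that depend
  \<open>H\<close>-linearly on \<open>m\<close>, and their common zeros are the \<open>m\<close> with \<open>x A m \<subseteq> M2\<close>, which by simplicity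
  means \<open>m\<close> in \<open>M2\<close>.  Functionals that separate the elements of a module of finite rank also separate
  those of its fibre at a general point (\<open>exists_dual_system\<close>), so \<open>v = 0\<close>, a
  contradiction.
\<close>

section \<open>Exponents and evaluation of polynomials\<close>

lemma exponent_induct [case_names zero step]:
  fixes \<alpha> :: "'n::finite \<Rightarrow>\<^sub>0 nat"
  assumes zero: "P 0" and step: "\<And>\<alpha> i. P \<alpha> \<Longrightarrow> P (\<alpha> + Poly_Mapping.single i 1)"
  shows "P \<alpha>"
proof (induction "\<Sum>i\<in>UNIV. Poly_Mapping.lookup \<alpha> i" arbitrary: \<alpha>)
  case 0
  then have "\<alpha> = 0" by (intro poly_mapping_eqI) simp
  with zero show ?case by simp
next
  case (Suc N)
  then obtain i where i: "Poly_Mapping.lookup \<alpha> i > 0"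
    by (metis gr0I sum.neutral nat.simps(3))
  let ?\<beta> = "\<alpha> - Poly_Mapping.single i 1"
  have \<alpha>: "\<alpha> = ?\<beta> + Poly_Mapping.single i 1"
    using i by (intro poly_mapping_eqI) (auto simp: lookup_add lookup_minus lookup_single when_def)
  have "(\<Sum>j\<in>UNIV. Poly_Mapping.lookup \<alpha> j) = (\<Sum>j\<in>UNIV. Poly_Mapping.lookup ?\<beta> j) + 1"
    by (subst \<alpha>) (simp add: lookup_add sum.distrib lookup_single when_def)
  with Suc have "P ?\<beta>" by simp
  from step[OF this, of i] \<alpha> show ?case by simp
qed

text \<open>The monomial with exponent \<open>\<alpha>\<close> in the elements \<open>x i\<close>.\<close>

definition mpow :: "('n::finite \<Rightarrow> 'r::comm_monoid_mult) \<Rightarrow> ('n \<Rightarrow>\<^sub>0 nat) \<Rightarrow> 'r"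
  where "mpow x \<alpha> = (\<Prod>i\<in>UNIV. x i ^ Poly_Mapping.lookup \<alpha> i)"

lemma mpow_zero [simp]: "mpow x 0 = 1"
  by (simp add: mpow_def)

lemma mpow_add: "mpow x (\<alpha> + \<beta>) = mpow x \<alpha> * mpow x \<beta>"
  by (simp add: mpow_def lookup_add power_add prod.distrib)

lemma mpow_single [simp]: "mpow x (Poly_Mapping.single i 1) = x i"
proof -
  have "mpow x (Poly_Mapping.single i 1) = (\<Prod>j\<in>UNIV. if j = i then x i else 1)"
    unfolding mpow_def by (intro prod.cong) (auto simp: lookup_single when_def)
  then show ?thesis by simp
qed

lemma Const_mult_single:
  "Const c * Poly_Mapping.single \<alpha> d = (Poly_Mapping.single \<alpha> (c * d) :: ('n, 'k::comm_ring_1) polys)"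
  by (simp add: Const_def mult_single)

lemma Const_add: "Const (a + b) = (Const a + Const b :: ('n, 'k::comm_ring_1) polys)"
  by (simp add: Const_def single_add)

lemma Const_mult: "Const (a * b) = (Const a * Const b :: ('n, 'k::comm_ring_1) polys)"
  by (simp add: Const_def mult_single)

lemma Const_0 [simp]: "Const 0 = 0" and Const_1 [simp]: "Const 1 = 1"
  by (simp_all add: Const_def)

lemma Const_minus: "Const (- a) = (- Const a :: ('n, 'k::comm_ring_1) polys)"
  by (simp add: Const_def single_uminus)

lemma poly_mapping_sum_monomials:
  "(\<Sum>\<alpha>\<in>Poly_Mapping.keys f. Poly_Mapping.single \<alpha> (Poly_Mapping.lookup f \<alpha>)) = f"
  by (rule poly_mapping_eqI)
    (simp add: lookup_sum lookup_single when_def in_keys_iff)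

lemma polys_induct [case_names Const add Var]:
  fixes f :: "('n::finite, 'k::comm_ring_1) polys"
  assumes C: "\<And>c. P (Const c)" and A: "\<And>f g. P f \<Longrightarrow> P g \<Longrightarrow> P (f + g)"
    and V: "\<And>i f. P f \<Longrightarrow> P (Var i * f)"
  shows "P f"
proof -
  have S: "P (Poly_Mapping.single \<alpha> c)" for \<alpha> :: "'n \<Rightarrow>\<^sub>0 nat" and c
  proof (induction \<alpha> rule: exponent_induct)
    case zero
    show ?case using C[of c] by (simp add: Const_def)
  next
    case (step \<alpha> i)
    from V[OF this, of i] show ?case by (simp add: Var_def mult_single add.commute)
  qed
  have "P (\<Sum>\<alpha>\<in>F. Poly_Mapping.single \<alpha> (Poly_Mapping.lookup f \<alpha>))" if "finite F" for F
    using that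
  proof (induction F)
    case empty
    show ?case using C[of 0] by simp
  qed (auto intro: A S)
  from this[of "Poly_Mapping.keys f"] show ?thesis by (simp add: poly_mapping_sum_monomials)
qed

text \<open>Evaluation at the point \<open>p\<close> of affine space.\<close>

definition eval :: "('n::finite \<Rightarrow> 'k) \<Rightarrow> ('n, 'k::comm_ring_1) polys \<Rightarrow> 'k"
  where "eval p f = (\<Sum>\<alpha>\<in>Poly_Mapping.keys f. Poly_Mapping.lookup f \<alpha> * mpow p \<alpha>)"

lemma eval_eq_sum:
  assumes "finite F" "Poly_Mapping.keys f \<subseteq> F"
  shows "eval p f = (\<Sum>\<alpha>\<in>F. Poly_Mapping.lookup f \<alpha> * mpow p \<alpha>)"
  unfolding eval_def by (rule sum.mono_neutral_left) (use assms in \<open>auto simp: in_keys_iff\<close>)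

lemma eval_add [simp]: "eval p (f + g) = eval p f + eval p g"
proof -
  let ?F = "Poly_Mapping.keys f \<union> Poly_Mapping.keys g"
  have "Poly_Mapping.keys (f + g) \<subseteq> ?F" by (rule keys_add)
  then show ?thesis
    by (simp add: eval_eq_sum[of ?F] lookup_add algebra_simps sum.distrib)
qed

lemma eval_single: "eval p (Poly_Mapping.single \<alpha> c) = c * mpow p \<alpha>"
  by (subst eval_eq_sum[of "{\<alpha>}"]) (auto simp: in_keys_iff lookup_single when_def split: if_splits)

lemma eval_0 [simp]: "eval p 0 = 0"
  by (simp add: eval_def)

lemma eval_Const [simp]: "eval p (Const c) = c"
  by (simp add: Const_def eval_single)

lemma eval_Var [simp]: "eval p (Var i) = p i"
  unfolding Var_def eval_single mpow_single by simp

lemma eval_1 [simp]: "eval p 1 = 1"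
  using eval_Const[of p 1] by (simp del: eval_Const)

lemma eval_sum [simp]: "eval p (\<Sum>i\<in>I. f i) = (\<Sum>i\<in>I. eval p (f i))"
  by (induction I rule: infinite_finite_induct) auto

lemma eval_mult [simp]: "eval p (f * g) = eval p f * eval p g"
proof -
  have single: "eval p (Poly_Mapping.single \<alpha> c * g) = c * mpow p \<alpha> * eval p g" for \<alpha> c
  proof -
    have "Poly_Mapping.single \<alpha> c * g = Poly_Mapping.single \<alpha> c *
        (\<Sum>\<beta>\<in>Poly_Mapping.keys g. Poly_Mapping.single \<beta> (Poly_Mapping.lookup g \<beta>))"
      by (simp add: poly_mapping_sum_monomials)
    then show ?thesis
      by (simp add: sum_distrib_left mult_single eval_single mpow_add eval_def[of p g] mult_ac)
  qed
  have "f * g = (\<Sum>\<alpha>\<in>Poly_Mapping.keys f. Poly_Mapping.single \<alpha> (Poly_Mapping.lookup f \<alpha>)) * g"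
    by (simp add: poly_mapping_sum_monomials)
  then show ?thesis
    by (simp add: sum_distrib_right single eval_def[of p f])
qed

lemma eval_minus [simp]: "eval p (- f) = - eval p f"
  by (metis add.right_inverse add_eq_0_iff eval_0 eval_add)

lemma eval_diff [simp]: "eval p (f - g) = eval p f - eval p g"
  using eval_add[of p f "- g"] by (simp del: eval_add)

lemma eval_prod [simp]: "eval p (\<Prod>i\<in>I. f i) = (\<Prod>i\<in>I. eval p (f i))"
  by (induction I rule: infinite_finite_induct) auto

lemma eval_power [simp]: "eval p (f ^ k) = eval p f ^ k"
  by (induction k) auto

lemma eval_mpow: "eval p (mpow x \<alpha>) = mpow (\<lambda>i. eval p (x i)) \<alpha>"
  by (simp add: mpow_def)

text \<open>A positive linear weight on exponents that separates a given finite set of them, as in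
  Kronecker substitution: each new variable gets a weight larger than all partial weights
  so far.\<close>

lemma exists_separating_weight:
  fixes S :: "('n::finite \<Rightarrow>\<^sub>0 nat) set"
  assumes "finite S"
  obtains c :: "'n \<Rightarrow> nat" where "\<And>i. c i > 0"
    "inj_on (\<lambda>\<alpha>. \<Sum>i\<in>UNIV. c i * Poly_Mapping.lookup \<alpha> i) S"
proof -
  have "\<exists>c. (\<forall>i. c i > 0) \<and> (\<forall>\<alpha>\<in>S. \<forall>\<beta>\<in>S.
      (\<Sum>i\<in>I. c i * Poly_Mapping.lookup \<alpha> i) = (\<Sum>i\<in>I. c i * Poly_Mapping.lookup \<beta> i)
      \<longrightarrow> (\<forall>i\<in>I. Poly_Mapping.lookup \<alpha> i = Poly_Mapping.lookup \<beta> i))"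
    if "finite I" for I :: "'n set"
    using that
  proof (induction I)
    case empty
    show ?case by (auto intro!: exI[of _ "\<lambda>_. 1"])
  next
    case (insert j I)
    then obtain c where pos: "\<And>i. c i > 0" and inj: "\<And>\<alpha> \<beta>. \<alpha> \<in> S \<Longrightarrow> \<beta> \<in> S \<Longrightarrow>
      (\<Sum>i\<in>I. c i * Poly_Mapping.lookup \<alpha> i) = (\<Sum>i\<in>I. c i * Poly_Mapping.lookup \<beta> i) \<Longrightarrow>
      (\<forall>i\<in>I. Poly_Mapping.lookup \<alpha> i = Poly_Mapping.lookup \<beta> i)"
      by blast
    define w where "w \<alpha> = (\<Sum>i\<in>I. c i * Poly_Mapping.lookup \<alpha> i)" for \<alpha>
    define B where "B = Suc (\<Sum>\<alpha>\<in>S. w \<alpha>)"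
    have small: "w \<alpha> < B" if "\<alpha> \<in> S" for \<alpha>
      unfolding B_def using member_le_sum[OF that _ assms, of w] by simp
    let ?c = "c(j := B)"
    have eq: "(\<Sum>i\<in>insert j I. ?c i * Poly_Mapping.lookup \<alpha> i) = w \<alpha> + B * Poly_Mapping.lookup \<alpha> j" for \<alpha>
    proof -
      have "(\<Sum>i\<in>I. ?c i * Poly_Mapping.lookup \<alpha> i) = w \<alpha>"
        unfolding w_def using insert.hyps by (intro sum.cong) auto
      then show ?thesis using insert.hyps by simp
    qed
    have "\<forall>i\<in>insert j I. Poly_Mapping.lookup \<alpha> i = Poly_Mapping.lookup \<beta> i"
      if S: "\<alpha> \<in> S" "\<beta> \<in> S"
        and e: "w \<alpha> + B * Poly_Mapping.lookup \<alpha> j = w \<beta> + B * Poly_Mapping.lookup \<beta> j" for \<alpha> \<beta>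
    proof -
      have "w \<alpha> = (w \<alpha> + B * Poly_Mapping.lookup \<alpha> j) mod B" using small[OF S(1)] by simp
      also have "\<dots> = w \<beta>" unfolding e using small[OF S(2)] by simp
      finally have w: "w \<alpha> = w \<beta>" .
      have "B * Poly_Mapping.lookup \<alpha> j = B * Poly_Mapping.lookup \<beta> j" using e unfolding w by (rule add_left_imp_eq)
      then have "Poly_Mapping.lookup \<alpha> j = Poly_Mapping.lookup \<beta> j" using small[OF S(1)] by (metis less_zeroE mult_left_cancel neq0_conv)
      with inj[OF S] w show ?thesis by (auto simp: w_def)
    qed
    then have "\<forall>\<alpha>\<in>S. \<forall>\<beta>\<in>S.
      (\<Sum>i\<in>insert j I. ?c i * Poly_Mapping.lookup \<alpha> i) = (\<Sum>i\<in>insert j I. ?c i * Poly_Mapping.lookup \<beta> i)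
      \<longrightarrow> (\<forall>i\<in>insert j I. Poly_Mapping.lookup \<alpha> i = Poly_Mapping.lookup \<beta> i)"
      unfolding eq by blast
    moreover have "\<forall>i. ?c i > 0" using pos by (simp add: B_def)
    ultimately show ?case by blast
  qed
  from this[OF finite, of UNIV] obtain c :: "'n \<Rightarrow> nat" where pos: "\<forall>i. c i > 0"
    and inj: "\<forall>\<alpha>\<in>S. \<forall>\<beta>\<in>S.
      (\<Sum>i\<in>UNIV. c i * Poly_Mapping.lookup \<alpha> i) = (\<Sum>i\<in>UNIV. c i * Poly_Mapping.lookup \<beta> i)
      \<longrightarrow> (\<forall>i\<in>UNIV. Poly_Mapping.lookup \<alpha> i = Poly_Mapping.lookup \<beta> i)"
    by (elim exE conjE)
  have "inj_on (\<lambda>\<alpha>. \<Sum>i\<in>UNIV. c i * Poly_Mapping.lookup \<alpha> i) S"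
    by (intro inj_onI poly_mapping_eqI) (use inj in blast)
  with pos show thesis using that[of c] by blast
qed

text \<open>Over an infinite field, two nonzero polynomials are both nonzero at some point: restrict
  them to a monomial curve on which the monomials of each stay distinct.\<close>

lemma exists_common_nonzero:
  fixes f g :: "('n::finite, 'k::field_char_0) polys"
  assumes "f \<noteq> 0" "g \<noteq> 0"
  obtains p where "eval p f \<noteq> 0" "eval p g \<noteq> 0"
proof -
  obtain c :: "'n \<Rightarrow> nat" where
    inj: "inj_on (\<lambda>\<alpha>. \<Sum>i\<in>UNIV. c i * Poly_Mapping.lookup \<alpha> i) (Poly_Mapping.keys f \<union> Poly_Mapping.keys g)"
    using exists_separating_weight[of "Poly_Mapping.keys f \<union> Poly_Mapping.keys g"] by auto
  define w where "w \<alpha> = (\<Sum>i\<in>UNIV. c i * Poly_Mapping.lookup \<alpha> i)" for \<alpha>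
  define K where "K u = (\<Sum>\<alpha>\<in>Poly_Mapping.keys u. monom (Poly_Mapping.lookup u \<alpha>) (w \<alpha>))"
    for u :: "('n, 'k) polys"
  have eval_K: "eval (\<lambda>i. t ^ c i) u = poly (K u) t" for t u
    by (simp add: eval_def K_def mpow_def w_def poly_sum poly_monom power_sum power_mult)
  have K0: "K u \<noteq> 0" if "u \<noteq> 0" "inj_on w (Poly_Mapping.keys u)" for u
  proof -
    from \<open>u \<noteq> 0\<close> obtain \<alpha> where \<alpha>: "\<alpha> \<in> Poly_Mapping.keys u" by (metis ex_in_conv keys_eq_empty)
    have "coeff (K u) (w \<alpha>) = (\<Sum>\<beta>\<in>Poly_Mapping.keys u. if \<beta> = \<alpha> then Poly_Mapping.lookup u \<beta> else 0)"
      unfolding K_def coeff_sum using that(2) \<alpha> by (intro sum.cong) (auto simp: inj_on_def)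
    also have "\<dots> = Poly_Mapping.lookup u \<alpha>" using \<alpha> by simp
    finally show ?thesis using \<alpha> by (auto simp: in_keys_iff)
  qed
  have "K f * K g \<noteq> 0"
    using K0[of f] K0[of g] assms inj unfolding w_def[symmetric] by (auto simp: inj_on_Un)
  then have "finite {t. poly (K f * K g) t = 0}" by (rule poly_roots_finite)
  then obtain t where "poly (K f * K g) t \<noteq> 0"
    using ex_new_if_finite[OF infinite_UNIV_char_0] by (metis (mono_tags, lifting) mem_Collect_eq)
  then have "eval (\<lambda>i. t ^ c i) f \<noteq> 0" "eval (\<lambda>i. t ^ c i) g \<noteq> 0" by (simp_all add: eval_K)
  then show thesis by (rule that)
qed

lemma eval_eq_0_imp:
  fixes f :: "('n::finite, 'k::field_char_0) polys"
  assumes "\<And>p. eval p f = 0"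
  shows "f = 0"
  using assms exists_common_nonzero[of f 1] by (metis eval_1 zero_neq_one)

lemma polys_mult_nonzero:
  fixes f g :: "('n::finite, 'k::field_char_0) polys"
  assumes "f \<noteq> 0" "g \<noteq> 0"
  shows "f * g \<noteq> 0"
  using exists_common_nonzero[OF assms] by (metis eval_0 eval_mult no_zero_divisors)

lemma polys_prod_nonzero:
  fixes f :: "'i \<Rightarrow> ('n::finite, 'k::field_char_0) polys"
  assumes "finite I" "\<And>i. i \<in> I \<Longrightarrow> f i \<noteq> 0"
  shows "(\<Prod>i\<in>I. f i) \<noteq> 0"
  using assms by (induction I) (auto simp: polys_mult_nonzero)

text \<open>More vectors than coordinates are linearly dependent.\<close>

lemma exists_linear_relation:
  fixes x :: "nat \<Rightarrow> nat \<Rightarrow> 'k::field"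
  assumes "r < k"
  shows "\<exists>c. (\<exists>j<k. c j \<noteq> 0) \<and> (\<forall>s<r. (\<Sum>j<k. c j * x j s) = 0)"
  using assms
proof (induction r arbitrary: k x)
  case 0
  then show ?case by (intro exI[of _ "\<lambda>_. 1"]) auto
next
  case (Suc r)
  show ?case
  proof (cases "\<exists>l<k. x l r \<noteq> 0")
    case False
    with Suc.IH[of k x] Suc.prems show ?thesis by (auto simp: less_Suc_eq)
  next
    case True
    then obtain l where l: "l < k" "x l r \<noteq> 0" by blast
    define y where "y j s = x j s - x j r / x l r * x l s" for j s
    define \<sigma> where "\<sigma> j = (if j < l then j else Suc j)" for j
    obtain d where d: "\<exists>j<k-1. d j \<noteq> 0" "\<And>s. s < r \<Longrightarrow> (\<Sum>j<k-1. d j * y (\<sigma> j) s) = 0"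
    proof -
      have "r < k - 1" using Suc.prems by simp
      from Suc.IH[OF this, of "\<lambda>j. y (\<sigma> j)"] show thesis using that by blast
    qed
    have inj: "inj \<sigma>" by (auto simp: inj_on_def \<sigma>_def split: if_splits)
    have bij: "bij_betw \<sigma> {..<k-1} ({..<k} - {l})"
      unfolding bij_betw_def
    proof
      show "inj_on \<sigma> {..<k-1}" using inj by (rule inj_on_subset) simp
      show "\<sigma> ` {..<k-1} = {..<k} - {l}"
      proof (intro equalityI subsetI)
        fix j assume "j \<in> {..<k} - {l}"
        then have "\<sigma> (if j < l then j else j - 1) = j" "(if j < l then j else j - 1) < k - 1"
          using l(1) by (auto simp: \<sigma>_def)
        then show "j \<in> \<sigma> ` {..<k-1}" by (metis imageI lessThan_iff)
      qed (auto simp: \<sigma>_def split: if_splits)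
    qed
    define e where "e j = d (inv \<sigma> j)" for j
    have e: "e (\<sigma> j) = d j" for j using inj by (simp add: e_def)
    have "(\<Sum>j\<in>{..<k} - {l}. e j * y j s) = (\<Sum>j<k-1. d j * y (\<sigma> j) s)" for s
      by (subst sum.reindex_bij_betw[OF bij, symmetric]) (simp add: e)
    with d(2) have rel: "(\<Sum>j\<in>{..<k} - {l}. e j * y j s) = 0" if "s < Suc r" for s
      using that l(2) by (auto simp: less_Suc_eq y_def)
    define c where "c = e(l := - (\<Sum>j\<in>{..<k} - {l}. e j * (x j r / x l r)))"
    have "(\<Sum>j<k. c j * x j s) = 0" if "s < Suc r" for s
    proof -
      have "(\<Sum>j<k. c j * x j s) = c l * x l s + (\<Sum>j\<in>{..<k} - {l}. c j * x j s)"
        using l(1) by (subst sum.remove[of _ l]) auto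
      also have "(\<Sum>j\<in>{..<k} - {l}. c j * x j s) = (\<Sum>j\<in>{..<k} - {l}. e j * x j s)"
        by (rule sum.cong) (auto simp: c_def)
      also have "c l * x l s + \<dots> = (\<Sum>j\<in>{..<k} - {l}. e j * y j s)"
        by (simp add: c_def y_def sum_distrib_right sum_distrib_left sum_subtractf algebra_simps)
      finally show ?thesis using rel[OF that] by simp
    qed
    moreover have "\<exists>j<k. c j \<noteq> 0"
    proof -
      from d(1) obtain j where j: "j < k-1" "d j \<noteq> 0" by blast
      then have "\<sigma> j \<in> {..<k} - {l}" using bij by (auto simp: bij_betw_def)
      with j show ?thesis using e[of j] by (intro exI[of _ "\<sigma> j"]) (auto simp: c_def)
    qed
    ultimately show ?thesis by blast
  qed
qed


section \<open>The Jacobson radical\<close>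

lemma left_idealD:
  assumes "left_ideal L"
  shows "0 \<in> L" "x \<in> L \<Longrightarrow> y \<in> L \<Longrightarrow> x + y \<in> L" "y \<in> L \<Longrightarrow> x * y \<in> L" "x \<in> L \<Longrightarrow> - x \<in> L"
    "x \<in> L \<Longrightarrow> y \<in> L \<Longrightarrow> x - y \<in> L"
proof -
  show "x \<in> L \<Longrightarrow> y \<in> L \<Longrightarrow> x - y \<in> L"
    using assms unfolding left_ideal_def diff_conv_add_uminus by blast
qed (use assms in \<open>auto simp: left_ideal_def\<close>)

lemma modular_left_idealD:
  assumes "left_ideal L" "\<And>x. x - x * e \<in> L" "e \<in> L"
  shows "L = UNIV"
proof -
  have "x \<in> L" for x
    using left_idealD(2)[OF assms(1) assms(2)[of x] left_idealD(3)[OF assms(1,3), of x]] by simp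
  then show ?thesis by auto
qed

lemma left_ideal_jacobson_radical: "left_ideal (jacobson_radical :: 'r::ring set)"
  unfolding left_ideal_def jacobson_radical_def
  by (auto dest: left_idealD simp: maximal_left_ideal_def)

text \<open>A proper modular left ideal lies in a maximal one, and left ideals above a modular one
  are proper if and only if they avoid the modular unit \<open>e\<close>.\<close>

lemma exists_maximal_left_ideal:
  fixes L :: "'r::ring set"
  assumes L: "left_ideal L" and e: "\<And>x. x - x * e \<in> L" and "e \<notin> L"
  obtains L' where "L \<subseteq> L'" "maximal_left_ideal L'" "modular_left_ideal L'" "e \<notin> L'"
proof -
  let ?A = "{L'. left_ideal L' \<and> L \<subseteq> L' \<and> e \<notin> L'}"
  have "\<exists>M\<in>?A. \<forall>X\<in>?A. M \<subseteq> X \<longrightarrow> X = M"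
  proof (rule subset_Zorn_nonempty)
    show "?A \<noteq> {}" using assms by blast
  next
    fix \<C> assume ne: "\<C> \<noteq> {}" and ch: "subset.chain ?A \<C>"
    have sub: "\<C> \<subseteq> ?A" and tot: "\<And>X Y. X \<in> \<C> \<Longrightarrow> Y \<in> \<C> \<Longrightarrow> X \<subseteq> Y \<or> Y \<subseteq> X"
      using ch unfolding subset_chain_def by blast+
    have "left_ideal (\<Union>\<C>)"
      unfolding left_ideal_def
    proof (intro conjI ballI allI)
      show "0 \<in> \<Union>\<C>" using ne sub left_idealD(1) by blast
    next
      fix x y assume "x \<in> \<Union>\<C>" "y \<in> \<Union>\<C>"
      then obtain X Y where "X \<in> \<C>" "Y \<in> \<C>" "x \<in> X" "y \<in> Y" by blast
      with tot[of X Y] obtain Z where "Z \<in> \<C>" "x \<in> Z" "y \<in> Z" by blast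
      then show "x + y \<in> \<Union>\<C>" using sub left_idealD(2) by blast
    next
      fix x y assume "y \<in> \<Union>\<C>" then show "x * y \<in> \<Union>\<C>" using sub left_idealD(3) by blast
    next
      fix y assume "y \<in> \<Union>\<C>" then show "- y \<in> \<Union>\<C>" using sub left_idealD(4) by blast
    qed
    then show "\<Union>\<C> \<in> ?A" using ne sub by blast
  qed
  then obtain M where MA: "M \<in> ?A" and MX: "\<forall>X\<in>?A. M \<subseteq> X \<longrightarrow> X = M" by (rule bexE)
  from MA have M: "left_ideal M" "L \<subseteq> M" "e \<notin> M" by auto
  have max: "X = M" if "left_ideal X" "L \<subseteq> X" "e \<notin> X" "M \<subseteq> X" for X
    using MX that by simp
  have eM: "x - x * e \<in> M" for x using e M(2) by blast
  have "maximal_left_ideal M"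
    unfolding maximal_left_ideal_def
  proof (intro conjI allI impI)
    fix X assume X: "left_ideal X \<and> M \<subseteq> X"
    show "X = M \<or> X = UNIV"
    proof (cases "e \<in> X")
      case True
      have "x - x * e \<in> X" for x using eM X by blast
      with modular_left_idealD[of X e] True X show ?thesis by blast
    next
      case False
      with max[of X] X M(2) show ?thesis by blast
    qed
  qed (use M in auto)
  moreover have "modular_left_ideal M" using M(1) eM by (auto simp: modular_left_ideal_def)
  ultimately show thesis using that M by blast
qed

text \<open>Elements of the radical are left quasi-regular: \<open>(1 + z) (1 - x) = 1\<close> in the
  unitization.\<close>

lemma jacobson_radical_left_quasi_regular:
  fixes x :: "'r::ring"
  assumes "x \<in> jacobson_radical"
  obtains z where "z - x - z * x = 0"
proof -
  let ?L = "range (\<lambda>y. y - y * x)"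
  have L: "left_ideal ?L"
    unfolding left_ideal_def
  proof (intro conjI ballI allI)
    show "0 \<in> ?L" by (rule image_eqI[of _ _ 0]) simp_all
    fix u v assume "u \<in> ?L" "v \<in> ?L"
    then obtain y z where uv: "u = y - y * x" "v = z - z * x" by blast
    have "u + v = (y + z) - (y + z) * x" unfolding uv by (simp add: algebra_simps)
    then show "u + v \<in> ?L" by blast
  next
    fix w v assume "v \<in> ?L"
    then obtain z where v: "v = z - z * x" by blast
    have "w * v = w * z - (w * z) * x" unfolding v by (simp add: algebra_simps)
    then show "w * v \<in> ?L" by blast
  next
    fix v assume "v \<in> ?L"
    then obtain z where v: "v = z - z * x" by blast
    have "- v = - z - (- z) * x" unfolding v by (simp add: algebra_simps)
    then show "- v \<in> ?L" by blast
  qed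
  have "x \<in> ?L"
  proof (rule ccontr)
    assume "x \<notin> ?L"
    then obtain L' where "maximal_left_ideal L'" "modular_left_ideal L'" "x \<notin> L'"
      using exists_maximal_left_ideal[OF L, of x] by blast
    with assms show False by (auto simp: jacobson_radical_def)
  qed
  then obtain z where z: "x = z - z * x" by blast
  have "z - (z - z * x) - z * x = 0" by simp
  then have "z - x - z * x = 0" unfolding z[symmetric] .
  then show thesis by (rule that)
qed

text \<open>The left quasi-inverse \<open>z\<close> is again in the radical, so it has a left quasi-inverse itself,
  which must be \<open>- x\<close>.\<close>

lemma jacobson_radical_quasi_regular:
  fixes x :: "'r::ring"
  assumes x: "x \<in> jacobson_radical"
  obtains z where "z - x - z * x = 0" "z - x - x * z = 0"
proof -
  note J = left_idealD[OF left_ideal_jacobson_radical]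
  obtain z where z: "z - x - z * x = 0"
    using jacobson_radical_left_quasi_regular[OF x] .
  then have zx: "z = x + z * x" by (simp add: algebra_simps)
  have "z \<in> jacobson_radical" by (subst zx) (intro J x)
  then have "- z \<in> jacobson_radical" by (rule J)
  then obtain w where w: "w - (- z) - w * (- z) = 0"
    using jacobson_radical_left_quasi_regular by blast
  then have w': "w + z + w * z = 0" by (simp add: algebra_simps)
  have "(w + z + w * z) * x = 0" unfolding w' by simp
  then have "w * x + z * x + w * (z * x) = 0" by (simp add: algebra_simps)
  moreover have "z * x = z - x" using z by (simp add: algebra_simps)
  ultimately have "w * x + (z - x) + w * (z - x) = 0" by simp
  then have "z - x + w * z = 0" by (simp add: algebra_simps)
  then have "(w + z + w * z) - (z - x + w * z) = 0" unfolding w' by simp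
  then have "w + x = 0" by (simp add: algebra_simps)
  then have "w = - x" by (simp add: eq_neg_iff_add_eq_0)
  with w' have "z - x - x * z = 0" by (simp add: algebra_simps)
  with z show thesis by (rule that)
qed

text \<open>For a maximal modular left ideal \<open>L\<close>, the left ideal of all \<open>y\<close> with \<open>y a\<close> in \<open>L\<close> is everything
  or again maximal modular.\<close>

lemma jacobson_radical_right_ideal:
  fixes x :: "'r::ring"
  assumes "x \<in> jacobson_radical"
  shows "x * a \<in> jacobson_radical"
  unfolding jacobson_radical_def
proof clarify
  fix L :: "'r set"
  assume max: "maximal_left_ideal L" and mod: "modular_left_ideal L"
  then have L: "left_ideal L" and maxD: "\<And>X. left_ideal X \<Longrightarrow> L \<subseteq> X \<Longrightarrow> X = L \<or> X = UNIV"
    by (auto simp: maximal_left_ideal_def)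
  note LD = left_idealD[OF L]
  let ?Q = "{y. y * a \<in> L}"
  have sum: "left_ideal {y * a + l | y l. y \<in> X \<and> l \<in> L}" (is "left_ideal (?S X)")
    if X: "left_ideal X" for X
    unfolding left_ideal_def
  proof (intro conjI ballI allI)
    note XD = left_idealD[OF X]
    show "0 \<in> ?S X" using XD(1) LD(1) by (auto intro!: exI[of _ 0])
    fix u v assume "u \<in> ?S X" "v \<in> ?S X"
    then obtain y l y' l' where "u = y * a + l" "v = y' * a + l'" "y \<in> X" "y' \<in> X" "l \<in> L" "l' \<in> L"
      by blast
    then have "u + v = (y + y') * a + (l + l')" "y + y' \<in> X" "l + l' \<in> L"
      using XD LD by (auto simp: algebra_simps)
    then show "u + v \<in> ?S X" by blast
  next
    note XD = left_idealD[OF X]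
    fix w v assume "v \<in> ?S X"
    then obtain y l where "v = y * a + l" "y \<in> X" "l \<in> L" by blast
    then have "w * v = (w * y) * a + w * l" "w * y \<in> X" "w * l \<in> L"
      using XD LD by (auto simp: algebra_simps)
    then show "w * v \<in> ?S X" by blast
  next
    note XD = left_idealD[OF X]
    fix v assume "v \<in> ?S X"
    then obtain y l where "v = y * a + l" "y \<in> X" "l \<in> L" by blast
    then have "- v = (- y) * a + (- l)" "- y \<in> X" "- l \<in> L"
      using XD LD by (auto simp: algebra_simps)
    then show "- v \<in> ?S X" by blast
  qed
  have sub: "L \<subseteq> ?S X" if "left_ideal X" for X
    using left_idealD(1)[OF that] by (force intro: exI[of _ 0])
  have UL: "left_ideal (UNIV :: 'r set)" by (auto simp: left_ideal_def)
  have Q: "left_ideal ?Q"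
    using LD by (auto simp: left_ideal_def algebra_simps)
  show "x * a \<in> L"
  proof (cases "?Q = UNIV")
    case True
    then show ?thesis by blast
  next
    case False
    have S: "?S UNIV = UNIV"
    proof -
      have "?S UNIV = L \<or> ?S UNIV = UNIV" using maxD[OF sum[OF UL] sub[OF UL]] .
      moreover have "y * a \<in> ?S UNIV" for y using LD(1) by (force intro: exI[of _ 0])
      ultimately show ?thesis using False by blast
    qed
    have "modular_left_ideal ?Q"
    proof -
      have "a \<in> ?S UNIV" using S by blast
      then obtain e l where el: "a = e * a + l" "l \<in> L" by blast
      have "(y - y * e) * a \<in> L" for y
      proof -
        have "l = a - e * a" using el(1) by (simp add: algebra_simps)
        moreover have "(y - y * e) * a = y * (a - e * a)" by (simp add: algebra_simps)
        ultimately have "(y - y * e) * a = y * l" by simp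
        then show ?thesis using LD(3)[OF el(2)] by simp
      qed
      then show ?thesis unfolding modular_left_ideal_def using Q by blast
    qed
    moreover have "maximal_left_ideal ?Q"
      unfolding maximal_left_ideal_def
    proof (intro conjI allI impI)
      fix X assume X: "left_ideal X \<and> ?Q \<subseteq> X"
      have "?S X = L \<or> ?S X = UNIV" using maxD[OF sum sub] X by blast
      then show "X = ?Q \<or> X = UNIV"
      proof
        assume "?S X = L"
        then have "X \<subseteq> ?Q" using LD(1) by (force intro: exI[of _ 0])
        with X show ?thesis by blast
      next
        assume U: "?S X = UNIV"
        have "y \<in> X" for y
        proof -
          have "y * a \<in> ?S X" using U by blast
          then obtain z l where zl: "y * a = z * a + l" "z \<in> X" "l \<in> L" by blast
          have "(y - z) * a = l" using zl(1) by (simp add: algebra_simps)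
          with zl(3) have "y - z \<in> ?Q" by simp
          then have "y - z + z \<in> X" using X zl(2) by (intro left_idealD(2)) auto
          then show ?thesis by simp
        qed
        then show ?thesis by blast
      qed
    qed (use Q False in auto)
    ultimately show ?thesis using assms by (auto simp: jacobson_radical_def)
  qed
qed

lemma jacobson_radical_automorphism:
  fixes \<sigma> :: "'r::ring \<Rightarrow> 'r"
  assumes "bij \<sigma>" and add: "\<And>x y. \<sigma> (x + y) = \<sigma> x + \<sigma> y" and mult: "\<And>x y. \<sigma> (x * y) = \<sigma> x * \<sigma> y"
    and x: "x \<in> jacobson_radical"
  shows "\<sigma> x \<in> jacobson_radical"
  unfolding jacobson_radical_def
proof clarify
  fix L :: "'r set"
  assume max: "maximal_left_ideal L" and mod: "modular_left_ideal L"
  have zero: "\<sigma> 0 = 0" using add[of 0 0] by simp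
  have minus: "\<sigma> (- x) = - \<sigma> x" for x using add[of x "- x"] zero by (simp add: eq_neg_iff_add_eq_0 add.commute)
  have diff: "\<sigma> (x - y) = \<sigma> x - \<sigma> y" for x y using add[of x "- y"] minus by simp
  have surj: "surj \<sigma>" and inj: "inj \<sigma>" using assms(1) by (auto simp: bij_def)
  have pre: "left_ideal (\<sigma> -` X)" if "left_ideal X" for X
    using left_idealD[OF that] by (auto simp: left_ideal_def add mult minus zero)
  have im: "left_ideal (\<sigma> ` X)" if X: "left_ideal X" for X
    unfolding left_ideal_def
  proof (intro conjI ballI allI)
    note XD = left_idealD[OF X]
    show "0 \<in> \<sigma> ` X" using XD(1) zero by (metis imageI)
    fix u v assume "u \<in> \<sigma> ` X" "v \<in> \<sigma> ` X"
    then show "u + v \<in> \<sigma> ` X" using XD(2) by (auto simp flip: add)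
  next
    note XD = left_idealD[OF X]
    fix w v assume "v \<in> \<sigma> ` X"
    moreover obtain w' where "w = \<sigma> w'" using surj by blast
    ultimately show "w * v \<in> \<sigma> ` X" using XD(3) by (auto simp flip: mult)
  next
    note XD = left_idealD[OF X]
    fix v assume "v \<in> \<sigma> ` X"
    then show "- v \<in> \<sigma> ` X" using XD(4) by (auto simp flip: minus)
  qed
  have L: "left_ideal L" "L \<noteq> UNIV" and maxD: "\<And>X. left_ideal X \<Longrightarrow> L \<subseteq> X \<Longrightarrow> X = L \<or> X = UNIV"
    using max by (auto simp: maximal_left_ideal_def)
  have "maximal_left_ideal (\<sigma> -` L)"
    unfolding maximal_left_ideal_def
  proof (intro conjI allI impI)
    show "left_ideal (\<sigma> -` L)" using pre L by blast
    show "\<sigma> -` L \<noteq> UNIV"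
    proof
      assume "\<sigma> -` L = UNIV"
      then have "range \<sigma> \<subseteq> L" by blast
      with surj L(2) show False by blast
    qed
    fix X assume X: "left_ideal X \<and> \<sigma> -` L \<subseteq> X"
    then have "L \<subseteq> \<sigma> ` X" using surj by (metis image_mono surj_image_vimage_eq)
    then have "\<sigma> ` X = L \<or> \<sigma> ` X = UNIV" using maxD im X by blast
    then show "X = \<sigma> -` L \<or> X = UNIV" using inj by (metis inj_vimage_image_eq vimage_UNIV)
  qed
  moreover have "modular_left_ideal (\<sigma> -` L)"
  proof -
    obtain e where e: "\<And>y. y - y * e \<in> L" using mod by (auto simp: modular_left_ideal_def)
    obtain e' where "e = \<sigma> e'" using surj by blast
    then have "\<sigma> (y - y * e') \<in> L" for y using e[of "\<sigma> y"] by (simp add: diff mult)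
    with pre L show ?thesis by (auto simp: modular_left_ideal_def)
  qed
  ultimately have "x \<in> \<sigma> -` L" using x by (auto simp: jacobson_radical_def)
  then show "\<sigma> x \<in> L" by simp
qed

text \<open>A maximal modular left ideal \<open>L\<close> is a subspace: otherwise \<open>L + c L\<close> is everything, and
  then \<open>x e\<close> lies in \<open>L\<close> for all \<open>x\<close>, where \<open>e\<close> is the modular unit, so that \<open>L\<close> is
  everything.\<close>

lemma jacobson_radical_scale:
  fixes s :: "'r::ring \<Rightarrow> 'r"
  assumes add: "\<And>x y. s (x + y) = s x + s y"
    and left: "\<And>x y. s x * y = s (x * y)" and right: "\<And>x y. x * s y = s (x * y)"
    and x: "x \<in> jacobson_radical"
  shows "s x \<in> jacobson_radical"
  unfolding jacobson_radical_def
proof clarify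
  fix L :: "'r set"
  assume max: "maximal_left_ideal L" and mod: "modular_left_ideal L"
  have zero: "s 0 = 0" using add[of 0 0] by simp
  have minus: "s (- x) = - s x" for x using add[of x "- x"] zero by (simp add: eq_neg_iff_add_eq_0 add.commute)
  have L: "left_ideal L" "L \<noteq> UNIV" and maxD: "\<And>X. left_ideal X \<Longrightarrow> L \<subseteq> X \<Longrightarrow> X = L \<or> X = UNIV"
    using max by (auto simp: maximal_left_ideal_def)
  note LD = left_idealD[OF L(1)]
  obtain e where e: "\<And>y. y - y * e \<in> L" using mod by (auto simp: modular_left_ideal_def)
  have xL: "x \<in> L" using x max mod by (auto simp: jacobson_radical_def)
  let ?S = "{l + s l' | l l'. l \<in> L \<and> l' \<in> L}"
  have "left_ideal ?S"
    unfolding left_ideal_def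
  proof (intro conjI ballI allI)
    show "0 \<in> ?S" using LD(1) zero by (auto intro!: exI[of _ 0])
    fix u v assume "u \<in> ?S" "v \<in> ?S"
    then obtain k k' l l' where "u = k + s k'" "v = l + s l'" and m: "k \<in> L" "k' \<in> L" "l \<in> L" "l' \<in> L"
      by blast
    then have "u + v = (k + l) + s (k' + l')" by (simp add: add algebra_simps)
    then show "u + v \<in> ?S" using m LD(2) by blast
  next
    fix w v assume "v \<in> ?S"
    then obtain l l' where "v = l + s l'" and m: "l \<in> L" "l' \<in> L" by blast
    then have "w * v = w * l + s (w * l')" by (simp add: right algebra_simps)
    then show "w * v \<in> ?S" using m LD(3) by blast
  next
    fix v assume "v \<in> ?S"
    then obtain l l' where "v = l + s l'" and m: "l \<in> L" "l' \<in> L" by blast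
    then have "- v = - l + s (- l')" by (simp add: minus)
    then show "- v \<in> ?S" using m LD(4) by blast
  qed
  moreover have "L \<subseteq> ?S"
  proof
    fix l assume "l \<in> L"
    moreover have "l = l + s 0" by (simp add: zero)
    ultimately show "l \<in> ?S" using LD(1) by blast
  qed
  ultimately have "?S = L \<or> ?S = UNIV" by (rule maxD)
  moreover have "?S \<noteq> UNIV"
  proof
    assume "?S = UNIV"
    then obtain l l' where el: "e = l + s l'" "l \<in> L" "l' \<in> L" by blast
    have "y \<in> L" for y
    proof -
      have "y * e = y * l + s y * l'" using el(1) by (simp add: algebra_simps left right)
      then have "y * e \<in> L" using el LD by simp
      then have "(y - y * e) + y * e \<in> L" using e LD by blast
      then show ?thesis by simp
    qed
    with L(2) show False by blast
  qed
  ultimately have "?S = L" by blast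
  moreover have "0 + s x \<in> ?S" using LD(1) xL by blast
  ultimately show "s x \<in> L" by simp
qed


section \<open>The radical is stable under locally nilpotent derivations\<close>

text \<open>If all values of a polynomial with vector coefficients lie in a subspace, so do the
  coefficients.  The top coefficient is eliminated by comparing the values at \<open>2 t\<close> and \<open>t\<close>.\<close>

lemma (in vector_space) coefficients_in_subspace:
  assumes J: "subspace J" and P: "\<And>t::'a. (\<Sum>k<K. scale (t ^ k) (v k)) \<in> J"
    and char0: "inj (of_nat :: nat \<Rightarrow> 'a)" and "k < K"
  shows "v k \<in> J"
  using P \<open>k < K\<close>
proof (induction K arbitrary: v k)
  case (Suc K)
  have two: "(2::'a) ^ i \<noteq> 2 ^ j" if "i \<noteq> j" for i j
  proof
    assume "(2::'a) ^ i = 2 ^ j"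
    then have "(of_nat (2 ^ i) :: 'a) = of_nat (2 ^ j)" by simp
    then have "(2::nat) ^ i = 2 ^ j" by (rule injD[OF char0])
    with that show False by simp
  qed
  have "(\<Sum>k<K. scale (t ^ k) (scale (2 ^ k - 2 ^ K) (v k))) \<in> J" for t
  proof -
    have "(\<Sum>k<Suc K. scale ((2 * t) ^ k) (v k)) - scale (2 ^ K) (\<Sum>k<Suc K. scale (t ^ k) (v k)) \<in> J"
      using Suc.prems(1) J by (intro subspace_diff subspace_scale)
    also have "(\<Sum>k<Suc K. scale ((2 * t) ^ k) (v k)) - scale (2 ^ K) (\<Sum>k<Suc K. scale (t ^ k) (v k))
      = (\<Sum>k<Suc K. scale ((2 * t) ^ k) (v k) - scale (2 ^ K) (scale (t ^ k) (v k)))"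
      by (simp only: sum_subtractf scale_sum_right)
    also have "\<dots> = (\<Sum>k<Suc K. scale (t ^ k) (scale (2 ^ k - 2 ^ K) (v k)))"
      by (rule sum.cong) (simp_all add: power_mult_distrib scale_left_diff_distrib algebra_simps)
    finally show ?thesis by simp
  qed
  note IH = Suc.IH[OF this]
  have low: "v k \<in> J" if "k < K" for k
  proof -
    have "scale (inverse (2 ^ k - 2 ^ K)) (scale (2 ^ k - 2 ^ K) (v k)) \<in> J"
      using IH[OF that] J by (rule subspace_scale[rotated])
    with two[of k K] that show ?thesis by simp
  qed
  have "(\<Sum>k<Suc K. scale (1 ^ k) (v k)) - (\<Sum>k<K. v k) \<in> J"
    by (rule subspace_diff[OF J Suc.prems(1) subspace_sum[OF J low]]) simp
  then have "v K \<in> J" by simp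
  with low Suc.prems(2) show ?case by (auto simp: less_Suc_eq)
qed simp

text \<open>The exponential \<open>exp (t d)\<close> of a locally nilpotent derivation \<open>d\<close> is an automorphism,
  so the radical is stable under it for all scalars \<open>t\<close>, and hence under its coefficient \<open>d\<close>
  at \<open>t\<close>.\<close>

lemma jacobson_radical_derivation:
  fixes scale :: "'k::field_char_0 \<Rightarrow> 'r::ring \<Rightarrow> 'r"
  assumes vs: "vector_space scale"
    and left: "\<And>c x y. scale c x * y = scale c (x * y)"
    and right: "\<And>c x y. x * scale c y = scale c (x * y)"
    and lin: "Vector_Spaces.linear scale scale d"
    and deriv: "\<And>x y. d (x * y) = d x * y + x * d y"
    and nil: "\<And>x. \<exists>N. (d ^^ N) x = 0"
    and x: "x \<in> jacobson_radical"
  shows "d x \<in> jacobson_radical"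
proof -
  interpret vector_space scale by fact
  interpret d: Vector_Spaces.linear scale scale d by fact
  \<comment> \<open>In terms of the divided powers of \<open>d\<close> the Leibniz rule has no binomial coefficients.\<close>
  define \<delta> where "\<delta> k y = scale (inverse (fact k)) ((d ^^ k) y)" for k y
  have pow_add: "(d ^^ k) (y + z) = (d ^^ k) y + (d ^^ k) z" for k y z
    by (induction k) (simp_all add: d.add)
  have pow_scale: "(d ^^ k) (scale c y) = scale c ((d ^^ k) y)" for k y c
    by (induction k) (simp_all add: d.scale)
  have pow_sum: "(d ^^ k) (sum f A) = (\<Sum>i\<in>A. (d ^^ k) (f i))" for k A and f :: "nat \<Rightarrow> 'r"
    by (induction k) (simp_all add: d.sum)
  have pow_0: "(d ^^ k) 0 = 0" for k by (induction k) (simp_all add: d.zero)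
  have \<delta>_add: "\<delta> k (y + z) = \<delta> k y + \<delta> k z" for k y z
    by (simp add: \<delta>_def pow_add scale_right_distrib)
  have \<delta>_Suc: "d (\<delta> k y) = scale (of_nat (Suc k)) (\<delta> (Suc k) y)" for k y
    by (simp add: \<delta>_def d.scale del: of_nat_Suc)
  have \<delta>_mult: "\<delta> m (y * z) = (\<Sum>i\<le>m. \<delta> i y * \<delta> (m - i) z)" for m y z
  proof (induction m)
    case 0
    show ?case by (simp add: \<delta>_def)
  next
    case (Suc m)
    let ?g = "\<lambda>i. \<delta> i y * \<delta> (Suc m - i) z"
    have "scale (of_nat (Suc m)) (\<delta> (Suc m) (y * z)) = d (\<Sum>i\<le>m. \<delta> i y * \<delta> (m - i) z)"
      by (simp only: \<delta>_Suc[symmetric] Suc.IH)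
    also have "\<dots> = (\<Sum>i\<le>m. scale (of_nat (Suc i)) (?g (Suc i))) + (\<Sum>i\<le>m. scale (of_nat (Suc m - i)) (?g i))"
      by (simp only: d.sum deriv \<delta>_Suc left right sum.distrib)
        (intro arg_cong2[where f = "(+)"] sum.cong; simp add: Suc_diff_le)
    also have "(\<Sum>i\<le>m. scale (of_nat (Suc i)) (?g (Suc i))) = (\<Sum>i\<le>Suc m. scale (of_nat i) (?g i))"
      by (subst sum.atMost_Suc_shift) simp
    also have "(\<Sum>i\<le>m. scale (of_nat (Suc m - i)) (?g i)) = (\<Sum>i\<le>Suc m. scale (of_nat (Suc m - i)) (?g i))"
      by simp
    also have "(\<Sum>i\<le>Suc m. scale (of_nat i) (?g i)) + (\<Sum>i\<le>Suc m. scale (of_nat (Suc m - i)) (?g i))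
      = (\<Sum>i\<le>Suc m. scale (of_nat i + of_nat (Suc m - i)) (?g i))"
      by (simp only: sum.distrib scale_left_distrib)
    also have "\<dots> = (\<Sum>i\<le>Suc m. scale (of_nat (Suc m)) (?g i))"
      by (rule sum.cong) (simp_all add: of_nat_diff)
    also have "\<dots> = scale (of_nat (Suc m)) (\<Sum>i\<le>Suc m. ?g i)" by (simp only: scale_sum_right)
    finally show ?case by (simp del: of_nat_Suc)
  qed
  have pow_pow: "(d ^^ i) ((d ^^ j) y) = (d ^^ (i + j)) y" for i j y
    by (simp add: funpow_add)
  have vanish: "(d ^^ k) y = 0" if "(d ^^ N) y = 0" "N \<le> k" for k N y
  proof -
    have "(d ^^ k) y = (d ^^ (k - N)) ((d ^^ N) y)" using that(2) by (simp add: pow_pow)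
    then show ?thesis using that(1) pow_0 by simp
  qed
  define N where "N y = (SOME N. (d ^^ N) y = 0)" for y
  have N: "(d ^^ N y) y = 0" for y unfolding N_def using nil by (rule someI_ex)
  define E where "E t y = (\<Sum>k\<le>N y. scale (t ^ k) (\<delta> k y))" for t y
  have E_eq: "E t y = (\<Sum>k\<le>K. scale (t ^ k) (\<delta> k y))" if "(d ^^ K) y = 0" for t y K
  proof -
    have "(\<Sum>k\<le>L. scale (t ^ k) (\<delta> k y)) = (\<Sum>k\<le>max L L'. scale (t ^ k) (\<delta> k y))"
      if "(d ^^ L) y = 0" for L L'
      using vanish[OF that] by (intro sum.mono_neutral_left) (auto simp: \<delta>_def)
    from this[OF N, of K] this[OF that, of "N y"] show ?thesis by (simp add: E_def max.commute)
  qed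
  have E_add: "E t (y + z) = E t y + E t z" for t y z
  proof -
    let ?K = "max (N y) (N z)"
    have K: "(d ^^ ?K) y = 0" "(d ^^ ?K) z = 0" using vanish[OF N] by auto
    then have "(d ^^ ?K) (y + z) = 0" by (simp add: pow_add)
    with K show ?thesis
      by (simp add: E_eq[of ?K] \<delta>_add scale_right_distrib sum.distrib)
  qed
  have E_mult: "E t (y * z) = E t y * E t z" for t y z
  proof -
    let ?K = "max (N y) (N z)"
    define a b where "a i = scale (t ^ i) (\<delta> i y)" and "b i = scale (t ^ i) (\<delta> i z)" for i
    have K: "(d ^^ ?K) y = 0" "(d ^^ ?K) z = 0" using vanish[OF N] by auto
    have a0: "a i = 0" "\<delta> i y = 0" and b0: "b i = 0" "\<delta> i z = 0" if "i \<ge> ?K" for i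
      using vanish[OF K(1) that] vanish[OF K(2) that] by (simp_all add: a_def b_def \<delta>_def)
    have "\<delta> (?K + ?K) (y * z) = 0"
      unfolding \<delta>_mult
    proof (intro sum.neutral ballI)
      fix i
      show "\<delta> i y * \<delta> (?K + ?K - i) z = 0"
        by (cases "i \<ge> ?K") (simp_all only: a0(2) b0(2) mult_zero_left mult_zero_right, linarith?)
    qed
    then have "(d ^^ (?K + ?K)) (y * z) = 0" by (simp add: \<delta>_def)
    then have "E t (y * z) = (\<Sum>k\<le>?K + ?K. scale (t ^ k) (\<delta> k (y * z)))" by (rule E_eq)
    also have "\<dots> = (\<Sum>k\<le>?K + ?K. \<Sum>i\<le>k. a i * b (k - i))"
      unfolding \<delta>_mult scale_sum_right
      by (intro sum.cong) (simp_all add: a_def b_def left right flip: power_add)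
    also have "\<dots> = (\<Sum>(i, j)\<in>{(i, j). i + j \<le> ?K + ?K}. a i * b j)"
      by (simp only: sum.triangle_reindex_eq)
    also have "\<dots> = (\<Sum>(i, j)\<in>{..?K} \<times> {..?K}. a i * b j)"
    proof (rule sum.mono_neutral_right)
      show "finite {(i, j). i + j \<le> ?K + ?K}"
        by (rule finite_subset[of _ "{..?K + ?K} \<times> {..?K + ?K}"]) auto
      show "\<forall>p\<in>{(i, j). i + j \<le> ?K + ?K} - {..?K} \<times> {..?K}. (case p of (i, j) \<Rightarrow> a i * b j) = 0"
        using a0(1) b0(1) by (auto simp del: max.bounded_iff) (metis linear mult_zero_left mult_zero_right)+
    qed auto
    also have "\<dots> = (\<Sum>i\<le>?K. a i) * (\<Sum>j\<le>?K. b j)"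
      by (simp add: sum_product sum.cartesian_product)
    also have "\<dots> = E t y * E t z" using K by (simp add: E_eq a_def b_def)
    finally show ?thesis .
  qed
  have E_comp: "E s (E t y) = E (s + t) y" for s t y
  proof -
    let ?K = "N y"
    have \<delta>_0: "\<delta> k y = 0" if "k \<ge> ?K" for k using vanish[OF N that] by (simp add: \<delta>_def)
    have \<delta>\<delta>: "\<delta> i (\<delta> j y) = scale (of_nat (i + j choose i)) (\<delta> (i + j) y)" for i j
      by (simp add: \<delta>_def pow_scale funpow_add binomial_fact field_simps)
    have "(d ^^ ?K) (E t y) = 0"
      unfolding E_def pow_sum by (intro sum.neutral) (simp add: pow_scale \<delta>_def pow_pow vanish[OF N])
    then have "E s (E t y) = (\<Sum>i\<le>?K. scale (s ^ i) (\<delta> i (\<Sum>j\<le>?K. scale (t ^ j) (\<delta> j y))))"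
      by (simp add: E_eq) (simp add: E_def)
    also have "\<dots> = (\<Sum>i\<le>?K. \<Sum>j\<le>?K. scale (s ^ i * t ^ j * of_nat (i + j choose i)) (\<delta> (i + j) y))"
    proof -
      have "\<delta> i (\<Sum>j\<le>?K. scale (t ^ j) (\<delta> j y)) = (\<Sum>j\<le>?K. scale (t ^ j) (\<delta> i (\<delta> j y)))" for i
        by (simp add: \<delta>_def[of i] pow_sum pow_scale scale_sum_right mult.commute)
      then show ?thesis by (simp add: \<delta>\<delta> scale_sum_right mult.assoc)
    qed
    also have "\<dots> = (\<Sum>(i, j)\<in>{..?K} \<times> {..?K}. scale (s ^ i * t ^ j * of_nat (i + j choose i)) (\<delta> (i + j) y))"
      by (simp add: sum.cartesian_product)
    also have "\<dots> = (\<Sum>(i, j)\<in>{(i, j). i + j \<le> ?K}. scale (s ^ i * t ^ j * of_nat (i + j choose i)) (\<delta> (i + j) y))"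
      by (rule sum.mono_neutral_right) (auto, meson \<delta>_0 nat_le_linear)
    also have "\<dots> = (\<Sum>k\<le>?K. \<Sum>i\<le>k. scale (s ^ i * t ^ (k - i) * of_nat (k choose i)) (\<delta> k y))"
      unfolding sum.triangle_reindex_eq by (intro sum.cong) auto
    also have "\<dots> = (\<Sum>k\<le>?K. scale ((s + t) ^ k) (\<delta> k y))"
      by (intro sum.cong) (simp_all add: binomial_ring scale_sum_left mult_ac)
    finally show ?thesis by (simp add: E_def)
  qed
  have E_0: "E 0 y = y" for y
  proof -
    have "E 0 y = (\<Sum>k\<le>N y. if k = 0 then y else 0)"
      unfolding E_def by (intro sum.cong) (auto simp: \<delta>_def)
    then show ?thesis by simp
  qed
  have "bij (E t)" for t
    by (rule bij_betw_byWitness[of _ "E (- t)"]) (simp_all add: E_comp E_0)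
  then have EJ: "E t x \<in> jacobson_radical" for t
    using E_add E_mult x by (rule jacobson_radical_automorphism)
  have J: "subspace jacobson_radical"
  proof -
    have "scale c y \<in> jacobson_radical" if "y \<in> jacobson_radical" for c y
      using jacobson_radical_scale[OF scale_right_distrib left right that] .
    then show ?thesis
      by (auto simp: subspace_def intro: left_idealD[OF left_ideal_jacobson_radical])
  qed
  \<comment> \<open>At least two terms, so that the coefficient of index 1 is among them.\<close>
  let ?K = "max 2 (Suc (N x))"
  have "(\<Sum>k<?K. scale (t ^ k) (\<delta> k x)) \<in> jacobson_radical" for t
  proof -
    have "(\<Sum>k<?K. scale (t ^ k) (\<delta> k x)) = (\<Sum>k\<le>N x. scale (t ^ k) (\<delta> k x))"
      by (rule sum.mono_neutral_right) (auto simp: \<delta>_def vanish[OF N])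
    then show ?thesis using EJ[of t] by (simp add: E_def)
  qed
  then have "\<delta> 1 x \<in> jacobson_radical"
    by (rule coefficients_in_subspace[OF J]) (auto intro: inj_of_nat)
  then show ?thesis by (simp add: \<delta>_def)
qed


section \<open>Modules of finite rank over the polynomial ring\<close>

text \<open>Modules over the ring of polynomials in finitely many variables.\<close>

locale polys_module = module act
  for act :: "('n::finite, 'k::field_char_0) polys \<Rightarrow> 'm::ab_group_add \<Rightarrow> 'm"
begin

lemma subspaceI_Var:
  assumes "0 \<in> N" and add: "\<And>x y. x \<in> N \<Longrightarrow> y \<in> N \<Longrightarrow> x + y \<in> N"
    and C: "\<And>c x. x \<in> N \<Longrightarrow> act (Const c) x \<in> N" and V: "\<And>i x. x \<in> N \<Longrightarrow> act (Var i) x \<in> N"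
  shows "subspace N"
proof (rule subspaceI)
  fix f x assume x: "x \<in> N"
  show "act f x \<in> N"
  proof (induction f rule: polys_induct)
    case (Var i f)
    from V[OF this, of i] show ?case by (simp flip: scale_scale)
  qed (use x add C in \<open>auto simp: scale_left_distrib\<close>)
qed (use assms in auto)

text \<open>Submodules with torsion-free quotient.\<close>

definition saturated :: "'m set \<Rightarrow> bool"
  where "saturated N \<longleftrightarrow> (\<forall>f m. f \<noteq> 0 \<longrightarrow> act f m \<in> N \<longrightarrow> m \<in> N)"

lemma saturatedD: "saturated N \<Longrightarrow> f \<noteq> 0 \<Longrightarrow> act f m \<in> N \<Longrightarrow> m \<in> N"
  by (auto simp: saturated_def)

text \<open>The preimage of the torsion submodule of the quotient by \<open>N\<close>.\<close>

definition saturation :: "'m set \<Rightarrow> 'm set"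
  where "saturation N = {m. \<exists>f. f \<noteq> 0 \<and> act f m \<in> N}"

lemma subspace_saturation:
  assumes "subspace N"
  shows "subspace (saturation N)"
proof (rule subspaceI)
  show "0 \<in> saturation N" using subspace_0[OF assms] by (auto simp: saturation_def intro!: exI[of _ 1])
next
  fix x y assume "x \<in> saturation N" "y \<in> saturation N"
  then obtain f g where fg: "f \<noteq> 0" "g \<noteq> 0" "act f x \<in> N" "act g y \<in> N" by (auto simp: saturation_def)
  have "act (f * g) (x + y) = act g (act f x) + act f (act g y)"
    by (simp add: scale_right_distrib mult.commute)
  also have "\<dots> \<in> N"
    using subspace_add[OF assms subspace_scale[OF assms fg(3)] subspace_scale[OF assms fg(4)]] .
  finally show "x + y \<in> saturation N" using fg polys_mult_nonzero by (auto simp: saturation_def)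
next
  fix c x assume "x \<in> saturation N"
  then obtain f where f: "f \<noteq> 0" "act f x \<in> N" by (auto simp: saturation_def)
  have "act f (act c x) = act c (act f x)" by (simp add: mult.commute)
  also have "\<dots> \<in> N" using subspace_scale[OF assms f(2)] .
  finally show "act c x \<in> saturation N" using f by (auto simp: saturation_def)
qed

lemma saturated_saturation: "saturated (saturation N)"
  unfolding saturated_def saturation_def using polys_mult_nonzero by fastforce

lemma saturation_superset: "N \<subseteq> saturation N"
  by (auto simp: saturation_def intro!: exI[of _ 1])

text \<open>Functionals on \<open>N / Z\<close>, as maps that are only constrained on \<open>N\<close>.\<close>

definition functional :: "'m set \<Rightarrow> 'm set \<Rightarrow> ('m \<Rightarrow> ('n, 'k) polys) \<Rightarrow> bool"
  where "functional N Z \<phi> \<longleftrightarrow>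
    (\<forall>x\<in>N. \<forall>y\<in>N. \<phi> (x + y) = \<phi> x + \<phi> y) \<and> (\<forall>f. \<forall>x\<in>N. \<phi> (act f x) = f * \<phi> x) \<and> (\<forall>z\<in>Z. \<phi> z = 0)"

lemma functionalD:
  assumes "functional N Z \<phi>"
  shows "x \<in> N \<Longrightarrow> y \<in> N \<Longrightarrow> \<phi> (x + y) = \<phi> x + \<phi> y" "x \<in> N \<Longrightarrow> \<phi> (act f x) = f * \<phi> x"
    "z \<in> Z \<Longrightarrow> \<phi> z = 0"
  using assms by (auto simp: functional_def)

lemma functional_diff:
  assumes "functional N Z \<phi>" "subspace N" "x \<in> N" "y \<in> N"
  shows "\<phi> (x - y) = \<phi> x - \<phi> y"
proof -
  have "\<phi> (x + act (- 1) y) = \<phi> x + (- 1) * \<phi> y"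
    using assms by (simp add: functionalD subspace_scale del: scale_minus_left)
  then show ?thesis by simp
qed

lemma functional_sum:
  assumes "functional N Z \<phi>" "subspace N" "\<And>i. i \<in> I \<Longrightarrow> x i \<in> N"
  shows "\<phi> (\<Sum>i\<in>I. x i) = (\<Sum>i\<in>I. \<phi> (x i))"
  using assms(3)
proof (induction I rule: infinite_finite_induct)
  case (insert i I)
  then show ?case using functionalD(1)[OF assms(1), of "x i" "sum x I"] subspace_sum[OF assms(2), of I x] by simp
qed (use functionalD(2)[OF assms(1) subspace_0[OF assms(2)], of 0] in auto)

text \<open>A coordinate system of \<open>N / Z\<close>: up to the common denominator \<open>h\<close>, each element is
  the combination of the \<open>u i\<close> with coefficients \<open>\<phi> i\<close>.\<close>

definition coordinates :: "'m set \<Rightarrow> 'm set \<Rightarrow> nat \<Rightarrow> (nat \<Rightarrow> 'm) \<Rightarrow> (nat \<Rightarrow> 'm \<Rightarrow> ('n, 'k) polys)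
    \<Rightarrow> ('n, 'k) polys \<Rightarrow> bool"
  where "coordinates N Z r u \<phi> h \<longleftrightarrow> h \<noteq> 0 \<and> (\<forall>i<r. u i \<in> N \<and> functional N Z (\<phi> i)) \<and>
    (\<forall>m\<in>N. act h m - (\<Sum>i<r. act (\<phi> i m) (u i)) \<in> Z)"

lemma coordinatesD:
  assumes "coordinates N Z r u \<phi> h"
  shows "h \<noteq> 0" "i < r \<Longrightarrow> u i \<in> N" "i < r \<Longrightarrow> functional N Z (\<phi> i)"
    "m \<in> N \<Longrightarrow> act h m - (\<Sum>i<r. act (\<phi> i m) (u i)) \<in> Z"
  using assms by (auto simp: coordinates_def)

lemma coordinates_eq_0:
  assumes "coordinates N Z r u \<phi> h" "saturated Z" "m \<in> N" "\<And>i. i < r \<Longrightarrow> \<phi> i m = 0"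
  shows "m \<in> Z"
  using coordinatesD(4)[OF assms(1,3)] assms(4) saturatedD[OF assms(2) coordinatesD(1)[OF assms(1)]]
  by simp

text \<open>A functional is determined by its values on the \<open>u i\<close>.\<close>

lemma functional_coordinates:
  assumes c: "coordinates N Z r u \<phi> h" and N: "subspace N" and Z: "Z \<subseteq> N" and \<psi>: "functional N Z \<psi>"
    and m: "m \<in> N"
  shows "h * \<psi> m = (\<Sum>i<r. \<phi> i m * \<psi> (u i))"
proof -
  note cD = coordinatesD[OF c]
  have S: "(\<Sum>i<r. act (\<phi> i m) (u i)) \<in> N"
    by (intro subspace_sum[OF N] subspace_scale[OF N] cD) auto
  have "0 = \<psi> (act h m - (\<Sum>i<r. act (\<phi> i m) (u i)))"
    using functionalD(3)[OF \<psi> cD(4)[OF m]] by simp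
  also have "\<dots> = \<psi> (act h m) - \<psi> (\<Sum>i<r. act (\<phi> i m) (u i))"
    using m by (intro functional_diff[OF \<psi> N] subspace_scale[OF N] S)
  also have "\<dots> = h * \<psi> m - (\<Sum>i<r. \<phi> i m * \<psi> (u i))"
    using m cD(2) by (subst functional_sum[OF \<psi> N]) (auto simp: functionalD(2)[OF \<psi>] subspace_scale[OF N])
  finally show ?thesis by simp
qed

text \<open>Let \<open>\<Lambda>\<close> be a module of functionals on \<open>N / Z\<close> that separate the elements of \<open>N1 / Z\<close>.  Then finitely many
  members \<open>\<psi> i\<close> of \<open>\<Lambda>\<close> already determine the elements of \<open>N1 / Z\<close>, with a common denominator \<open>g\<close>; hence they
  also determine the fibres of \<open>N1 / Z\<close> at the points where \<open>g\<close> does not vanish.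

  Take a maximal system of \<open>v i\<close> in \<open>N1\<close> and \<open>\<psi> i\<close> in \<open>\<Lambda>\<close> that is dual up to the factor \<open>g\<close>.  Its size
  is bounded by the number \<open>r\<close> of coordinates of \<open>N / Z\<close>, since otherwise evaluation at a
  general point would give more than \<open>r\<close> independent vectors in a space of dimension \<open>r\<close>.  An
  element that is not reconstructed from its values under the \<open>\<psi> i\<close> would allow an
  extension of the system.\<close>

lemma exists_dual_system:
  assumes c: "coordinates N Z r u \<phi> h" and N: "subspace N" and Z: "Z \<subseteq> N"
    and N1: "subspace N1" "N1 \<subseteq> N"
    and \<Lambda>: "\<And>\<psi>. \<psi> \<in> \<Lambda> \<Longrightarrow> functional N Z \<psi>"
    and \<Lambda>_comb: "\<And>\<psi> \<psi>' f g. \<psi> \<in> \<Lambda> \<Longrightarrow> \<psi>' \<in> \<Lambda> \<Longrightarrow> (\<lambda>m. f * \<psi> m + g * \<psi>' m) \<in> \<Lambda>"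
    and sep: "\<And>m. m \<in> N1 \<Longrightarrow> (\<And>\<psi>. \<psi> \<in> \<Lambda> \<Longrightarrow> \<psi> m = 0) \<Longrightarrow> m \<in> Z"
  obtains k :: nat and v \<psi> g where "g \<noteq> 0" "\<And>i. i < k \<Longrightarrow> v i \<in> N1" "\<And>i. i < k \<Longrightarrow> \<psi> i \<in> \<Lambda>"
    "\<And>m. m \<in> N1 \<Longrightarrow> act g m - (\<Sum>i<k. act (\<psi> i m) (v i)) \<in> Z"
proof -
  define P where "P k \<longleftrightarrow> (\<exists>v \<psi> g. g \<noteq> 0 \<and> (\<forall>i<k. v i \<in> N1 \<and> \<psi> i \<in> \<Lambda>) \<and>
    (\<forall>i<k. \<forall>j<k. \<psi> i (v j) = (if i = j then g else 0)))" for k :: nat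
  note cD = coordinatesD[OF c]
  have bound: "k \<le> r" if Pk: "P k" for k
  proof (rule ccontr)
    assume "\<not> k \<le> r"
    then have "r < k" by simp
    obtain v \<psi> g where g: "g \<noteq> 0" and mem: "\<And>i. i < k \<Longrightarrow> v i \<in> N1 \<and> \<psi> i \<in> \<Lambda>"
      and dual: "\<And>i j. i < k \<Longrightarrow> j < k \<Longrightarrow> \<psi> i (v j) = (if i = j then g else 0)"
      using Pk unfolding P_def by blast
    obtain p where p: "eval p h \<noteq> 0" "eval p g \<noteq> 0" using exists_common_nonzero[OF cD(1) g] .
    obtain a where a: "\<exists>j<k. a j \<noteq> 0" "\<And>s. s < r \<Longrightarrow> (\<Sum>j<k. a j * eval p (\<phi> s (v j))) = 0"
      using exists_linear_relation[OF \<open>r < k\<close>, of "\<lambda>j s. eval p (\<phi> s (v j))"] by blast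
    have "a i = 0" if i: "i < k" for i
    proof -
      have "a i * (eval p h * eval p g) = (\<Sum>j<k. a j * eval p (h * \<psi> i (v j)))"
      proof -
        have "(\<Sum>j<k. a j * eval p (h * \<psi> i (v j))) = (\<Sum>j<k. if j = i then a i * (eval p h * eval p g) else 0)"
          using i by (intro sum.cong) (auto simp: dual)
        then show ?thesis using i by simp
      qed
      also have "\<dots> = (\<Sum>j<k. a j * (\<Sum>s<r. eval p (\<phi> s (v j)) * eval p (\<psi> i (u s))))"
      proof (rule sum.cong[OF refl])
        fix j assume "j \<in> {..<k}"
        then have "h * \<psi> i (v j) = (\<Sum>s<r. \<phi> s (v j) * \<psi> i (u s))"
          using i mem \<Lambda> N1(2) by (intro functional_coordinates[OF c N Z]) auto
        then show "a j * eval p (h * \<psi> i (v j)) = a j * (\<Sum>s<r. eval p (\<phi> s (v j)) * eval p (\<psi> i (u s)))"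
          by (simp del: eval_mult) simp
      qed
      also have "\<dots> = (\<Sum>s<r. (\<Sum>j<k. a j * eval p (\<phi> s (v j))) * eval p (\<psi> i (u s)))"
        unfolding sum_distrib_left sum_distrib_right by (subst sum.swap) (simp add: mult.assoc)
      also have "\<dots> = 0" using a(2) by simp
      finally show ?thesis using p by simp
    qed
    with a(1) show False by blast
  qed
  have "P 0" by (auto simp: P_def intro!: exI[of _ 1])
  moreover have "\<not> (\<forall>k. P k)" using bound[of "Suc r"] by auto
  ultimately obtain k where k: "P k" "\<not> P (Suc k)" by (metis nat.induct)
  then obtain v \<psi> g where g: "g \<noteq> 0" and v: "\<And>i. i < k \<Longrightarrow> v i \<in> N1" and \<psi>: "\<And>i. i < k \<Longrightarrow> \<psi> i \<in> \<Lambda>"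
      and dual: "\<And>i j. i < k \<Longrightarrow> j < k \<Longrightarrow> \<psi> i (v j) = (if i = j then g else 0)"
    unfolding P_def by blast
  have dual_sum: "(\<Sum>j<k. c j * \<psi> i (v j)) = c i * g" "(\<Sum>j<k. c j * \<psi> j (v i)) = c i * g"
    if "i < k" for c i
  proof -
    have "(\<Sum>j<k. c j * \<psi> i (v j)) = (\<Sum>j<k. if j = i then c i * g else 0)"
      "(\<Sum>j<k. c j * \<psi> j (v i)) = (\<Sum>j<k. if j = i then c i * g else 0)"
      by (rule sum.cong; use that in \<open>simp add: dual\<close>)+
    then show "(\<Sum>j<k. c j * \<psi> i (v j)) = c i * g" "(\<Sum>j<k. c j * \<psi> j (v i)) = c i * g"
      using that by simp_all
  qed
  show thesis
  proof (rule that[OF g v \<psi>])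
    fix m assume m: "m \<in> N1"
    define m' where "m' = act g m - (\<Sum>i<k. act (\<psi> i m) (v i))"
    have S: "(\<Sum>i<k. act (\<psi> i m) (v i)) \<in> N1"
      by (intro subspace_sum[OF N1(1)] subspace_scale[OF N1(1)] v) auto
    have m': "m' \<in> N1"
      unfolding m'_def using m S by (intro subspace_diff[OF N1(1)] subspace_scale[OF N1(1)])
    have val: "\<chi> m' = g * \<chi> m - (\<Sum>i<k. \<psi> i m * \<chi> (v i))" if \<chi>: "functional N Z \<chi>" for \<chi>
    proof -
      have "\<chi> m' = \<chi> (act g m) - \<chi> (\<Sum>i<k. act (\<psi> i m) (v i))"
        unfolding m'_def using m S N1 subspace_scale[OF N] by (intro functional_diff[OF \<chi> N]) auto
      also have "\<chi> (\<Sum>i<k. act (\<psi> i m) (v i)) = (\<Sum>i<k. \<psi> i m * \<chi> (v i))"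
        using v N1(2) by (subst functional_sum[OF \<chi> N]) (auto simp: functionalD(2)[OF \<chi>] subspace_scale[OF N] subset_iff)
      finally show ?thesis using m N1(2) by (auto simp: functionalD(2)[OF \<chi>])
    qed
    have "m' \<in> Z"
    proof (rule ccontr)
      assume "m' \<notin> Z"
      with sep[OF m'] obtain \<chi> where \<chi>: "\<chi> \<in> \<Lambda>" "\<chi> m' \<noteq> 0" by blast
      \<comment> \<open>Make \<open>\<chi>\<close> vanish on the \<open>v i\<close>; then \<open>m'\<close> and \<open>\<chi>\<close> extend the dual system, with new
        factor \<open>g (g ?q)\<close>.\<close>
      have comb: "(\<lambda>x. g * \<chi> x - (\<Sum>i<l. \<chi> (v i) * \<psi> i x)) \<in> \<Lambda>" if "l \<le> k" for l
        using that
      proof (induction l)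
        case 0
        show ?case using \<Lambda>_comb[OF \<chi>(1) \<chi>(1), of g 0] by simp
      next
        case (Suc l)
        then show ?case
          using \<Lambda>_comb[OF Suc.IH \<psi>[of l], of 1 "- \<chi> (v l)"] by (simp add: diff_diff_eq algebra_simps)
      qed
      define \<chi>' where "\<chi>' = (\<lambda>x. g * \<chi> x - (\<Sum>i<k. \<chi> (v i) * \<psi> i x))"
      have \<chi>'\<Lambda>: "\<chi>' \<in> \<Lambda>" unfolding \<chi>'_def by (rule comb) simp
      have \<psi>m': "\<psi> i m' = 0" if "i < k" for i
        using that by (simp add: val \<Lambda> \<psi> dual_sum mult.commute)
      have \<chi>'v: "\<chi>' (v j) = 0" if "j < k" for j
        using that by (simp add: \<chi>'_def dual_sum mult.commute)
      have \<chi>'m': "\<chi>' m' = g * \<chi> m'" by (simp add: \<chi>'_def \<psi>m')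
      let ?q = "\<chi> m'"
      let ?v = "v(k := m')" and ?\<psi> = "\<lambda>i. if i < k then (\<lambda>x. (g * ?q) * \<psi> i x + 0 * \<psi> i x) else (\<lambda>x. g * \<chi>' x + 0 * \<chi>' x)"
      have "g * (g * ?q) \<noteq> 0" using g \<chi>(2) by (simp add: polys_mult_nonzero)
      moreover have "\<forall>i<Suc k. ?v i \<in> N1 \<and> ?\<psi> i \<in> \<Lambda>"
      proof (intro allI impI conjI)
        fix i assume "i < Suc k"
        then show "?v i \<in> N1" using v m' by (auto simp: less_Suc_eq)
        show "?\<psi> i \<in> \<Lambda>"
        proof (cases "i < k")
          case True
          then show ?thesis using \<Lambda>_comb[OF \<psi>[OF True] \<psi>[OF True], of "g * ?q" 0] by simp
        next
          case False
          then show ?thesis using \<Lambda>_comb[OF \<chi>'\<Lambda> \<chi>'\<Lambda>, of g 0] by simp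
        qed
      qed
      moreover have "\<forall>i<Suc k. \<forall>j<Suc k. ?\<psi> i (?v j) = (if i = j then g * (g * ?q) else 0)"
        by (auto simp: less_Suc_eq dual \<psi>m' \<chi>'v \<chi>'m' mult_ac)
      ultimately have "P (Suc k)"
        unfolding P_def by (intro exI[of _ ?v] exI[of _ ?\<psi>] exI[of _ "g * (g * ?q)"] conjI)
      with k(2) show False ..
    qed
    then show "act g m - (\<Sum>i<k. act (\<psi> i m) (v i)) \<in> Z" by (simp add: m'_def)
  qed
qed

end

text \<open>Finitely generated modules, with a fixed finite set of generators.\<close>

locale fg_polys_module = polys_module act
  for act :: "('n::finite, 'k::field_char_0) polys \<Rightarrow> 'm::ab_group_add \<Rightarrow> 'm" +
  fixes G :: "'m set"
  assumes finite_G: "finite G" and span_G: "span G = UNIV"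
begin

text \<open>Linear independence of \<open>u 0, \<dots>, u (r - 1)\<close> in the quotient by \<open>Z\<close>.\<close>

definition independent_mod :: "'m set \<Rightarrow> nat \<Rightarrow> (nat \<Rightarrow> 'm) \<Rightarrow> bool"
  where "independent_mod Z r u \<longleftrightarrow>
    (\<forall>c. (\<Sum>i<r. act (c i) (u i)) \<in> Z \<longrightarrow> (\<forall>i<r. c i = 0))"

lemma independent_modD:
  assumes "independent_mod Z r u" "(\<Sum>i<r. act (c i) (u i)) \<in> Z" "i < r"
  shows "c i = 0"
  using assms by (simp add: independent_mod_def)

definition has_independent :: "'m set \<Rightarrow> nat \<Rightarrow> bool"
  where "has_independent Z r \<longleftrightarrow> (\<exists>u. (\<forall>i<r. u i \<in> G) \<and> independent_mod Z r u)"

text \<open>The rank of the quotient by \<open>Z\<close>, as the maximal number of independent elements among the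
  given generators.\<close>

definition corank :: "'m set \<Rightarrow> nat"
  where "corank Z = (GREATEST r. has_independent Z r)"

lemma has_independent_bound:
  assumes "has_independent Z r" "0 \<in> Z"
  shows "r \<le> card G"
proof -
  obtain u where u: "\<forall>i<r. u i \<in> G" "independent_mod Z r u"
    using assms by (auto simp: has_independent_def)
  have "inj_on u {..<r}"
  proof (rule inj_onI, rule ccontr)
    fix i j assume ij: "i \<in> {..<r}" "j \<in> {..<r}" "u i = u j" "i \<noteq> j"
    let ?c = "\<lambda>l. if l = i then 1 else if l = j then - 1 else 0"
    have "(\<Sum>l<r. act (?c l) (u l)) = (\<Sum>l\<in>{i, j}. act (?c l) (u l))"
      using ij by (intro sum.mono_neutral_right) auto
    also have "\<dots> = 0" using ij by simp
    finally have S: "(\<Sum>l<r. act (?c l) (u l)) \<in> Z" using assms(2) by simp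
    have "i < r" using ij(1) by simp
    from independent_modD[where c = ?c, OF u(2) S this] show False by simp
  qed
  moreover have "u ` {..<r} \<subseteq> G" using u(1) by auto
  ultimately show ?thesis using card_inj_on_le[OF _ _ finite_G] by fastforce
qed

lemma corank:
  assumes "0 \<in> Z"
  shows "has_independent Z (corank Z)" "has_independent Z r \<Longrightarrow> r \<le> corank Z" "corank Z \<le> card G"
proof -
  have 0: "has_independent Z 0" by (auto simp: has_independent_def independent_mod_def)
  show *: "has_independent Z (corank Z)"
    unfolding corank_def by (rule GreatestI_nat[where P = "has_independent Z", OF 0]) (use has_independent_bound assms in blast)
  show "has_independent Z r \<Longrightarrow> r \<le> corank Z"
    unfolding corank_def by (rule Greatest_le_nat) (use has_independent_bound assms in blast)+
  show "corank Z \<le> card G" using has_independent_bound[OF * assms] .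
qed

text \<open>Modulo a maximal independent family of generators, every generator and hence every element
  is torsion, with a common denominator for all elements because there are finitely many
  generators.\<close>

lemma common_denominator:
  assumes Z: "subspace Z" and uG: "\<forall>i<r. u i \<in> G" and u: "independent_mod Z r u"
    and max: "\<not> has_independent Z (Suc r)"
  shows "\<exists>h c. h \<noteq> 0 \<and> (\<forall>m. act h m - (\<Sum>i<r. act (c m i) (u i)) \<in> Z)"
proof -
  have "\<exists>h c. h \<noteq> 0 \<and> act h g - (\<Sum>i<r. act (c i) (u i)) \<in> Z" if g: "g \<in> G" for g
  proof -
    have "\<not> independent_mod Z (Suc r) (u(r := g))"
    proof
      assume "independent_mod Z (Suc r) (u(r := g))"
      moreover have "\<forall>i<Suc r. (u(r := g)) i \<in> G" using uG g by (auto simp: less_Suc_eq)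
      ultimately show False using max unfolding has_independent_def by blast
    qed
    then obtain c where c: "(\<Sum>i<Suc r. act (c i) ((u(r := g)) i)) \<in> Z" "\<exists>i<Suc r. c i \<noteq> 0"
      unfolding independent_mod_def by blast
    have S: "(\<Sum>i<Suc r. act (c i) ((u(r := g)) i)) = (\<Sum>i<r. act (c i) (u i)) + act (c r) g"
      by simp
    have "c r \<noteq> 0"
    proof
      assume "c r = 0"
      with c u show False unfolding S independent_mod_def by (auto simp: less_Suc_eq)
    qed
    moreover have "act (c r) g - (\<Sum>i<r. act (- c i) (u i)) \<in> Z"
      using c(1) unfolding S by (simp add: sum_negf add.commute)
    ultimately show ?thesis by (intro exI[of _ "c r"] exI[of _ "\<lambda>i. - c i"]) simp
  qed
  then obtain H C where H: "\<And>g. g \<in> G \<Longrightarrow> H g \<noteq> 0"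
    and C: "\<And>g. g \<in> G \<Longrightarrow> act (H g) g - (\<Sum>i<r. act (C g i) (u i)) \<in> Z"
    by metis
  define h where "h = (\<Prod>g\<in>G. H g)"
  let ?S = "{m. \<exists>c. act h m - (\<Sum>i<r. act (c i) (u i)) \<in> Z}"
  have "subspace ?S"
  proof (rule subspaceI)
    show "0 \<in> ?S" using subspace_0[OF Z] by (auto intro!: exI[of _ "\<lambda>_. 0"])
  next
    fix x y assume "x \<in> ?S" "y \<in> ?S"
    then obtain c d where "act h x - (\<Sum>i<r. act (c i) (u i)) \<in> Z" "act h y - (\<Sum>i<r. act (d i) (u i)) \<in> Z"
      by blast
    from subspace_add[OF Z this] show "x + y \<in> ?S"
      by (auto intro!: exI[of _ "\<lambda>i. c i + d i"] simp: scale_left_distrib scale_right_distrib sum.distrib algebra_simps)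
  next
    fix f x assume "x \<in> ?S"
    then obtain c where "act h x - (\<Sum>i<r. act (c i) (u i)) \<in> Z" by blast
    from subspace_scale[OF Z this, of f] have "act h (act f x) - (\<Sum>i<r. act (f * c i) (u i)) \<in> Z"
      by (simp add: scale_right_diff_distrib scale_sum_right mult.commute)
    then show "act f x \<in> ?S" by (intro CollectI exI[of _ "\<lambda>i. f * c i"])
  qed
  moreover have "G \<subseteq> ?S"
  proof
    fix g assume g: "g \<in> G"
    let ?f = "\<Prod>g'\<in>G - {g}. H g'"
    have h: "h = ?f * H g" unfolding h_def using g finite_G by (simp add: prod.remove mult.commute)
    have "act h g - (\<Sum>i<r. act (?f * C g i) (u i)) \<in> Z"
      using subspace_scale[OF Z C[OF g], of ?f] by (simp add: h scale_right_diff_distrib scale_sum_right)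
    then show "g \<in> ?S" by (intro CollectI exI[of _ "\<lambda>i. ?f * C g i"])
  qed
  ultimately have "span G \<subseteq> ?S" by (rule span_minimal[rotated])
  then have "\<forall>m. \<exists>c. act h m - (\<Sum>i<r. act (c i) (u i)) \<in> Z" using span_G by auto
  then have "\<exists>c. \<forall>m. act h m - (\<Sum>i<r. act (c m i) (u i)) \<in> Z" by (rule choice)
  moreover have "h \<noteq> 0" unfolding h_def by (rule polys_prod_nonzero[OF finite_G H])
  ultimately show ?thesis by blast
qed

lemma exists_coordinates:
  assumes Z: "subspace Z"
  obtains r u \<phi> h where "coordinates UNIV Z r u \<phi> h"
proof -
  define r where "r = corank Z"
  have "has_independent Z r" "\<not> has_independent Z (Suc r)"
    using corank[OF subspace_0[OF Z]] unfolding r_def by (blast, fastforce)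
  then obtain u where uG: "\<forall>i<r. u i \<in> G" and u: "independent_mod Z r u"
    and max: "\<not> has_independent Z (Suc r)"
    unfolding has_independent_def by blast
  obtain h \<Phi> where h: "h \<noteq> 0" and \<Phi>': "\<forall>m. act h m - (\<Sum>i<r. act (\<Phi> m i) (u i)) \<in> Z"
    using common_denominator[OF Z uG u max] by (elim exE conjE) (rule that)
  note \<Phi> = \<Phi>'[rule_format]
  have uniq: "\<Phi> m i = c i" if "act h m - (\<Sum>i<r. act (c i) (u i)) \<in> Z" "i < r" for m c i
  proof -
    have "(\<Sum>i<r. act (\<Phi> m i - c i) (u i)) \<in> Z"
      using subspace_diff[OF Z that(1) \<Phi>[of m]] by (simp add: scale_left_diff_distrib sum_subtractf)
    from independent_modD[where c = "\<lambda>i. \<Phi> m i - c i", OF u this that(2)] show ?thesis by simp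
  qed
  have "functional UNIV Z (\<lambda>m. \<Phi> m i)" if i: "i < r" for i
    unfolding functional_def
  proof (intro conjI ballI allI)
    fix x y
    from subspace_add[OF Z \<Phi>[of x] \<Phi>[of y]]
    have "act h (x + y) - (\<Sum>i<r. act (\<Phi> x i + \<Phi> y i) (u i)) \<in> Z"
      by (simp add: scale_left_distrib scale_right_distrib sum.distrib algebra_simps)
    from uniq[where c = "\<lambda>i. \<Phi> x i + \<Phi> y i", OF this i] show "\<Phi> (x + y) i = \<Phi> x i + \<Phi> y i" .
  next
    fix f x
    from subspace_scale[OF Z \<Phi>[of x], of f] have "act h (act f x) - (\<Sum>i<r. act (f * \<Phi> x i) (u i)) \<in> Z"
      by (simp add: scale_right_diff_distrib scale_sum_right mult.commute)
    from uniq[where c = "\<lambda>i. f * \<Phi> x i", OF this i] show "\<Phi> (act f x) i = f * \<Phi> x i" .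
  next
    fix z assume "z \<in> Z"
    then have "act h z - (\<Sum>i<r. act 0 (u i)) \<in> Z" using Z by (simp add: subspace_scale)
    from uniq[where c = "\<lambda>i. 0", OF this i] show "\<Phi> z i = 0" .
  qed
  then have "coordinates UNIV Z r u (\<lambda>i m. \<Phi> m i) h"
    using h \<Phi> by (simp add: coordinates_def)
  then show thesis by (rule that)
qed

text \<open>By means of a dual system, coordinates on the whole module give coordinates on a
  submodule, although the submodule comes without a finite set of generators.\<close>

lemma exists_coordinates_submodule:
  assumes Z: "subspace Z" "saturated Z" and N: "subspace N" "Z \<subseteq> N"
  obtains r u \<phi> h where "coordinates N Z r u \<phi> h"
proof -
  obtain r u \<phi> h where c: "coordinates UNIV Z r u \<phi> h" using exists_coordinates[OF Z(1)] .
  have sep: "m \<in> Z" if "\<And>\<psi>. functional UNIV Z \<psi> \<Longrightarrow> \<psi> m = 0" for m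
    by (rule coordinates_eq_0[OF c Z(2)]) (use that coordinatesD(3)[OF c] in auto)
  have comb: "functional UNIV Z (\<lambda>m. f * \<psi> m + g * \<psi>' m)" if "functional UNIV Z \<psi>" "functional UNIV Z \<psi>'"
    for f g \<psi> \<psi>'
    using that by (simp add: functional_def algebra_simps)
  obtain k :: nat and v \<psi> g where "g \<noteq> 0" "\<And>i. i < k \<Longrightarrow> v i \<in> N" "\<And>i. i < k \<Longrightarrow> functional UNIV Z (\<psi> i)"
    "\<And>m. m \<in> N \<Longrightarrow> act g m - (\<Sum>i<k. act (\<psi> i m) (v i)) \<in> Z"
    by (rule exists_dual_system[OF c subspace_UNIV, of N "{\<psi>. functional UNIV Z \<psi>}"])
      (use N sep comb in auto)
  then have "coordinates N Z k v \<psi> g"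
    by (auto simp: coordinates_def functional_def)
  then show thesis by (rule that)
qed

text \<open>Independence modulo \<open>Z'\<close> implies independence modulo the smaller \<open>Z\<close>.  If the coranks
  were equal, a maximal independent family modulo \<open>Z'\<close> would be maximal modulo \<open>Z\<close>, and then
  elements of \<open>Z'\<close> would be torsion modulo \<open>Z\<close>.\<close>

lemma corank_strict_mono:
  assumes Z: "subspace Z" "saturated Z" and Z': "subspace Z'" and "Z \<subset> Z'"
  shows "corank Z' < corank Z"
proof -
  note c = corank[OF subspace_0[OF Z(1)]] and c' = corank[OF subspace_0[OF Z']]
  obtain u where uG: "\<forall>i<corank Z'. u i \<in> G" and u': "independent_mod Z' (corank Z') u"
    using c'(1) unfolding has_independent_def by blast
  have u: "independent_mod Z (corank Z') u"
    using u' \<open>Z \<subset> Z'\<close> unfolding independent_mod_def by blast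
  have "corank Z' \<le> corank Z" using uG u by (intro c(2)) (auto simp: has_independent_def)
  moreover have "corank Z' \<noteq> corank Z"
  proof
    assume eq: "corank Z' = corank Z"
    then have "\<not> has_independent Z (Suc (corank Z'))" using c(2) by fastforce
    then obtain h b where h: "h \<noteq> 0" "\<forall>m. act h m - (\<Sum>i<corank Z'. act (b m i) (u i)) \<in> Z"
      using common_denominator[OF Z(1) uG u] by blast
    obtain m where m: "m \<in> Z'" "m \<notin> Z" using \<open>Z \<subset> Z'\<close> by blast
    define a where "a = b m"
    have a: "act h m - (\<Sum>i<corank Z'. act (a i) (u i)) \<in> Z" using h(2) by (simp add: a_def)
    have "act h m - (act h m - (\<Sum>i<corank Z'. act (a i) (u i))) \<in> Z'"
      by (rule subspace_diff[OF Z' subspace_scale[OF Z' m(1)]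
            subsetD[OF psubset_imp_subset[OF \<open>Z \<subset> Z'\<close>] a]])
    then have "(\<Sum>i<corank Z'. act (a i) (u i)) \<in> Z'" by simp
    from independent_modD[OF u' this] have "\<forall>i<corank Z'. a i = 0" by blast
    with a have "act h m \<in> Z" by simp
    with m(2) saturatedD[OF Z(2) h(1)] show False by blast
  qed
  ultimately show ?thesis by simp
qed

end


section \<open>Algebras of operators generated by families of derivatives\<close>

text \<open>The decompositions of an exponent as an ordered sum of two exponents.\<close>

definition antidiagonal :: "('n \<Rightarrow>\<^sub>0 nat) \<Rightarrow> (('n \<Rightarrow>\<^sub>0 nat) \<times> ('n \<Rightarrow>\<^sub>0 nat)) set"
  where "antidiagonal \<delta> = {(\<beta>, \<alpha>). \<beta> + \<alpha> = \<delta>}"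

lemma exponent_cases:
  fixes \<alpha> :: "'n \<Rightarrow>\<^sub>0 nat"
  obtains "Poly_Mapping.lookup \<alpha> i = 0" | \<alpha>' where "\<alpha> = \<alpha>' + Poly_Mapping.single i 1"
proof (cases "Poly_Mapping.lookup \<alpha> i = 0")
  case False
  have "\<alpha> = (\<alpha> - Poly_Mapping.single i 1) + Poly_Mapping.single i 1"
    using False by (intro poly_mapping_eqI) (auto simp: lookup_add lookup_minus lookup_single when_def)
  then show thesis by (rule that(2))
qed

lemma add_single_swap: "(\<beta> + Poly_Mapping.single i 1) + \<alpha> = (\<beta> + \<alpha>) + Poly_Mapping.single i (1::nat)"
  by (simp add: ac_simps)

lemma finite_antidiagonal: "finite (antidiagonal (\<delta> :: 'n::finite \<Rightarrow>\<^sub>0 nat))"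
proof (induction \<delta> rule: exponent_induct)
  case zero
  have "antidiagonal (0 :: 'n \<Rightarrow>\<^sub>0 nat) \<subseteq> {(0, 0)}"
  proof clarify
    fix \<beta> \<alpha> :: "'n \<Rightarrow>\<^sub>0 nat" assume "(\<beta>, \<alpha>) \<in> antidiagonal 0"
    then have "Poly_Mapping.lookup (\<beta> + \<alpha>) i = 0" for i by (simp add: antidiagonal_def)
    then show "\<beta> = 0 \<and> \<alpha> = 0" by (auto intro!: poly_mapping_eqI simp: lookup_add)
  qed
  then show ?case by (rule finite_subset) simp
next
  case (step \<delta> i)
  let ?e = "Poly_Mapping.single i (1::nat)"
  have "antidiagonal (\<delta> + ?e) \<subseteq> (\<lambda>(\<beta>, \<alpha>). (\<beta> + ?e, \<alpha>)) ` antidiagonal \<delta> \<union> (\<lambda>(\<beta>, \<alpha>). (\<beta>, \<alpha> + ?e)) ` antidiagonal \<delta>"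
  proof clarify
    fix \<beta> \<alpha> :: "'n \<Rightarrow>\<^sub>0 nat"
    assume "(\<beta>, \<alpha>) \<in> antidiagonal (\<delta> + ?e)"
      and n: "(\<beta>, \<alpha>) \<notin> (\<lambda>(\<beta>, \<alpha>). (\<beta>, \<alpha> + ?e)) ` antidiagonal \<delta>"
    then have s: "\<beta> + \<alpha> = \<delta> + ?e" by (simp add: antidiagonal_def)
    show "(\<beta>, \<alpha>) \<in> (\<lambda>(\<beta>, \<alpha>). (\<beta> + ?e, \<alpha>)) ` antidiagonal \<delta>"
    proof (cases \<beta> i rule: exponent_cases)
      case 1
      show ?thesis
      proof (cases \<alpha> i rule: exponent_cases)
        case 1
        with \<open>Poly_Mapping.lookup \<beta> i = 0\<close> have "Poly_Mapping.lookup (\<beta> + \<alpha>) i = 0" by (simp add: lookup_add)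
        then show ?thesis unfolding s by (simp add: lookup_add)
      next
        case (2 \<alpha>')
        with s have "(\<beta> + \<alpha>') + ?e = \<delta> + ?e" by (simp add: add.assoc)
        then have "(\<beta>, \<alpha>') \<in> antidiagonal \<delta>" by (simp add: antidiagonal_def)
        with n 2 show ?thesis by force
      qed
    next
      case (2 \<beta>')
      with s have "(\<beta>' + \<alpha>) + ?e = \<delta> + ?e" by (simp only: add_single_swap)
      then have "(\<beta>', \<alpha>) \<in> antidiagonal \<delta>" by (simp add: antidiagonal_def)
      with 2 show ?thesis by force
    qed
  qed
  then show ?case by (rule finite_subset) (use step in simp)
qed

lemma sum_antidiagonal_shift:
  fixes F :: "('n::finite \<Rightarrow>\<^sub>0 nat) \<Rightarrow> ('n \<Rightarrow>\<^sub>0 nat) \<Rightarrow> 'b::comm_monoid_add"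
  assumes "\<And>\<beta> \<alpha>. Poly_Mapping.lookup \<beta> i = 0 \<Longrightarrow> F \<beta> \<alpha> = 0"
  shows "(\<Sum>(\<beta>, \<alpha>)\<in>antidiagonal (\<delta> + Poly_Mapping.single i 1). F \<beta> \<alpha>)
    = (\<Sum>(\<beta>, \<alpha>)\<in>antidiagonal \<delta>. F (\<beta> + Poly_Mapping.single i 1) \<alpha>)"
proof -
  let ?e = "Poly_Mapping.single i (1::nat)"
  let ?s = "\<lambda>(\<beta>, \<alpha>). (\<beta> + ?e, \<alpha>)"
  have "(\<Sum>(\<beta>, \<alpha>)\<in>antidiagonal \<delta>. F (\<beta> + ?e) \<alpha>) = (\<Sum>(\<beta>, \<alpha>)\<in>?s ` antidiagonal \<delta>. F \<beta> \<alpha>)"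
    by (subst sum.reindex) (auto simp: inj_on_def intro!: sum.cong)
  also have "\<dots> = (\<Sum>(\<beta>, \<alpha>)\<in>antidiagonal (\<delta> + ?e). F \<beta> \<alpha>)"
  proof (rule sum.mono_neutral_left[OF finite_antidiagonal])
    show "?s ` antidiagonal \<delta> \<subseteq> antidiagonal (\<delta> + ?e)"
      by (auto simp: antidiagonal_def ac_simps)
    show "\<forall>p\<in>antidiagonal (\<delta> + ?e) - ?s ` antidiagonal \<delta>. (case p of (\<beta>, \<alpha>) \<Rightarrow> F \<beta> \<alpha>) = 0"
    proof clarify
      fix \<beta> \<alpha> assume a: "(\<beta>, \<alpha>) \<in> antidiagonal (\<delta> + ?e)" "(\<beta>, \<alpha>) \<notin> ?s ` antidiagonal \<delta>"
      show "F \<beta> \<alpha> = 0"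
      proof (cases \<beta> i rule: exponent_cases)
        case 1
        then show ?thesis by (rule assms)
      next
        case (2 \<beta>')
        with a(1) have "(\<beta>' + \<alpha>) + ?e = \<delta> + ?e" unfolding antidiagonal_def by (simp only: add_single_swap mem_Collect_eq case_prod_conv)
        then have "(\<beta>', \<alpha>) \<in> antidiagonal \<delta>" by (simp add: antidiagonal_def)
        with a(2) 2 show ?thesis by force
      qed
    qed
  qed
  finally show ?thesis ..
qed

lemma sum_antidiagonal_swap:
  "(\<Sum>(\<beta>, \<alpha>)\<in>antidiagonal \<delta>. F \<alpha> \<beta>) = (\<Sum>(\<beta>, \<alpha>)\<in>antidiagonal \<delta>. F \<beta> \<alpha>)"
  by (rule sum.reindex_bij_witness[of _ prod.swap prod.swap])
    (auto simp: antidiagonal_def add.commute)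

context polys_module
begin

lemma act_minus_Var: "act (Const a - Var i) m = act (Const a) m - act (Var i) m"
  by (simp add: scale_left_diff_distrib)

text \<open>Let \<open>c\<close> be a family of operators on \<open>N\<close>, taken modulo \<open>X\<close>, whose commutator with the
  variable \<open>i\<close> lowers the index by the unit vector at \<open>i\<close>.  If all members of the family kill
  \<open>f m\<close>, where \<open>f \<noteq> 0\<close>, then they kill \<open>m\<close>.  Otherwise take the top exponent \<open>\<beta>\<close> of \<open>f\<close> and a top index
  \<open>\<alpha>\<close> with \<open>c \<alpha> m \<noteq> 0\<close>, with respect to some additive weight, to see that \<open>c (\<beta> + \<alpha>) (f m)\<close>
  is a nonzero multiple of \<open>c \<alpha> m\<close>.\<close>

lemma torsion_lemma:
  fixes c :: "('n \<Rightarrow>\<^sub>0 nat) \<Rightarrow> 'm \<Rightarrow> 'm"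
  assumes X: "subspace X" and N: "subspace N"
    and add: "\<And>\<alpha> u v. c \<alpha> (u + v) = c \<alpha> u + c \<alpha> v"
    and Const: "\<And>\<alpha> a u. c \<alpha> (act (Const a) u) = act (Const a) (c \<alpha> u)"
    and Var: "\<And>\<alpha> i u. u \<in> N \<Longrightarrow> c (\<alpha> + Poly_Mapping.single i 1) (act (Var i) u)
        - act (Var i) (c (\<alpha> + Poly_Mapping.single i 1) u) - c \<alpha> u \<in> X"
    and Var0: "\<And>\<alpha> i u. u \<in> N \<Longrightarrow> Poly_Mapping.lookup \<alpha> i = 0 \<Longrightarrow>
        c \<alpha> (act (Var i) u) - act (Var i) (c \<alpha> u) \<in> X"
    and fin: "finite {\<alpha>. c \<alpha> m \<notin> X}" and m: "m \<in> N"
    and f: "f \<noteq> 0" "\<And>\<alpha>. c \<alpha> (act f m) \<in> X"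
  shows "c \<gamma> m \<in> X"
proof (rule ccontr)
  assume \<gamma>: "c \<gamma> m \<notin> X"
  let ?S = "{\<alpha>. c \<alpha> m \<notin> X}"
  obtain q :: "'n \<Rightarrow> nat" where q: "\<And>i. q i > 0"
    and inj: "inj_on (\<lambda>\<alpha>. \<Sum>i\<in>UNIV. q i * Poly_Mapping.lookup \<alpha> i) (Poly_Mapping.keys f)"
    using exists_separating_weight[OF finite_keys[of f]] by metis
  define w where "w \<alpha> = (\<Sum>i\<in>UNIV. q i * Poly_Mapping.lookup \<alpha> i)" for \<alpha>
  have w_add: "w (\<alpha> + \<beta>) = w \<alpha> + w \<beta>" for \<alpha> \<beta>
    by (simp add: w_def lookup_add algebra_simps sum.distrib)
  have w_single: "w (Poly_Mapping.single i 1) > 0" for i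
    unfolding w_def using q[of i] by (intro sum_pos2[of _ i]) auto
  have w0: "w 0 = 0" by (simp add: w_def)
  define \<mu> where "\<mu> = Max (w ` ?S)"
  have "\<mu> \<in> w ` ?S" unfolding \<mu>_def by (rule Max_in) (use fin \<gamma> in auto)
  then obtain \<alpha>0 where \<alpha>0: "c \<alpha>0 m \<notin> X" "w \<alpha>0 = \<mu>" by auto
  have \<mu>: "c \<alpha> m \<in> X" if "w \<alpha> > \<mu>" for \<alpha>
  proof (rule ccontr)
    assume "c \<alpha> m \<notin> X"
    then have "w \<alpha> \<le> \<mu>" unfolding \<mu>_def by (intro Max_ge) (use fin in auto)
    with that show False by simp
  qed
  have "Max (w ` Poly_Mapping.keys f) \<in> w ` Poly_Mapping.keys f"
    by (rule Max_in) (use f(1) in auto)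
  then obtain \<beta>0 where \<beta>0: "\<beta>0 \<in> Poly_Mapping.keys f" "w \<beta>0 = Max (w ` Poly_Mapping.keys f)" by auto
  have less: "w \<beta> < w \<beta>0" if "\<beta> \<in> Poly_Mapping.keys f" "\<beta> \<noteq> \<beta>0" for \<beta>
  proof -
    have "w \<beta> \<le> w \<beta>0" unfolding \<beta>0(2) using that by (intro Max_ge) auto
    moreover have "w \<beta> \<noteq> w \<beta>0" using inj that \<beta>0(1) by (auto simp: inj_on_def w_def)
    ultimately show ?thesis by simp
  qed
  let ?T = "\<lambda>\<beta>. act (Poly_Mapping.single \<beta> 1)"
  have T_step: "?T (\<beta> + Poly_Mapping.single i 1) u = act (Var i) (?T \<beta> u)" for \<beta> i u
    by (simp add: Var_def mult_single add.commute)
  have T_N: "?T \<beta> m \<in> N" for \<beta> using m by (rule subspace_scale[OF N])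
  have split: "y \<in> X" if "y - a - b \<in> X" "a \<in> X" "b \<in> X" for y a b
    using subspace_add[OF X subspace_add[OF X that(1,2)] that(3)] by simp
  have split0: "y \<in> X" if "y - a \<in> X" "a \<in> X" for y a
    using subspace_add[OF X that] by simp
  have high: "c \<alpha> (?T \<beta> m) \<in> X" if "w \<alpha> > w \<beta> + \<mu>" for \<alpha> \<beta>
    using that
  proof (induction \<beta> arbitrary: \<alpha> rule: exponent_induct)
    case zero
    then show ?case using \<mu> by (simp add: w0)
  next
    case (step \<beta> i)
    have IH: "act (Var i) (c \<alpha> (?T \<beta> m)) \<in> X"
      using step.prems by (intro subspace_scale[OF X] step.IH) (simp add: w_add)
    show ?case
    proof (cases \<alpha> i rule: exponent_cases)
      case 1
      from split0[OF Var0[OF T_N 1] IH] show ?thesis by (simp only: T_step)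
    next
      case (2 \<alpha>')
      have "c \<alpha>' (?T \<beta> m) \<in> X" using step.prems by (intro step.IH) (simp add: w_add 2)
      from split[OF Var[OF T_N] IH[unfolded 2] this] show ?thesis by (simp only: T_step 2)
    qed
  qed
  have top: "c (\<beta> + \<alpha>0) (?T \<beta> m) - c \<alpha>0 m \<in> X" for \<beta>
  proof (induction \<beta> rule: exponent_induct)
    case zero
    show ?case using subspace_0[OF X] by simp
  next
    case (step \<beta> i)
    let ?\<alpha> = "\<beta> + \<alpha>0 + Poly_Mapping.single i 1"
    have "act (Var i) (c ?\<alpha> (?T \<beta> m)) \<in> X"
      using w_single[of i] by (intro subspace_scale[OF X] high) (simp add: w_add \<alpha>0(2))
    from subspace_add[OF X subspace_add[OF X Var[OF T_N, of "\<beta> + \<alpha>0" i \<beta>] this] step]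
    have "c ?\<alpha> (act (Var i) (?T \<beta> m)) - c \<alpha>0 m \<in> X" by (simp add: algebra_simps)
    then show ?case by (simp only: T_step add_single_swap)
  qed
  have zero: "c \<alpha> 0 = 0" for \<alpha> using add[of \<alpha> 0 0] by simp
  have c_sum: "c \<alpha> (\<Sum>i\<in>I. g i) = (\<Sum>i\<in>I. c \<alpha> (g i))" for \<alpha> I and g :: "('n \<Rightarrow>\<^sub>0 nat) \<Rightarrow> 'm"
    by (induction I rule: infinite_finite_induct) (simp_all add: add zero)
  let ?\<alpha> = "\<beta>0 + \<alpha>0"
  let ?g = "\<lambda>\<beta>. act (Const (Poly_Mapping.lookup f \<beta>)) (c ?\<alpha> (?T \<beta> m))"
  have "act f m = (\<Sum>\<beta>\<in>Poly_Mapping.keys f. act (Const (Poly_Mapping.lookup f \<beta>)) (?T \<beta> m))"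
    by (subst (1) poly_mapping_sum_monomials[of f, symmetric])
      (simp add: scale_sum_left Const_mult_single)
  then have "c ?\<alpha> (act f m) = (\<Sum>\<beta>\<in>Poly_Mapping.keys f. ?g \<beta>)"
    by (simp only: c_sum Const)
  also have "\<dots> = ?g \<beta>0 + (\<Sum>\<beta>\<in>Poly_Mapping.keys f - {\<beta>0}. ?g \<beta>)"
    using \<beta>0(1) by (simp add: sum.remove)
  finally have "?g \<beta>0 = c ?\<alpha> (act f m) - (\<Sum>\<beta>\<in>Poly_Mapping.keys f - {\<beta>0}. ?g \<beta>)" by simp
  also have "\<dots> \<in> X"
    by (intro subspace_diff[OF X f(2)] subspace_sum[OF X] subspace_scale[OF X] high)
      (use less in \<open>auto simp: w_add \<alpha>0(2)\<close>)
  finally have "act (Const (inverse (Poly_Mapping.lookup f \<beta>0))) (?g \<beta>0) \<in> X" by (rule subspace_scale[OF X])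
  moreover have "Poly_Mapping.lookup f \<beta>0 \<noteq> 0" using \<beta>0(1) by (simp add: in_keys_iff)
  ultimately have "c ?\<alpha> (?T \<beta>0 m) \<in> X" by (simp flip: Const_mult)
  from subspace_diff[OF X this top[of \<beta>0]] have "c \<alpha>0 m \<in> X" by simp
  with \<alpha>0(1) show False ..
qed

end


text \<open>The algebraic content of a TC-representation.  A T-invariant map \<open>a\<close> enters only through
  the family of its values \<open>b \<alpha> = a (T^\<alpha> / \<alpha>!)\<close> at the divided powers; the set of these families is \<open>\<B>\<close>.  Continuity
  becomes the local finiteness of the families, and the algebra is made up of the linear
  combinations of single families.\<close>

locale family_module = fg_polys_module act G
  for act :: "('n::finite, 'k::field_char_0) polys \<Rightarrow> 'm::ab_group_add \<Rightarrow> 'm"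
    and G :: "'m set" +
  fixes scale :: "'k \<Rightarrow> 'a::ring \<Rightarrow> 'a"
    and D :: "'n \<Rightarrow> 'a \<Rightarrow> 'a"
    and \<rho> :: "'a \<Rightarrow> 'm \<Rightarrow> 'm"
    and \<B> :: "(('n \<Rightarrow>\<^sub>0 nat) \<Rightarrow> 'a) set"
  assumes scale_vs: "vector_space scale"
    and D_linear: "Vector_Spaces.linear scale scale (D i)"
    and D_mult: "D i (x * y) = D i x * y + x * D i y"
    and rep_linear: "\<rho> x (u + v) = \<rho> x u + \<rho> x v"
    and rep_Const: "\<rho> x (act (Const c) u) = act (Const c) (\<rho> x u)"
    and rep_add: "\<rho> (x + y) u = \<rho> x u + \<rho> y u"
    and rep_scale: "\<rho> (scale c x) u = act (Const c) (\<rho> x u)"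
    and rep_mult: "\<rho> (x * y) u = \<rho> x (\<rho> y u)"
    and rep_D: "\<rho> (D i x) u = \<rho> x (act (Var i) u) - act (Var i) (\<rho> x u)"
    and family_step: "b \<in> \<B> \<Longrightarrow> D i (b (\<alpha> + Poly_Mapping.single i 1)) = b \<alpha>"
    and family_zero: "b \<in> \<B> \<Longrightarrow> Poly_Mapping.lookup \<alpha> i = 0 \<Longrightarrow> D i (b \<alpha>) = 0"
    and family_finite: "b \<in> \<B> \<Longrightarrow> finite {\<alpha>. \<rho> (b \<alpha>) u \<noteq> 0}"
    and family_span: "\<exists>b\<in>\<B>. \<exists>S k. finite S \<and> x = (\<Sum>\<alpha>\<in>S. scale (k \<alpha>) (b \<alpha>))"
begin

lemma D_add: "D i (x + y) = D i x + D i y"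
proof -
  interpret L: Vector_Spaces.linear scale scale "D i" by (rule D_linear)
  show ?thesis by (rule L.add)
qed

lemma D_scale: "D i (scale c x) = scale c (D i x)"
proof -
  interpret L: Vector_Spaces.linear scale scale "D i" by (rule D_linear)
  show ?thesis by (rule L.scale)
qed

lemma D_0: "D i 0 = 0"
  using D_add[of i 0 0] by simp

lemma D_sum: "D i (\<Sum>j\<in>I. f j) = (\<Sum>j\<in>I. D i (f j))"
  by (induction I rule: infinite_finite_induct) (simp_all add: D_add D_0)

lemma rep_zero: "\<rho> x 0 = 0"
  using rep_linear[of x 0 0] by simp

lemma rep_0: "\<rho> 0 u = 0"
  using rep_add[of 0 0 u] by simp

lemma rep_neg: "\<rho> (- x) u = - \<rho> x u"
  using rep_add[of x "- x" u] by (simp add: rep_0 eq_neg_iff_add_eq_0 add.commute)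

lemma rep_uminus: "\<rho> x (- u) = - \<rho> x u"
  using rep_linear[of x u "- u"] by (simp add: rep_zero eq_neg_iff_add_eq_0 add.commute)

lemma rep_minus: "\<rho> (x - y) u = \<rho> x u - \<rho> y u"
  using rep_add[of x "- y" u] by (simp add: rep_neg)

lemma rep_diff: "\<rho> x (u - v) = \<rho> x u - \<rho> x v"
  using rep_linear[of x u "- v"] by (simp add: rep_uminus)

lemma rep_sum: "\<rho> (\<Sum>j\<in>I. f j) u = (\<Sum>j\<in>I. \<rho> (f j) u)"
  by (induction I rule: infinite_finite_induct) (simp_all add: rep_add rep_0)

lemma rep_sum_right: "\<rho> x (\<Sum>j\<in>I. f j) = (\<Sum>j\<in>I. \<rho> x (f j))"
  by (induction I rule: infinite_finite_induct) (simp_all add: rep_linear rep_zero)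

lemma rep_Var: "\<rho> x (act (Var i) u) = act (Var i) (\<rho> x u) + \<rho> (D i x) u"
  by (simp add: rep_D)

text \<open>The elements that are killed by all products of \<open>k\<close> derivations \<open>D i\<close>: differential
  operators of order less than \<open>k\<close>.\<close>

fun order_less :: "nat \<Rightarrow> 'a set"
  where "order_less 0 = {0}" | "order_less (Suc k) = {x. \<forall>i. D i x \<in> order_less k}"

lemma order_less_closed:
  "0 \<in> order_less k" "x \<in> order_less k \<Longrightarrow> y \<in> order_less k \<Longrightarrow> x + y \<in> order_less k"
  "x \<in> order_less k \<Longrightarrow> scale c x \<in> order_less k"
proof (induction k arbitrary: x y c)
  case 0
  interpret V: vector_space scale by (rule scale_vs)
  case 1 show ?case by simp
  case 2 then show ?case by simp
  case 3 then show ?case by simp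
next
  case (Suc k)
  case 1 show ?case using Suc by (simp add: D_0)
  case 2 then show ?case using Suc by (simp add: D_add)
  case 3 then show ?case using Suc by (simp add: D_scale)
qed

lemma order_less_mono: "k \<le> l \<Longrightarrow> order_less k \<subseteq> order_less l"
proof (rule lift_Suc_mono_le)
  show "order_less n \<subseteq> order_less (Suc n)" for n
    by (induction n) (auto simp: D_0)
qed

lemma family_order_less:
  assumes b: "b \<in> \<B>"
  shows "\<exists>k. b \<alpha> \<in> order_less k"
proof -
  have "b \<alpha> \<in> order_less (Suc k)" if "(\<Sum>i\<in>UNIV. Poly_Mapping.lookup \<alpha> i) \<le> k" for k
    using that
  proof (induction k arbitrary: \<alpha>)
    case 0
    then show ?case by (auto simp: family_zero[OF b])
  next
    case (Suc k)
    have "D i (b \<alpha>) \<in> order_less (Suc k)" for i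
    proof (cases \<alpha> i rule: exponent_cases)
      case 1
      then show ?thesis by (simp add: family_zero[OF b] order_less_closed del: order_less.simps)
    next
      case (2 \<alpha>')
      have "(\<Sum>i\<in>UNIV. Poly_Mapping.lookup \<alpha>' i) \<le> k"
        using Suc.prems unfolding 2 by (simp add: lookup_add sum.distrib lookup_single when_def)
      from Suc.IH[OF this] show ?thesis by (simp only: 2 family_step[OF b])
    qed
    then show ?case by simp
  qed
  then show ?thesis by blast
qed

lemma exists_order_less: "\<exists>k. x \<in> order_less k"
proof -
  obtain b S c where b: "b \<in> \<B>" and S: "finite S" and x: "x = (\<Sum>\<alpha>\<in>S. scale (c \<alpha>) (b \<alpha>))"
    using family_span by blast
  obtain k where k: "\<And>\<alpha>. b \<alpha> \<in> order_less (k \<alpha>)" using family_order_less[OF b] by metis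
  have "(\<Sum>\<alpha>\<in>S'. scale (c \<alpha>) (b \<alpha>)) \<in> order_less (\<Sum>\<alpha>\<in>S. k \<alpha>)" if "S' \<subseteq> S" for S'
    using finite_subset[OF that S] that
  proof (induction S')
    case (insert \<alpha> S')
    have "k \<alpha> \<le> (\<Sum>\<alpha>\<in>S. k \<alpha>)" using insert.prems S by (intro member_le_sum) auto
    then have "b \<alpha> \<in> order_less (\<Sum>\<alpha>\<in>S. k \<alpha>)" using k order_less_mono by blast
    then show ?case using insert by (simp add: order_less_closed)
  qed (simp add: order_less_closed)
  then show ?thesis unfolding x by blast
qed

text \<open>Induction over the order of an element.\<close>

lemma locally_nilpotent_induct [case_names zero step]:
  assumes zero: "P 0" and step: "\<And>x. (\<And>i. P (D i x)) \<Longrightarrow> P x"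
  shows "P x"
proof -
  have "x \<in> order_less k \<Longrightarrow> P x" for k
  proof (induction k arbitrary: x)
    case 0
    then show ?case using zero by simp
  next
    case (Suc k)
    have "P (D i x)" for i using Suc.prems by (intro Suc.IH) simp
    then show ?case by (rule step)
  qed
  with exists_order_less show ?thesis by blast
qed

lemma derivation_locally_nilpotent: "\<exists>N. (D i ^^ N) x = 0"
proof -
  have "x \<in> order_less k \<Longrightarrow> (D i ^^ k) x = 0" for k
  proof (induction k arbitrary: x)
    case (Suc k)
    then have "D i x \<in> order_less k" by simp
    from Suc.IH[OF this] show ?case by (simp add: funpow_swap1)
  qed simp
  with exists_order_less show ?thesis by blast
qed

lemma family_spans:
  assumes X: "subspace X" and b: "\<And>b \<alpha>. b \<in> \<B> \<Longrightarrow> \<rho> x (\<rho> (b \<alpha>) m) \<in> X"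
  shows "\<rho> x (\<rho> y m) \<in> X"
proof -
  obtain b S c where bB: "b \<in> \<B>" and y: "y = (\<Sum>\<alpha>\<in>S. scale (c \<alpha>) (b \<alpha>))"
    using family_span by blast
  have "\<rho> x (\<rho> y m) = (\<Sum>\<alpha>\<in>S. act (Const (c \<alpha>)) (\<rho> x (\<rho> (b \<alpha>) m)))"
    by (simp add: y rep_sum rep_sum_right rep_scale rep_Const)
  also have "\<dots> \<in> X" by (intro subspace_sum[OF X] subspace_scale[OF X] b bB)
  finally show ?thesis .
qed

lemma family_spans':
  assumes X: "subspace X" and b: "\<And>b \<alpha>. b \<in> \<B> \<Longrightarrow> \<rho> (b \<alpha>) m \<in> X"
  shows "\<rho> y m \<in> X"
proof -
  obtain b S c where bB: "b \<in> \<B>" and y: "y = (\<Sum>\<alpha>\<in>S. scale (c \<alpha>) (b \<alpha>))"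
    using family_span by blast
  have "\<rho> y m = (\<Sum>\<alpha>\<in>S. act (Const (c \<alpha>)) (\<rho> (b \<alpha>) m))"
    by (simp add: y rep_sum rep_scale)
  also have "\<dots> \<in> X" by (intro subspace_sum[OF X] subspace_scale[OF X] b bB)
  finally show ?thesis .
qed

subsection \<open>Invariant submodules\<close>

text \<open>Submodules over both the polynomial ring and the algebra.\<close>

definition invariant :: "'m set \<Rightarrow> bool"
  where "invariant N \<longleftrightarrow> subspace N \<and> (\<forall>x. \<forall>m\<in>N. \<rho> x m \<in> N)"

lemma invariantD: "invariant N \<Longrightarrow> subspace N" "invariant N \<Longrightarrow> m \<in> N \<Longrightarrow> \<rho> x m \<in> N"
  by (auto simp: invariant_def)

text \<open>The algebra annihilates the torsion of the quotient by an invariant submodule.\<close>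

lemma rep_saturation:
  assumes X: "invariant X" and m: "m \<in> saturation X"
  shows "\<rho> y m \<in> X"
proof (rule family_spans'[OF invariantD(1)[OF X]])
  fix b \<alpha> assume b: "b \<in> \<B>"
  obtain f where f: "f \<noteq> 0" "act f m \<in> X" using m by (auto simp: saturation_def)
  show "\<rho> (b \<alpha>) m \<in> X"
  proof (rule torsion_lemma[where c = "\<lambda>\<alpha>. \<rho> (b \<alpha>)" and N = UNIV, OF invariantD(1)[OF X] subspace_UNIV])
    show "finite {\<alpha>. \<rho> (b \<alpha>) m \<notin> X}"
      by (rule finite_subset[OF _ family_finite[OF b, of m]])
        (use subspace_0[OF invariantD(1)[OF X]] in auto)
    show "f \<noteq> 0" by fact
    show "\<rho> (b \<alpha>) (act f m) \<in> X" for \<alpha> using invariantD(2)[OF X f(2)] .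
  qed (use subspace_0[OF invariantD(1)[OF X]] in
      \<open>simp_all add: rep_linear rep_Const rep_Var family_zero[OF b] rep_0 family_step[OF b, simplified]\<close>)
qed

lemma invariant_saturation:
  assumes "invariant X"
  shows "invariant (saturation X)"
  unfolding invariant_def
  using subspace_saturation[OF invariantD(1)[OF assms]] rep_saturation[OF assms] saturation_superset
  by blast

lemma invariantI:
  assumes "0 \<in> N" "\<And>x y. x \<in> N \<Longrightarrow> y \<in> N \<Longrightarrow> x + y \<in> N"
    "\<And>c x. x \<in> N \<Longrightarrow> act (Const c) x \<in> N" "\<And>i x. x \<in> N \<Longrightarrow> act (Var i) x \<in> N"
    "\<And>y x. x \<in> N \<Longrightarrow> \<rho> y x \<in> N"
  shows "invariant N"
  using subspaceI_Var[of N] assms by (simp add: invariant_def)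

lemma invariant_UNIV: "invariant UNIV" and invariant_zero: "invariant {0}"
  by (auto simp: invariant_def rep_zero intro: subspaceI)

text \<open>An element whose derivatives vanish modulo \<open>M2\<close> commutes with the polynomials.\<close>

lemma rep_act:
  assumes M1: "subspace M1" and M2: "subspace M2" and x: "\<And>i m. m \<in> M1 \<Longrightarrow> \<rho> (D i x) m \<in> M2"
    and m: "m \<in> M1"
  shows "\<rho> x (act f m) - act f (\<rho> x m) \<in> M2"
proof (induction f rule: polys_induct)
  case (Const c)
  then show ?case using subspace_0[OF M2] by (simp add: rep_Const)
next
  case (add f g)
  from subspace_add[OF M2 this] show ?case by (simp add: scale_left_distrib rep_linear algebra_simps)
next
  case (Var i f)
  have "act f m \<in> M1" using m by (rule subspace_scale[OF M1])
  from subspace_add[OF M2 subspace_scale[OF M2 Var, of "Var i"] x[OF this, of i]]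
  show ?case by (simp add: rep_Var scale_right_diff_distrib diff_add_eq flip: scale_scale)
qed

end


section \<open>Quasi-regular ideals and fibres of simple sections\<close>

text \<open>A quasi-regular two-sided ideal that is stable under the derivations, such as the radical.\<close>

locale quasi_regular_ideal = family_module act G scale D \<rho> \<B>
  for act :: "('n::finite, 'k::field_char_0) polys \<Rightarrow> 'm::ab_group_add \<Rightarrow> 'm"
    and G :: "'m set"
    and scale :: "'k \<Rightarrow> 'a::ring \<Rightarrow> 'a"
    and D :: "'n \<Rightarrow> 'a \<Rightarrow> 'a"
    and \<rho> :: "'a \<Rightarrow> 'm \<Rightarrow> 'm"
    and \<B> :: "(('n \<Rightarrow>\<^sub>0 nat) \<Rightarrow> 'a) set" +
  fixes J :: "'a set"
  assumes J_0: "0 \<in> J" and J_add: "x \<in> J \<Longrightarrow> y \<in> J \<Longrightarrow> x + y \<in> J"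
    and J_scale: "x \<in> J \<Longrightarrow> scale c x \<in> J"
    and J_left: "x \<in> J \<Longrightarrow> y * x \<in> J" and J_right: "x \<in> J \<Longrightarrow> x * y \<in> J"
    and J_D: "x \<in> J \<Longrightarrow> D i x \<in> J"
    and J_quasi_regular: "x \<in> J \<Longrightarrow> \<exists>z. z - x - z * x = 0 \<and> z - x - x * z = 0"
begin

lemma J_sum: "(\<And>i. i \<in> I \<Longrightarrow> f i \<in> J) \<Longrightarrow> sum f I \<in> J"
  by (induction I rule: infinite_finite_induct) (auto intro: J_0 J_add)

end

text \<open>A quotient \<open>M1 / M2\<close> of saturated invariant submodules that admits no such submodule strictly
  between.  The case \<open>M1 = M2\<close> is not excluded.\<close>

locale simple_section = quasi_regular_ideal act G scale D \<rho> \<B> J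
  for act :: "('n::finite, 'k::field_char_0) polys \<Rightarrow> 'm::ab_group_add \<Rightarrow> 'm"
    and G :: "'m set"
    and scale :: "'k \<Rightarrow> 'a::ring \<Rightarrow> 'a"
    and D :: "'n \<Rightarrow> 'a \<Rightarrow> 'a"
    and \<rho> :: "'a \<Rightarrow> 'm \<Rightarrow> 'm"
    and \<B> :: "(('n \<Rightarrow>\<^sub>0 nat) \<Rightarrow> 'a) set"
    and J :: "'a set" +
  fixes M1 M2 :: "'m set"
  assumes M1: "invariant M1" "saturated M1" and M2: "invariant M2" "saturated M2"
    and M2_M1: "M2 \<subseteq> M1"
    and simple: "\<And>X. invariant X \<Longrightarrow> saturated X \<Longrightarrow> M2 \<subseteq> X \<Longrightarrow> X \<subseteq> M1 \<Longrightarrow> X = M2 \<or> X = M1"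
begin

lemmas M1_sub = invariantD(1)[OF M1(1)] and M1_rep = invariantD(2)[OF M1(1)]
  and M2_sub = invariantD(1)[OF M2(1)] and M2_rep = invariantD(2)[OF M2(1)]

text \<open>Without assuming \<open>X\<close> saturated, simplicity still gives \<open>A M1 \<subseteq> X\<close> unless \<open>X = M2\<close>.\<close>

lemma dichotomy:
  assumes X: "invariant X" and "M2 \<subseteq> X" "X \<subseteq> M1"
  shows "X = M2 \<or> (\<forall>y. \<forall>m\<in>M1. \<rho> y m \<in> X)"
proof -
  have "saturation X \<subseteq> M1" using assms(3) saturatedD[OF M1(2)] by (auto simp: saturation_def)
  moreover have "M2 \<subseteq> saturation X" using assms(2) saturation_superset by blast
  ultimately have "saturation X = M2 \<or> saturation X = M1"
    by (intro simple invariant_saturation X saturated_saturation)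
  then show ?thesis
  proof
    assume "saturation X = M2"
    with assms(2) saturation_superset[of X] show ?thesis by blast
  next
    assume "saturation X = M1"
    with rep_saturation[OF X] show ?thesis by blast
  qed
qed

text \<open>The elements that are linear over the polynomials on \<open>M1 / M2\<close>.\<close>

definition A0 :: "'a set"
  where "A0 = {x. \<forall>i. \<forall>m\<in>M1. \<rho> (D i x) m \<in> M2}"

lemma A0D: "x \<in> A0 \<Longrightarrow> m \<in> M1 \<Longrightarrow> \<rho> (D i x) m \<in> M2"
  by (simp add: A0_def)

lemma A0_0: "0 \<in> A0"
  using subspace_0[OF M2_sub] by (simp add: A0_def D_0 rep_0)

lemma A0_add: "x \<in> A0 \<Longrightarrow> y \<in> A0 \<Longrightarrow> x + y \<in> A0"
  using subspace_add[OF M2_sub] by (simp add: A0_def D_add rep_add)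

lemma A0_scale: "x \<in> A0 \<Longrightarrow> scale c x \<in> A0"
  using subspace_scale[OF M2_sub] by (simp add: A0_def D_scale rep_scale)

lemma A0_mult: "x \<in> A0 \<Longrightarrow> y \<in> A0 \<Longrightarrow> x * y \<in> A0"
  using subspace_add[OF M2_sub] M1_rep M2_rep by (simp add: A0_def D_mult rep_add rep_mult)

lemma A0_sum: "(\<And>i. i \<in> I \<Longrightarrow> f i \<in> A0) \<Longrightarrow> sum f I \<in> A0"
  by (induction I rule: infinite_finite_induct) (auto intro: A0_0 A0_add)

end

text \<open>Coordinates on \<open>M1 / M2\<close> and a point \<open>p\<close> off the zeros of the denominator give
  coordinates on the fibre of \<open>M1 / M2\<close> at \<open>p\<close>.\<close>

locale section_fibre = simple_section act G scale D \<rho> \<B> J M1 M2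
  for act :: "('n::finite, 'k::field_char_0) polys \<Rightarrow> 'm::ab_group_add \<Rightarrow> 'm"
    and G :: "'m set"
    and scale :: "'k \<Rightarrow> 'a::ring \<Rightarrow> 'a"
    and D :: "'n \<Rightarrow> 'a \<Rightarrow> 'a"
    and \<rho> :: "'a \<Rightarrow> 'm \<Rightarrow> 'm"
    and \<B> :: "(('n \<Rightarrow>\<^sub>0 nat) \<Rightarrow> 'a) set"
    and J :: "'a set"
    and M1 M2 :: "'m set" +
  fixes r :: nat and u :: "nat \<Rightarrow> 'm" and \<phi> :: "nat \<Rightarrow> 'm \<Rightarrow> ('n, 'k) polys"
    and h :: "('n, 'k) polys" and p :: "'n \<Rightarrow> 'k"
  assumes coords: "coordinates M1 M2 r u \<phi> h" and h_p: "eval p h \<noteq> 0"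
begin

text \<open>The elements of \<open>M1\<close> whose value in the fibre at \<open>p\<close> is zero.\<close>

definition vanishes :: "'m \<Rightarrow> bool"
  where "vanishes m \<longleftrightarrow> m \<in> M1 \<and> (\<forall>j<r. eval p (\<phi> j m) = 0)"

lemmas \<phi> = coordinatesD(3)[OF coords]

lemma \<phi>_diff: "j < r \<Longrightarrow> x \<in> M1 \<Longrightarrow> y \<in> M1 \<Longrightarrow> \<phi> j (x - y) = \<phi> j x - \<phi> j y"
  by (rule functional_diff[OF \<phi> M1_sub])

lemma \<phi>_cong: "j < r \<Longrightarrow> x - y \<in> M2 \<Longrightarrow> x \<in> M1 \<Longrightarrow> y \<in> M1 \<Longrightarrow> \<phi> j x = \<phi> j y"
  using \<phi>_diff[of j x y] functionalD(3)[OF \<phi>] by simp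

lemma vanishes_add: "vanishes x \<Longrightarrow> vanishes y \<Longrightarrow> vanishes (x + y)"
  by (auto simp: vanishes_def functionalD(1)[OF \<phi>] subspace_add[OF M1_sub])

lemma vanishes_act: "vanishes x \<Longrightarrow> vanishes (act f x)"
  by (auto simp: vanishes_def functionalD(2)[OF \<phi>] subspace_scale[OF M1_sub])

lemma vanishes_M2: "x \<in> M2 \<Longrightarrow> vanishes x"
  using M2_M1 by (auto simp: vanishes_def functionalD(3)[OF \<phi>])

lemma vanishes_diff: "vanishes x \<Longrightarrow> vanishes y \<Longrightarrow> vanishes (x - y)"
  by (auto simp: vanishes_def \<phi>_diff subspace_diff[OF M1_sub])

text \<open>An operator that is linear over the polynomials on \<open>M1 / M2\<close> acts on the fibre at \<open>p\<close>.\<close>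

lemma vanishes_A0:
  assumes x: "x \<in> A0" and m: "vanishes m"
  shows "vanishes (\<rho> x m)"
  unfolding vanishes_def
proof (intro conjI allI impI)
  have mM: "m \<in> M1" using m by (simp add: vanishes_def)
  show xm: "\<rho> x m \<in> M1" using mM by (rule M1_rep)
  fix j assume j: "j < r"
  let ?s = "\<Sum>i<r. act (\<phi> i m) (u i)"
  have u: "u i \<in> M1" if "i < r" for i using coordinatesD(2)[OF coords that] .
  note lin = rep_act[OF M1_sub M2_sub A0D[OF x]]
  have s: "?s \<in> M1" by (intro subspace_sum[OF M1_sub] subspace_scale[OF M1_sub] u) simp
  have "act h m - ?s \<in> M2" using coordinatesD(4)[OF coords mM] .
  then have "\<rho> x (act h m) - \<rho> x ?s \<in> M2" using M2_rep[of _ x] by (simp flip: rep_diff)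
  then have "\<phi> j (\<rho> x (act h m)) = \<phi> j (\<rho> x ?s)"
    using mM s by (intro \<phi>_cong[OF j]) (auto intro!: M1_rep subspace_scale[OF M1_sub])
  moreover have "\<phi> j (\<rho> x (act h m)) = \<phi> j (act h (\<rho> x m))"
    using mM xm by (intro \<phi>_cong[OF j lin]) (auto intro!: M1_rep subspace_scale[OF M1_sub])
  moreover have "\<phi> j (\<rho> x ?s) = (\<Sum>i<r. \<phi> i m * \<phi> j (\<rho> x (u i)))"
  proof -
    have "\<phi> j (\<rho> x ?s) = (\<Sum>i<r. \<phi> j (\<rho> x (act (\<phi> i m) (u i))))"
      unfolding rep_sum_right
      by (rule functional_sum[OF \<phi>[OF j] M1_sub]) (use u in \<open>auto intro!: M1_rep subspace_scale[OF M1_sub]\<close>)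
    also have "\<dots> = (\<Sum>i<r. \<phi> j (act (\<phi> i m) (\<rho> x (u i))))"
      by (intro sum.cong refl \<phi>_cong[OF j lin]) (use u in \<open>auto intro!: M1_rep subspace_scale[OF M1_sub]\<close>)
    also have "\<dots> = (\<Sum>i<r. \<phi> i m * \<phi> j (\<rho> x (u i)))"
      by (intro sum.cong refl functionalD(2)[OF \<phi>[OF j]]) (use u in \<open>auto intro!: M1_rep\<close>)
    finally show ?thesis .
  qed
  ultimately have "h * \<phi> j (\<rho> x m) = (\<Sum>i<r. \<phi> i m * \<phi> j (\<rho> x (u i)))"
    using functionalD(2)[OF \<phi>[OF j] xm, of h] by simp
  then have "eval p h * eval p (\<phi> j (\<rho> x m)) = (\<Sum>i<r. eval p (\<phi> i m) * eval p (\<phi> j (\<rho> x (u i))))"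
    by (simp flip: eval_mult eval_sum)
  also have "\<dots> = 0" using m by (simp add: vanishes_def)
  finally show "eval p (\<phi> j (\<rho> x m)) = 0" using h_p by simp
qed

text \<open>By quasi-regularity \<open>1 - y\<close> is injective on the fibre; the point is that its inverse
  \<open>1 + z\<close> also acts on the fibre.\<close>

lemma vanishes_quasi_regular:
  assumes y: "y \<in> J" "y \<in> A0" and m: "m \<in> M1" and v: "vanishes (m - \<rho> y m)"
  shows "vanishes m"
proof -
  obtain z where z: "z - y - z * y = 0" "z - y - y * z = 0" using J_quasi_regular[OF y(1)] by blast
  have "z \<in> A0"
    unfolding A0_def
  proof clarify
    fix i m assume m: "m \<in> M1"
    define m' where "m' = m + \<rho> z m"
    have m': "m' \<in> M1" unfolding m'_def using m by (intro subspace_add[OF M1_sub] M1_rep)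
    have "m' - \<rho> y m' = m + \<rho> (z - y - y * z) m"
      by (simp add: m'_def rep_linear rep_minus rep_mult)
    then have m_eq: "m = m' - \<rho> y m'" by (simp add: z rep_0)
    have "D i (z - y - z * y) = 0" unfolding z by (rule D_0)
    then have "D i z - D i z * y = D i y + z * D i y"
      using D_add[of i "z - y - z * y" "y + z * y"] by (simp add: z D_add D_mult algebra_simps)
    then have "\<rho> (D i z - D i z * y) m' = \<rho> (D i y + z * D i y) m'" by simp
    then have "\<rho> (D i z) m = \<rho> (D i y) m' + \<rho> z (\<rho> (D i y) m')"
      by (subst m_eq) (simp add: rep_diff rep_minus rep_add rep_mult)
    also have "\<dots> \<in> M2"
      using subspace_add[OF M2_sub A0D[OF y(2) m'] M2_rep[OF A0D[OF y(2) m']]] .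
    finally show "\<rho> (D i z) m \<in> M2" .
  qed
  from vanishes_add[OF v vanishes_A0[OF this v]]
  have "vanishes (m + \<rho> (z - y - z * y) m)"
    by (simp add: rep_diff rep_minus rep_add rep_mult algebra_simps)
  then show ?thesis by (simp add: z rep_0)
qed

text \<open>The elements of \<open>J\<close> that are linear over the polynomials kill a common nonzero vector of
  the fibre, if the fibre is not zero.  Otherwise applying them successively gives \<open>r + 1\<close> nonzero vectors in a space of
  dimension \<open>r\<close>, and a linear relation between these contradicts quasi-regularity.\<close>

lemma exists_common_zero:
  assumes m0: "m0 \<in> M1" "\<not> vanishes m0"
  obtains m where "m \<in> M1" "\<not> vanishes m" "\<And>y. y \<in> J \<Longrightarrow> y \<in> A0 \<Longrightarrow> vanishes (\<rho> y m)"
proof -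
  have "\<exists>m. m \<in> M1 \<and> \<not> vanishes m \<and> (\<forall>y. y \<in> J \<longrightarrow> y \<in> A0 \<longrightarrow> vanishes (\<rho> y m))"
  proof (rule ccontr)
    assume "\<not> ?thesis"
    then have "\<exists>y. y \<in> J \<and> y \<in> A0 \<and> \<not> vanishes (\<rho> y m)" if "m \<in> M1" "\<not> vanishes m" for m
      using that by blast
    then obtain Y where Y: "\<And>m. m \<in> M1 \<Longrightarrow> \<not> vanishes m \<Longrightarrow> Y m \<in> J"
      "\<And>m. m \<in> M1 \<Longrightarrow> \<not> vanishes m \<Longrightarrow> Y m \<in> A0"
      "\<And>m. m \<in> M1 \<Longrightarrow> \<not> vanishes m \<Longrightarrow> \<not> vanishes (\<rho> (Y m) m)"
      by metis
    \<comment> \<open>Each \<open>s l\<close> with \<open>l > j\<close> is the image of \<open>s j\<close> under an element of \<open>J\<close> in \<open>A0\<close>.\<close>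
    define s where "s = rec_nat m0 (\<lambda>_ m. \<rho> (Y m) m)"
    have s0: "s 0 = m0" and s_Suc: "s (Suc j) = \<rho> (Y (s j)) (s j)" for j by (simp_all add: s_def)
    have s: "s j \<in> M1 \<and> \<not> vanishes (s j)" for j
      by (induction j) (use m0 Y M1_rep in \<open>auto simp: s0 s_Suc\<close>)
    have step: "\<exists>y. y \<in> J \<and> y \<in> A0 \<and> s (j + Suc l) = \<rho> y (s j)" for j l
    proof (induction l)
      case 0
      show ?case using Y s by (intro exI[of _ "Y (s j)"]) (simp add: s_Suc)
    next
      case (Suc l)
      then obtain y where y: "y \<in> J" "y \<in> A0" "s (j + Suc l) = \<rho> y (s j)" by blast
      let ?y = "Y (s (j + Suc l)) * y"
      have "Y (s (j + Suc l)) \<in> A0" using Y(2) s by blast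
      then have "?y \<in> J" "?y \<in> A0" using y(1,2) by (auto intro: J_left A0_mult)
      moreover have "s (j + Suc (Suc l)) = \<rho> ?y (s j)"
        using s_Suc[of "j + Suc l"] y(3) by (simp add: rep_mult)
      ultimately show ?case by blast
    qed
    obtain c where c: "\<exists>j<Suc r. c j \<noteq> 0" "\<And>i. i < r \<Longrightarrow> (\<Sum>j<Suc r. c j * eval p (\<phi> i (s j))) = 0"
      using exists_linear_relation[of r "Suc r" "\<lambda>j i. eval p (\<phi> i (s j))"] by blast
    define j0 where "j0 = (LEAST j. c j \<noteq> 0)"
    from c(1) obtain j1 where "j1 < Suc r" "c j1 \<noteq> 0" by blast
    note j1 = this
    have j0: "c j0 \<noteq> 0" unfolding j0_def by (rule LeastI[of "\<lambda>j. c j \<noteq> 0", OF j1(2)])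
    have "j0 \<le> j1" unfolding j0_def by (rule Least_le[of "\<lambda>j. c j \<noteq> 0", OF j1(2)])
    with j1(1) have j0_r: "j0 < Suc r" by simp
    have less: "c j = 0" if "j < j0" for j
      using not_less_Least[of j "\<lambda>j. c j \<noteq> 0"] that unfolding j0_def by blast
    obtain y where y: "\<And>j. j > j0 \<Longrightarrow> y j \<in> J" "\<And>j. j > j0 \<Longrightarrow> y j \<in> A0"
      "\<And>j. j > j0 \<Longrightarrow> s j = \<rho> (y j) (s j0)"
    proof -
      have "\<exists>y. y \<in> J \<and> y \<in> A0 \<and> s j = \<rho> y (s j0)" if "j > j0" for j
        using step[of j0 "j - Suc j0"] that by simp
      then show thesis using that by metis
    qed
    \<comment> \<open>The relation, solved for its first term, says that \<open>s j0\<close> and \<open>Z (s j0)\<close> agree at \<open>p\<close>.\<close>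
    define Z where "Z = (\<Sum>j\<in>{j0<..r}. scale (- (c j / c j0)) (y j))"
    have Z: "Z \<in> J" "Z \<in> A0"
      unfolding Z_def using y by (auto intro!: J_sum J_scale A0_sum A0_scale)
    have "vanishes (s j0 - \<rho> Z (s j0))"
      unfolding vanishes_def
    proof (intro conjI allI impI)
      show "s j0 - \<rho> Z (s j0) \<in> M1" using s by (intro subspace_diff[OF M1_sub] M1_rep) auto
      fix i assume i: "i < r"
      have "\<rho> Z (s j0) = (\<Sum>j\<in>{j0<..r}. act (Const (- (c j / c j0))) (s j))"
        unfolding Z_def rep_sum rep_scale using y(3) by simp
      then have "\<phi> i (\<rho> Z (s j0)) = (\<Sum>j\<in>{j0<..r}. \<phi> i (act (Const (- (c j / c j0))) (s j)))"
        using s by (simp only:) (intro functional_sum[OF \<phi>[OF i] M1_sub] subspace_scale[OF M1_sub]; simp)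
      also have "\<dots> = (\<Sum>j\<in>{j0<..r}. Const (- (c j / c j0)) * \<phi> i (s j))"
        using s by (intro sum.cong refl functionalD(2)[OF \<phi>[OF i]]) auto
      finally have "c j0 * eval p (\<phi> i (s j0 - \<rho> Z (s j0)))
        = c j0 * eval p (\<phi> i (s j0)) + (\<Sum>j\<in>{j0<..r}. c j * eval p (\<phi> i (s j)))"
        using s M1_rep i j0 by (simp add: \<phi>_diff sum_negf right_diff_distrib distrib_left sum_distrib_left)
      also have "\<dots> = (\<Sum>j\<in>insert j0 {j0<..r}. c j * eval p (\<phi> i (s j)))" by simp
      also have "\<dots> = (\<Sum>j<Suc r. c j * eval p (\<phi> i (s j)))"
        by (rule sum.mono_neutral_left) (use j0_r less in auto)
      also have "\<dots> = 0" using c(2)[OF i] .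
      finally show "eval p (\<phi> i (s j0 - \<rho> Z (s j0))) = 0" using j0 by simp
    qed
    with vanishes_quasi_regular[OF Z] s show False by blast
  qed
  with that show thesis by blast
qed

end


section \<open>The operators theta\<close>

text \<open>The sign \<open>(-1)\<close> to the total degree.\<close>

definition sgn_exp :: "('n::finite \<Rightarrow>\<^sub>0 nat) \<Rightarrow> 'k::comm_ring_1"
  where "sgn_exp \<alpha> = mpow (\<lambda>_. - 1) \<alpha>"

lemma sgn_exp_0 [simp]: "sgn_exp 0 = 1"
  and sgn_exp_step [simp]: "sgn_exp (\<alpha> + Poly_Mapping.single i 1) = - sgn_exp \<alpha>"
  unfolding sgn_exp_def mpow_add mpow_single by simp_all

text \<open>An element \<open>x\<close> of the ideal whose derivatives annihilate \<open>A M1\<close> modulo \<open>M2\<close>; so \<open>x\<close> is linear over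
  the polynomials on \<open>A M1\<close>, modulo \<open>M2\<close>.\<close>

locale critical_element = simple_section act G scale D \<rho> \<B> J M1 M2
  for act :: "('n::finite, 'k::field_char_0) polys \<Rightarrow> 'm::ab_group_add \<Rightarrow> 'm"
    and G :: "'m set"
    and scale :: "'k \<Rightarrow> 'a::ring \<Rightarrow> 'a"
    and D :: "'n \<Rightarrow> 'a \<Rightarrow> 'a"
    and \<rho> :: "'a \<Rightarrow> 'm \<Rightarrow> 'm"
    and \<B> :: "(('n \<Rightarrow>\<^sub>0 nat) \<Rightarrow> 'a) set"
    and J :: "'a set"
    and M1 M2 :: "'m set" +
  fixes x :: 'a
  assumes x_J: "x \<in> J" and D_x: "m \<in> M1 \<Longrightarrow> \<rho> (D i x) (\<rho> y m) \<in> M2"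
begin

lemma mult_family_zero_in_A0: "b \<in> \<B> \<Longrightarrow> x * b 0 \<in> A0"
  using D_x by (simp add: A0_def D_mult family_zero rep_mult)

text \<open>In the derivative of the alternating sum, the terms that differentiate \<open>b' \<beta>\<close> and those that
  differentiate \<open>b \<alpha>\<close> cancel, as lowering \<open>\<alpha>\<close> by one changes the sign.\<close>

lemma alternating_sum_in_A0:
  assumes b: "b \<in> \<B>" and b': "b' \<in> \<B>"
  shows "(\<Sum>(\<beta>, \<alpha>)\<in>antidiagonal \<delta>. scale (sgn_exp \<alpha>) (b' \<beta> * (x * b \<alpha>))) \<in> A0"
  unfolding A0_def
proof clarify
  fix i m assume m: "m \<in> M1"
  interpret V: vector_space scale by (rule scale_vs)
  define S1 where "S1 \<delta> = (\<Sum>(\<beta>, \<alpha>)\<in>antidiagonal \<delta>. scale (sgn_exp \<alpha>) (D i (b' \<beta>) * (x * b \<alpha>)))" for \<delta>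
  define S2 where "S2 = (\<Sum>(\<beta>, \<alpha>)\<in>antidiagonal \<delta>. scale (sgn_exp \<alpha>) (b' \<beta> * (D i x * b \<alpha>)))"
  define S3 where "S3 \<delta> = (\<Sum>(\<beta>, \<alpha>)\<in>antidiagonal \<delta>. scale (sgn_exp \<alpha>) (b' \<beta> * (x * D i (b \<alpha>))))" for \<delta>
  let ?Y = "\<Sum>(\<beta>, \<alpha>)\<in>antidiagonal \<delta>. scale (sgn_exp \<alpha>) (b' \<beta> * (x * b \<alpha>))"
  have split: "D i ?Y = S1 \<delta> + S2 + S3 \<delta>"
    unfolding S1_def S2_def S3_def D_sum
    by (simp add: split_def D_scale D_mult V.scale_right_distrib sum.distrib algebra_simps)
  have "S1 \<delta> + S3 \<delta> = 0"
  proof (cases \<delta> i rule: exponent_cases)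
    case 1
    then have "Poly_Mapping.lookup \<beta> i = 0 \<and> Poly_Mapping.lookup \<alpha> i = 0" if "(\<beta>, \<alpha>) \<in> antidiagonal \<delta>" for \<beta> \<alpha>
      using that by (auto simp: antidiagonal_def lookup_add)
    then have "S1 \<delta> = 0" "S3 \<delta> = 0"
      unfolding S1_def S3_def by (auto intro!: sum.neutral simp: family_zero[OF b] family_zero[OF b'])
    then show ?thesis by simp
  next
    case (2 \<delta>')
    let ?e = "Poly_Mapping.single i (1::nat)"
    have "S1 \<delta> = (\<Sum>(\<beta>, \<alpha>)\<in>antidiagonal \<delta>'. scale (sgn_exp \<alpha>) (D i (b' (\<beta> + ?e)) * (x * b \<alpha>)))"
      unfolding S1_def 2 by (rule sum_antidiagonal_shift) (simp add: family_zero[OF b'])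
    then have 1: "S1 \<delta> = (\<Sum>(\<beta>, \<alpha>)\<in>antidiagonal \<delta>'. scale (sgn_exp \<alpha>) (b' \<beta> * (x * b \<alpha>)))"
      by (simp only: family_step[OF b'])
    have "S3 \<delta> = (\<Sum>(\<beta>, \<alpha>)\<in>antidiagonal \<delta>. scale (sgn_exp \<beta>) (b' \<alpha> * (x * D i (b \<beta>))))"
      unfolding S3_def by (rule sum_antidiagonal_swap[symmetric])
    also have "\<dots> = (\<Sum>(\<beta>, \<alpha>)\<in>antidiagonal \<delta>'. scale (sgn_exp (\<beta> + ?e)) (b' \<alpha> * (x * D i (b (\<beta> + ?e)))))"
      unfolding 2 by (rule sum_antidiagonal_shift) (simp add: family_zero[OF b])
    also have "\<dots> = (\<Sum>(\<beta>, \<alpha>)\<in>antidiagonal \<delta>'. - scale (sgn_exp \<beta>) (b' \<alpha> * (x * b \<beta>)))"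
      by (simp only: family_step[OF b] sgn_exp_step V.scale_minus_left)
    also have "\<dots> = (\<Sum>(\<beta>, \<alpha>)\<in>antidiagonal \<delta>'. - scale (sgn_exp \<alpha>) (b' \<beta> * (x * b \<alpha>)))"
      by (rule sum_antidiagonal_swap)
    also have "\<dots> = - S1 \<delta>" unfolding 1 by (simp add: split_def sum_negf)
    finally show ?thesis by simp
  qed
  with split have "D i ?Y = S2" by (simp add: add.commute add.left_commute)
  moreover have "\<rho> S2 m \<in> M2"
    unfolding S2_def rep_sum
    by (rule subspace_sum[OF M2_sub], clarsimp simp: rep_scale rep_mult)
      (rule subspace_scale[OF M2_sub M2_rep[OF D_x[OF m]]])
  ultimately show "\<rho> (D i ?Y) m \<in> M2" by simp
qed

lemma alternating_sum_in_J:
  "(\<Sum>(\<beta>, \<alpha>)\<in>antidiagonal \<delta>. scale (sgn_exp \<alpha>) (b' \<beta> * (x * b \<alpha>))) \<in> J"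
  by (rule J_sum, clarsimp) (rule J_scale[OF J_left[OF J_right[OF x_J]]])

text \<open>The operator \<open>\<Sum>\<alpha>. (p - T)^\<alpha> x (b \<alpha>)\<close>; for a given argument \<open>m\<close> the sum is finite.  By
  \<open>theta_act\<close> below it is defined, modulo \<open>M2\<close>, on the fibre at \<open>p\<close>.\<close>

definition theta :: "(('n \<Rightarrow>\<^sub>0 nat) \<Rightarrow> 'a) \<Rightarrow> ('n \<Rightarrow> 'k) \<Rightarrow> 'm \<Rightarrow> 'm"
  where "theta b p m = (\<Sum>\<alpha>\<in>{\<alpha>. \<rho> (b \<alpha>) m \<noteq> 0}.
    act (mpow (\<lambda>i. Const (p i) - Var i) \<alpha>) (\<rho> x (\<rho> (b \<alpha>) m)))"

lemma theta_eq:
  assumes "finite F" "{\<alpha>. \<rho> (b \<alpha>) m \<noteq> 0} \<subseteq> F"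
  shows "theta b p m = (\<Sum>\<alpha>\<in>F. act (mpow (\<lambda>i. Const (p i) - Var i) \<alpha>) (\<rho> x (\<rho> (b \<alpha>) m)))"
  unfolding theta_def by (rule sum.mono_neutral_left) (use assms in \<open>auto simp: rep_zero\<close>)

lemma theta_add:
  assumes b: "b \<in> \<B>"
  shows "theta b p (m + m') = theta b p m + theta b p m'"
proof -
  let ?F = "{\<alpha>. \<rho> (b \<alpha>) m \<noteq> 0} \<union> {\<alpha>. \<rho> (b \<alpha>) m' \<noteq> 0}"
  have "finite ?F" using family_finite[OF b] by blast
  moreover have "{\<alpha>. \<rho> (b \<alpha>) (m + m') \<noteq> 0} \<subseteq> ?F" by (auto simp: rep_linear)
  ultimately show ?thesis
    by (simp add: theta_eq[of ?F] rep_linear scale_right_distrib sum.distrib)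
qed

lemma theta_Const:
  assumes b: "b \<in> \<B>"
  shows "theta b p (act (Const c) m) = act (Const c) (theta b p m)"
proof -
  let ?F = "{\<alpha>. \<rho> (b \<alpha>) m \<noteq> 0}"
  have "finite ?F" using family_finite[OF b] by blast
  moreover have "{\<alpha>. \<rho> (b \<alpha>) (act (Const c) m) \<noteq> 0} \<subseteq> ?F" by (auto simp: rep_Const)
  ultimately show ?thesis
    by (simp add: theta_eq[of ?F] rep_Const scale_sum_right mult.commute)
qed

lemma theta_mem:
  assumes N: "invariant N" and m: "m \<in> N"
  shows "theta b p m \<in> N"
  unfolding theta_def
  by (intro subspace_sum[OF invariantD(1)[OF N]] subspace_scale[OF invariantD(1)[OF N]] invariantD(2)[OF N] m)

lemma theta_Var:
  assumes b: "b \<in> \<B>" and m: "m \<in> M1"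
  shows "theta b p (act (Var i) m) - act (Const (p i)) (theta b p m) \<in> M2"
proof -
  let ?e = "Poly_Mapping.single i (1::nat)"
  let ?S = "{\<alpha>. \<rho> (b \<alpha>) m \<noteq> 0}" and ?q = "\<lambda>\<alpha>. mpow (\<lambda>i. Const (p i) - Var i) \<alpha>"
  let ?F = "?S \<union> (\<lambda>\<alpha>. \<alpha> + ?e) ` ?S"
  have S: "finite ?S" using family_finite[OF b] by blast
  then have F: "finite ?F" by simp
  have D_F: "\<rho> (D i (b \<alpha>)) m = 0" if "\<alpha> \<notin> (\<lambda>\<alpha>. \<alpha> + ?e) ` ?S" for \<alpha>
  proof (cases \<alpha> i rule: exponent_cases)
    case 1
    then show ?thesis by (simp add: family_zero[OF b] rep_0)
  next
    case (2 \<alpha>')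
    with that show ?thesis unfolding 2 family_step[OF b] by blast
  qed
  have "{\<alpha>. \<rho> (b \<alpha>) (act (Var i) m) \<noteq> 0} \<subseteq> ?F"
  proof clarify
    fix \<alpha> assume "\<rho> (b \<alpha>) (act (Var i) m) \<noteq> 0" "\<alpha> \<notin> (\<lambda>\<alpha>. \<alpha> + ?e) ` ?S" "\<rho> (b \<alpha>) m = 0"
    then show False using D_F by (simp add: rep_Var)
  qed
  then have "theta b p (act (Var i) m) = (\<Sum>\<alpha>\<in>?F. act (?q \<alpha>) (\<rho> x (\<rho> (b \<alpha>) (act (Var i) m))))"
    by (rule theta_eq[OF F])
  also have "\<dots> = (\<Sum>\<alpha>\<in>?F. act (Var i) (act (?q \<alpha>) (\<rho> x (\<rho> (b \<alpha>) m))))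
      + (\<Sum>\<alpha>\<in>?F. act (?q \<alpha>) (\<rho> (D i x) (\<rho> (b \<alpha>) m)))
      + (\<Sum>\<alpha>\<in>?F. act (?q \<alpha>) (\<rho> x (\<rho> (D i (b \<alpha>)) m)))"
    by (simp only: rep_Var rep_linear scale_right_distrib sum.distrib) (simp add: mult.commute)
  also have "(\<Sum>\<alpha>\<in>?F. act (Var i) (act (?q \<alpha>) (\<rho> x (\<rho> (b \<alpha>) m)))) = act (Var i) (theta b p m)"
    by (simp only: theta_eq[OF F Un_upper1] scale_sum_right)
  also have "(\<Sum>\<alpha>\<in>?F. act (?q \<alpha>) (\<rho> x (\<rho> (D i (b \<alpha>)) m))) =
      (\<Sum>\<alpha>\<in>(\<lambda>\<alpha>. \<alpha> + ?e) ` ?S. act (?q \<alpha>) (\<rho> x (\<rho> (D i (b \<alpha>)) m)))"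
    by (rule sum.mono_neutral_right[OF F]) (auto simp: D_F rep_zero)
  also have "\<dots> = (\<Sum>\<alpha>\<in>?S. act (?q (\<alpha> + ?e)) (\<rho> x (\<rho> (D i (b (\<alpha> + ?e))) m)))"
    by (rule sum.reindex_cong[of "\<lambda>\<alpha>. \<alpha> + ?e"]) (auto simp: inj_on_def)
  also have "\<dots> = act (Const (p i) - Var i) (theta b p m)"
    unfolding theta_def scale_sum_right by (simp only: family_step[OF b] mpow_add mpow_single scale_scale mult.commute)
  finally have "theta b p (act (Var i) m) - act (Const (p i)) (theta b p m)
      = (\<Sum>\<alpha>\<in>?F. act (?q \<alpha>) (\<rho> (D i x) (\<rho> (b \<alpha>) m)))"
    by (simp add: act_minus_Var)
  also have "\<dots> \<in> M2" by (intro subspace_sum[OF M2_sub] subspace_scale[OF M2_sub] D_x m)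
  finally show ?thesis .
qed

lemma theta_act:
  assumes b: "b \<in> \<B>" and m: "m \<in> M1"
  shows "theta b p (act f m) - act (Const (eval p f)) (theta b p m) \<in> M2"
proof (induction f rule: polys_induct)
  case (Const c)
  show ?case using subspace_0[OF M2_sub] by (simp add: theta_Const[OF b])
next
  case (add f g)
  from subspace_add[OF M2_sub this] show ?case
    by (simp add: scale_left_distrib theta_add[OF b] Const_add algebra_simps)
next
  case (Var i f)
  have "act f m \<in> M1" using m by (rule subspace_scale[OF M1_sub])
  from subspace_add[OF M2_sub subspace_scale[OF M2_sub Var, of "Const (p i)"] theta_Var[OF b this, of p i]]
  show ?case by (simp add: scale_right_diff_distrib Const_mult flip: scale_scale)
qed

text \<open>If \<open>M1\<close> is not killed by \<open>x A\<close> modulo \<open>M2\<close>, then neither is any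
  element of \<open>M1\<close> outside \<open>M2\<close>.\<close>

lemma annihilator:
  assumes ne: "\<exists>y. \<exists>m\<in>M1. \<rho> x (\<rho> y m) \<notin> M2"
    and m: "m \<in> M1" "\<And>b \<alpha>. b \<in> \<B> \<Longrightarrow> \<rho> x (\<rho> (b \<alpha>) m) \<in> M2"
  shows "m \<in> M2"
proof -
  let ?Z = "{m\<in>M1. \<forall>y. \<rho> x (\<rho> y m) \<in> M2}"
  have "invariant ?Z"
  proof (rule invariantI)
    show "0 \<in> ?Z" using subspace_0[OF M1_sub] subspace_0[OF M2_sub] by (simp add: rep_zero)
  next
    fix v w assume "v \<in> ?Z" "w \<in> ?Z"
    then show "v + w \<in> ?Z" using subspace_add[OF M1_sub] subspace_add[OF M2_sub] by (simp add: rep_linear)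
  next
    fix c v assume "v \<in> ?Z"
    then show "act (Const c) v \<in> ?Z" using subspace_scale[OF M1_sub] subspace_scale[OF M2_sub] by (simp add: rep_Const)
  next
    fix i v assume v: "v \<in> ?Z"
    have "\<rho> x (\<rho> y (act (Var i) v)) \<in> M2" for y
      using v D_x[of v i y] subspace_scale[OF M2_sub] subspace_add[OF M2_sub] by (simp add: rep_Var rep_linear)
    then show "act (Var i) v \<in> ?Z" using v subspace_scale[OF M1_sub] by simp
  next
    fix y v assume v: "v \<in> ?Z"
    then show "\<rho> y v \<in> ?Z" using M1_rep by (simp add: mult.assoc flip: rep_mult)
  qed
  moreover have "saturated ?Z"
    unfolding saturated_def
  proof (intro allI impI)
    fix f v assume f: "f \<noteq> 0" "act f v \<in> ?Z"
    then have v: "v \<in> M1" using saturatedD[OF M1(2)] by blast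
    have "\<rho> x (\<rho> (b \<gamma>) v) \<in> M2" if b: "b \<in> \<B>" for b \<gamma>
    proof (rule torsion_lemma[where c = "\<lambda>\<alpha> v. \<rho> x (\<rho> (b \<alpha>) v)" and N = M1, OF M2_sub M1_sub])
      show "finite {\<alpha>. \<rho> x (\<rho> (b \<alpha>) v) \<notin> M2}"
        by (rule finite_subset[OF _ family_finite[OF b, of v]])
          (use subspace_0[OF M2_sub] in \<open>auto simp: rep_zero\<close>)
      show "\<rho> x (\<rho> (b \<alpha>) (act f v)) \<in> M2" for \<alpha> using f(2) by blast
      show "v \<in> M1" "f \<noteq> 0" by fact+
    qed (use D_x subspace_0[OF M2_sub] in \<open>simp_all add: rep_linear rep_Const rep_Var family_zero[OF b] rep_0 rep_zero
        family_step[OF b, simplified]\<close>)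
    then have "\<rho> x (\<rho> y v) \<in> M2" for y by (rule family_spans[OF M2_sub])
    with v show "v \<in> ?Z" by simp
  qed
  moreover have "M2 \<subseteq> ?Z" using M2_M1 M2_rep by auto
  ultimately have "?Z = M2 \<or> ?Z = M1" by (intro simple) auto
  moreover have "?Z \<noteq> M1" using ne by auto
  moreover have "\<rho> x (\<rho> y m) \<in> M2" for y using m(2) by (rule family_spans[OF M2_sub])
  then have "m \<in> ?Z" using m(1) by simp
  ultimately show ?thesis by blast
qed

end


text \<open>A critical element together with a point \<open>p\<close> and coordinates on the fibre there.\<close>

locale critical_fibre = critical_element act G scale D \<rho> \<B> J M1 M2 x
    + section_fibre act G scale D \<rho> \<B> J M1 M2 r u \<phi> h p
  for act :: "('n::finite, 'k::field_char_0) polys \<Rightarrow> 'm::ab_group_add \<Rightarrow> 'm"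
    and G :: "'m set"
    and scale :: "'k \<Rightarrow> 'a::ring \<Rightarrow> 'a"
    and D :: "'n \<Rightarrow> 'a \<Rightarrow> 'a"
    and \<rho> :: "'a \<Rightarrow> 'm \<Rightarrow> 'm"
    and \<B> :: "(('n \<Rightarrow>\<^sub>0 nat) \<Rightarrow> 'a) set"
    and J :: "'a set"
    and M1 M2 :: "'m set" and x :: 'a
    and r :: nat and u :: "nat \<Rightarrow> 'm" and \<phi> :: "nat \<Rightarrow> 'm \<Rightarrow> ('n, 'k) polys"
    and h :: "('n, 'k) polys" and p :: "'n \<Rightarrow> 'k"
begin

text \<open>The monomials in the functions \<open>p i - T i\<close>, each of which vanishes at \<open>p\<close>.\<close>

abbreviation q :: "('n \<Rightarrow>\<^sub>0 nat) \<Rightarrow> ('n, 'k) polys"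
  where "q \<equiv> mpow (\<lambda>i. Const (p i) - Var i)"

lemma subspace_vanishes: "subspace {m. vanishes m}"
  by (rule subspaceI) (auto intro: vanishes_add vanishes_act vanishes_M2 subspace_0[OF M2_sub])

lemma vanishes_sum: "(\<And>i. i \<in> I \<Longrightarrow> vanishes (f i)) \<Longrightarrow> vanishes (sum f I)"
  using subspace_sum[OF subspace_vanishes, of I f] by simp

lemma vanishes_eval_0: "v \<in> M1 \<Longrightarrow> eval p f = 0 \<Longrightarrow> vanishes (act f v)"
  by (simp add: vanishes_def functionalD(2)[OF \<phi>] subspace_scale[OF M1_sub])

text \<open>Each factor \<open>p i - T i\<close> can be moved past an operator at the cost of a sign and a derivation,
  because it vanishes at \<open>p\<close> once it has become the outermost factor.\<close>

lemma rep_q_step: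
  assumes v: "v \<in> M1"
  shows "vanishes (\<rho> y (act (q (\<alpha> + Poly_Mapping.single i 1)) v) + \<rho> (D i y) (act (q \<alpha>) v))"
proof -
  let ?v = "act (q \<alpha>) v"
  have "act (q (\<alpha> + Poly_Mapping.single i 1)) v = act (Const (p i)) ?v - act (Var i) ?v"
    by (simp only: mpow_add mpow_single mult.commute[of "q \<alpha>"] flip: scale_scale) (rule act_minus_Var)
  then have "\<rho> y (act (q (\<alpha> + Poly_Mapping.single i 1)) v) + \<rho> (D i y) ?v
      = act (Const (p i) - Var i) (\<rho> y ?v)"
    by (simp add: rep_diff rep_Const rep_Var act_minus_Var del: scale_scale)
  also have "vanishes \<dots>"
    using v by (intro vanishes_eval_0 M1_rep subspace_scale[OF M1_sub]) simp_all
  finally show ?thesis .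
qed

lemma rep_q:
  assumes b: "b \<in> \<B>" and v: "v \<in> M1"
  shows "vanishes (\<rho> (b (\<beta> + \<alpha>)) (act (q \<alpha>) v) - act (Const (sgn_exp \<alpha>)) (\<rho> (b \<beta>) v))"
proof (induction \<alpha> rule: exponent_induct)
  case zero
  show ?case using vanishes_M2[OF subspace_0[OF M2_sub]] by simp
next
  case (step \<alpha> i)
  have "vanishes (\<rho> (b (\<beta> + \<alpha> + Poly_Mapping.single i 1)) (act (q (\<alpha> + Poly_Mapping.single i 1)) v)
      + \<rho> (b (\<beta> + \<alpha>)) (act (q \<alpha>) v))"
    using rep_q_step[OF v, of "b (\<beta> + \<alpha> + Poly_Mapping.single i 1)" \<alpha> i] by (simp only: family_step[OF b])
  from vanishes_diff[OF this step] show ?case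
    by (simp only: sgn_exp_step Const_minus scale_minus_left add.assoc) (simp add: algebra_simps)
qed

lemma rep_q_0:
  assumes b: "b \<in> \<B>" and v: "v \<in> M1" and "\<nexists>\<beta>. \<beta> + \<alpha> = \<delta>"
  shows "vanishes (\<rho> (b \<delta>) (act (q \<alpha>) v))"
  using assms(3)
proof (induction \<alpha> arbitrary: \<delta> rule: exponent_induct)
  case zero
  then show ?case by simp
next
  case (step \<alpha> i)
  have "vanishes (\<rho> (D i (b \<delta>)) (act (q \<alpha>) v))"
  proof (cases \<delta> i rule: exponent_cases)
    case 1
    then show ?thesis using vanishes_M2[OF subspace_0[OF M2_sub]] by (simp add: family_zero[OF b] rep_0)
  next
    case (2 \<delta>')
    have "\<nexists>\<beta>. \<beta> + \<alpha> = \<delta>'" using step.prems unfolding 2 by (metis add.assoc)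
    from step.IH[OF this] show ?thesis unfolding 2 family_step[OF b] .
  qed
  from vanishes_diff[OF rep_q_step[OF v, of "b \<delta>" \<alpha> i] this] show ?case by simp
qed

text \<open>At \<open>p\<close>, the coefficient \<open>b' \<delta>\<close> of a family acts
  on \<open>theta b p m\<close> like an alternating sum acts on \<open>m\<close>.\<close>

lemma rep_theta:
  assumes b: "b \<in> \<B>" and b': "b' \<in> \<B>" and m: "m \<in> M1"
  shows "vanishes (\<rho> (b' \<delta>) (theta b p m) -
    \<rho> (\<Sum>(\<beta>, \<alpha>)\<in>antidiagonal \<delta>. scale (sgn_exp \<alpha>) (b' \<beta> * (x * b \<alpha>))) m)"
proof -
  let ?S = "{\<alpha>. \<rho> (b \<alpha>) m \<noteq> 0}" and ?T = "snd ` antidiagonal \<delta>"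
  let ?v = "\<lambda>\<alpha>. \<rho> x (\<rho> (b \<alpha>) m)"
  let ?g = "\<lambda>\<alpha>. \<rho> (b' \<delta>) (act (q \<alpha>) (?v \<alpha>))"
  let ?k = "\<lambda>\<beta> \<alpha>. act (Const (sgn_exp \<alpha>)) (\<rho> (b' \<beta>) (?v \<alpha>))"
  have v: "?v \<alpha> \<in> M1" for \<alpha> using m by (intro M1_rep)
  have fin: "finite ?S" "finite ?T" using family_finite[OF b] finite_antidiagonal by auto
  have 1: "\<rho> (b' \<delta>) (theta b p m) = (\<Sum>\<alpha>\<in>?S \<inter> ?T. ?g \<alpha>) + (\<Sum>\<alpha>\<in>?S - ?T. ?g \<alpha>)"
    unfolding theta_def rep_sum_right using fin by (simp add: sum.Int_Diff[of ?S _ ?T])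
  have inj: "inj_on snd (antidiagonal \<delta>)"
    by (auto simp: inj_on_def antidiagonal_def)
  have "\<rho> (\<Sum>(\<beta>, \<alpha>)\<in>antidiagonal \<delta>. scale (sgn_exp \<alpha>) (b' \<beta> * (x * b \<alpha>))) m
      = (\<Sum>(\<beta>, \<alpha>)\<in>antidiagonal \<delta>. ?k \<beta> \<alpha>)"
    by (simp add: rep_sum split_def rep_scale rep_mult)
  also have "\<dots> = (\<Sum>\<alpha>\<in>?T. ?k (\<delta> - \<alpha>) \<alpha>)"
    unfolding sum.reindex[OF inj] by (rule sum.cong) (auto simp: antidiagonal_def)
  also have "\<dots> = (\<Sum>\<alpha>\<in>?S \<inter> ?T. ?k (\<delta> - \<alpha>) \<alpha>)"
    by (rule sum.mono_neutral_right) (use fin in \<open>auto simp: rep_zero\<close>)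
  finally have "\<rho> (b' \<delta>) (theta b p m) -
    \<rho> (\<Sum>(\<beta>, \<alpha>)\<in>antidiagonal \<delta>. scale (sgn_exp \<alpha>) (b' \<beta> * (x * b \<alpha>))) m
    = (\<Sum>\<alpha>\<in>?S \<inter> ?T. ?g \<alpha> - ?k (\<delta> - \<alpha>) \<alpha>) + (\<Sum>\<alpha>\<in>?S - ?T. ?g \<alpha>)"
    unfolding 1 by (simp add: sum_subtractf)
  also have "vanishes \<dots>"
  proof (intro vanishes_add vanishes_sum)
    fix \<alpha> assume "\<alpha> \<in> ?S \<inter> ?T"
    then obtain \<beta> where "\<beta> + \<alpha> = \<delta>" by (auto simp: antidiagonal_def)
    then show "vanishes (?g \<alpha> - ?k (\<delta> - \<alpha>) \<alpha>)" using rep_q[OF b' v, of \<beta> \<alpha> \<alpha>] by auto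
  next
    fix \<alpha> assume "\<alpha> \<in> ?S - ?T"
    then have "\<nexists>\<beta>. \<beta> + \<alpha> = \<delta>" by (force simp: antidiagonal_def)
    then show "vanishes (?g \<alpha>)" by (rule rep_q_0[OF b' v])
  qed
  finally show ?thesis .
qed

text \<open>Take for \<open>m\<close> a common zero at \<open>p\<close> of the ideal.  The elements \<open>w\<close> such that \<open>w\<close> and \<open>A w\<close> vanish at
  \<open>p\<close> form an invariant submodule, which contains all \<open>theta b p m\<close>.  It equals \<open>M2\<close>, since otherwise it
  would contain \<open>A M1\<close>, contrary to the assumption on \<open>m0\<close>.\<close>

lemma exists_theta_in_M2:
  assumes "m0 \<in> M1" "\<not> vanishes (\<rho> y0 m0)"
  obtains m where "m \<in> M1" "\<not> vanishes m" "\<And>b. b \<in> \<B> \<Longrightarrow> theta b p m \<in> M2"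
proof -
  obtain m where m: "m \<in> M1" "\<not> vanishes m" and zero: "\<And>y. y \<in> J \<Longrightarrow> y \<in> A0 \<Longrightarrow> vanishes (\<rho> y m)"
    using exists_common_zero[OF M1_rep[OF assms(1)] assms(2)] by blast
  let ?X = "{w\<in>M1. vanishes w \<and> (\<forall>y. vanishes (\<rho> y w))}"
  have "invariant ?X"
  proof (rule invariantI)
    show "0 \<in> ?X"
      using subspace_0[OF M1_sub] vanishes_M2[OF subspace_0[OF M2_sub]] by (simp add: rep_zero)
  next
    fix v w assume "v \<in> ?X" "w \<in> ?X"
    then show "v + w \<in> ?X" using subspace_add[OF M1_sub] vanishes_add by (simp add: rep_linear)
  next
    fix c v assume "v \<in> ?X"
    then show "act (Const c) v \<in> ?X"
      using subspace_scale[OF M1_sub] vanishes_act by (simp add: rep_Const)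
  next
    fix i v assume "v \<in> ?X"
    then show "act (Var i) v \<in> ?X"
      using subspace_scale[OF M1_sub] vanishes_act vanishes_add by (simp add: rep_Var)
  next
    fix y v assume "v \<in> ?X"
    then show "\<rho> y v \<in> ?X" using M1_rep by (simp flip: rep_mult)
  qed
  then have X: "?X = M2 \<or> (\<forall>y. \<forall>m\<in>M1. \<rho> y m \<in> ?X)"
    by (rule dichotomy) (use M2_M1 M2_rep vanishes_M2 in auto)
  have X_M2: "?X = M2" using X assms by blast
  show thesis
  proof (rule that[OF m])
    fix b assume b: "b \<in> \<B>"
    have vanish_theta: "vanishes (theta b p m)"
      unfolding theta_def
    proof (rule vanishes_sum)
      fix \<alpha>
      show "vanishes (act (q \<alpha>) (\<rho> x (\<rho> (b \<alpha>) m)))"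
      proof (cases "\<alpha> = 0")
        case True
        have "vanishes (\<rho> (x * b 0) m)"
          using b x_J by (intro zero J_right mult_family_zero_in_A0)
        with True show ?thesis by (simp add: rep_mult)
      next
        case False
        then obtain i where "Poly_Mapping.lookup \<alpha> i \<noteq> 0" by (metis poly_mapping_eqI lookup_zero)
        then obtain \<alpha>' where \<alpha>: "\<alpha> = \<alpha>' + Poly_Mapping.single i 1" using exponent_cases[of \<alpha> i] by metis
        have "eval p (q \<alpha>) = 0" unfolding \<alpha> mpow_add mpow_single by simp
        then show ?thesis using m by (intro vanishes_eval_0 M1_rep)
      qed
    qed
    have "vanishes (\<rho> (b' \<delta>) (theta b p m))" if b': "b' \<in> \<B>" for b' \<delta>
      using vanishes_add[OF rep_theta[OF b b' m(1), of \<delta>]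
          zero[OF alternating_sum_in_J alternating_sum_in_A0[OF b b'], of \<delta>]]
      by simp
    then have "vanishes (\<rho> y (theta b p m))" for y
      using family_spans'[OF subspace_vanishes] by blast
    with vanish_theta theta_mem[OF M1(1) m(1)] show "theta b p m \<in> M2"
      unfolding X_M2[symmetric] by simp
  qed
qed

end

context critical_element
begin

text \<open>The coordinate \<open>j\<close> at the point \<open>s\<close> of \<open>theta b p m\<close>, as a polynomial in \<open>p\<close>; see
  \<open>eval_kernel_functional\<close>.\<close>

definition kernel_functional :: "(nat \<Rightarrow> 'm \<Rightarrow> ('n, 'k) polys) \<Rightarrow> (('n \<Rightarrow>\<^sub>0 nat) \<Rightarrow> 'a) \<Rightarrow> nat \<Rightarrow>
    ('n \<Rightarrow> 'k) \<Rightarrow> 'm \<Rightarrow> ('n, 'k) polys"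
  where "kernel_functional \<phi> b j s m = (\<Sum>\<alpha>\<in>{\<alpha>. \<rho> (b \<alpha>) m \<noteq> 0}.
    Const (eval s (\<phi> j (\<rho> x (\<rho> (b \<alpha>) m)))) * mpow (\<lambda>i. Var i - Const (s i)) \<alpha>)"

lemma eval_kernel_functional:
  assumes \<phi>: "functional M1 M2 (\<phi> j)" and m: "m \<in> M1"
  shows "eval p (kernel_functional \<phi> b j s m) = eval s (\<phi> j (theta b p m))"
proof -
  let ?v = "\<lambda>\<alpha>. \<rho> x (\<rho> (b \<alpha>) m)"
  have v: "?v \<alpha> \<in> M1" for \<alpha> using m by (intro M1_rep)
  have "\<phi> j (theta b p m) = (\<Sum>\<alpha>\<in>{\<alpha>. \<rho> (b \<alpha>) m \<noteq> 0}. \<phi> j (act (mpow (\<lambda>i. Const (p i) - Var i) \<alpha>) (?v \<alpha>)))"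
    unfolding theta_def by (rule functional_sum[OF \<phi> M1_sub]) (rule subspace_scale[OF M1_sub v])
  also have "\<dots> = (\<Sum>\<alpha>\<in>{\<alpha>. \<rho> (b \<alpha>) m \<noteq> 0}. mpow (\<lambda>i. Const (p i) - Var i) \<alpha> * \<phi> j (?v \<alpha>))"
    by (simp add: functionalD(2)[OF \<phi> v])
  finally show ?thesis
    by (simp add: kernel_functional_def eval_mpow mult.commute)
qed

lemma functional_kernel_functional:
  assumes \<phi>: "functional M1 M2 (\<phi> j)" and b: "b \<in> \<B>"
  shows "functional M1 M2 (kernel_functional \<phi> b j s)"
proof -
  have ext: "f = g" if "\<And>p. eval p f = eval p g" for f g :: "('n, 'k) polys"
    using eval_eq_0_imp[of "f - g"] that by simp
  note ev = eval_kernel_functional[where \<phi> = \<phi>, OF \<phi>]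
  note mem = theta_mem[OF M1(1)]
  show ?thesis
    unfolding functional_def
  proof (intro conjI ballI allI)
    fix v w assume vw: "v \<in> M1" "w \<in> M1"
    show "kernel_functional \<phi> b j s (v + w) = kernel_functional \<phi> b j s v + kernel_functional \<phi> b j s w"
    proof (rule ext)
      fix p
      show "eval p (kernel_functional \<phi> b j s (v + w)) =
          eval p (kernel_functional \<phi> b j s v + kernel_functional \<phi> b j s w)"
        using vw subspace_add[OF M1_sub vw]
        by (simp add: ev theta_add[OF b] functionalD(1)[OF \<phi>] mem)
    qed
  next
    fix f v assume v: "v \<in> M1"
    have fv: "act f v \<in> M1" using v by (rule subspace_scale[OF M1_sub])
    show "kernel_functional \<phi> b j s (act f v) = f * kernel_functional \<phi> b j s v"
    proof (rule ext)
      fix p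
      have "\<phi> j (theta b p (act f v)) - \<phi> j (act (Const (eval p f)) (theta b p v))
        = \<phi> j (theta b p (act f v) - act (Const (eval p f)) (theta b p v))"
        using v fv by (intro functional_diff[OF \<phi> M1_sub, symmetric] mem subspace_scale[OF M1_sub])
      also have "\<dots> = 0" using theta_act[OF b v] by (rule functionalD(3)[OF \<phi>])
      finally show "eval p (kernel_functional \<phi> b j s (act f v)) = eval p (f * kernel_functional \<phi> b j s v)"
        using v fv by (simp add: ev functionalD(2)[OF \<phi>] mem)
    qed
  next
    fix z assume z: "z \<in> M2"
    show "kernel_functional \<phi> b j s z = 0"
    proof (rule ext)
      fix p
      show "eval p (kernel_functional \<phi> b j s z) = eval p 0"
        using z M2_M1 theta_mem[OF M2(1) z] by (simp add: ev subset_iff functionalD(3)[OF \<phi>])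
    qed
  qed
qed

text \<open>The polynomial \<open>kernel_functional \<phi> b j s m\<close>, expanded around \<open>s\<close>, has the values at \<open>s\<close> of the
  coordinates of \<open>x (b \<alpha>) m\<close> as its coefficients.\<close>

lemma kernel_functional_eq_0:
  assumes b: "b \<in> \<B>" and "kernel_functional \<phi> b j s m = 0" and \<phi>: "\<phi> j 0 = 0"
  shows "eval s (\<phi> j (\<rho> x (\<rho> (b \<alpha>) m))) = 0"
proof -
  let ?S = "{\<alpha>. \<rho> (b \<alpha>) m \<noteq> 0}"
  let ?c = "\<lambda>\<alpha>. eval s (\<phi> j (\<rho> x (\<rho> (b \<alpha>) m)))"
  define g :: "('n, 'k) polys" where "g = (\<Sum>\<alpha>\<in>?S. Poly_Mapping.single \<alpha> (?c \<alpha>))"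
  have "g = 0"
  proof (rule eval_eq_0_imp)
    fix t
    have "eval t g = eval (\<lambda>i. t i + s i) (kernel_functional \<phi> b j s m)"
      by (simp add: g_def kernel_functional_def eval_single eval_mpow)
    then show "eval t g = 0" using assms(2) by simp
  qed
  then have "Poly_Mapping.lookup g \<alpha> = 0" by simp
  moreover have "Poly_Mapping.lookup g \<alpha> = (\<Sum>\<beta>\<in>?S. if \<beta> = \<alpha> then ?c \<alpha> else 0)"
    unfolding g_def lookup_sum by (intro sum.cong) (auto simp: lookup_single when_def)
  ultimately have "\<alpha> \<in> ?S \<Longrightarrow> ?c \<alpha> = 0" using family_finite[OF b, of m] by simp
  then show ?thesis using \<phi> by (cases "\<alpha> \<in> ?S") (auto simp: rep_zero)
qed

text \<open>Otherwise there is a contradiction at a general point \<open>p\<close>: on the one hand there is a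
  nonzero vector of the fibre with image under \<open>theta b p\<close> in \<open>M2\<close> for all \<open>b\<close>, and on the other hand
  the images modulo \<open>M2\<close> determine the vector.\<close>

lemma x_annihilates:
  assumes m0: "m0 \<in> M1"
  shows "\<rho> x (\<rho> y0 m0) \<in> M2"
proof (rule ccontr)
  assume ne: "\<rho> x (\<rho> y0 m0) \<notin> M2"
  obtain r u \<phi> h where c: "coordinates M1 M2 r u \<phi> h"
    using exists_coordinates_submodule[OF M2_sub M2(2) M1_sub M2_M1] .
  note cD = coordinatesD[OF c]
  \<comment> \<open>The functionals whose value at each \<open>p\<close> is controlled by the operators \<open>theta b p\<close>.\<close>
  define \<Lambda> where "\<Lambda> = {\<psi>. functional M1 M2 \<psi> \<and>
    (\<forall>p. \<forall>m\<in>M1. (\<forall>b\<in>\<B>. theta b p m \<in> M2) \<longrightarrow> eval p (\<psi> m) = 0)}"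
  have kernel_\<Lambda>: "kernel_functional \<phi> b j s \<in> \<Lambda>" if b: "b \<in> \<B>" and j: "j < r" for b j s
    unfolding \<Lambda>_def using functional_kernel_functional[where \<phi> = \<phi>, OF cD(3)[OF j] b] b
    by (auto simp: eval_kernel_functional[where \<phi> = \<phi>, OF cD(3)[OF j]] functionalD(3)[OF cD(3)[OF j]])
  have sep: "m \<in> M2" if m: "m \<in> M1" and zero: "\<And>\<psi>. \<psi> \<in> \<Lambda> \<Longrightarrow> \<psi> m = 0" for m
  proof (rule annihilator)
    show "\<exists>y. \<exists>m\<in>M1. \<rho> x (\<rho> y m) \<notin> M2" using ne m0 by blast
    fix b \<alpha> assume b: "b \<in> \<B>"
    show "\<rho> x (\<rho> (b \<alpha>) m) \<in> M2"
    proof (rule coordinates_eq_0[OF c M2(2)])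
      show "\<rho> x (\<rho> (b \<alpha>) m) \<in> M1" using m by (intro M1_rep)
      fix j assume j: "j < r"
      show "\<phi> j (\<rho> x (\<rho> (b \<alpha>) m)) = 0"
      proof (rule eval_eq_0_imp)
        fix s
        show "eval s (\<phi> j (\<rho> x (\<rho> (b \<alpha>) m))) = 0"
          using kernel_functional_eq_0[OF b zero[OF kernel_\<Lambda>[OF b j]]]
            functionalD(3)[OF cD(3)[OF j] subspace_0[OF M2_sub]] by blast
      qed
    qed
  qed (rule m)
  obtain k :: nat and v \<psi> g where g: "g \<noteq> 0" and v: "\<And>i. i < k \<Longrightarrow> v i \<in> M1"
    and \<psi>: "\<And>i. i < k \<Longrightarrow> \<psi> i \<in> \<Lambda>"
    and dual: "\<And>m. m \<in> M1 \<Longrightarrow> act g m - (\<Sum>i<k. act (\<psi> i m) (v i)) \<in> M2"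
    by (rule exists_dual_system[OF c M1_sub M2_M1 M1_sub subset_refl, of \<Lambda>])
      (use sep in \<open>auto simp: \<Lambda>_def functional_def algebra_simps\<close>)
  have "\<rho> y0 m0 \<notin> M2" using ne M2_rep by blast
  then obtain j where j: "j < r" "\<phi> j (\<rho> y0 m0) \<noteq> 0"
    using coordinates_eq_0[OF c M2(2) M1_rep[OF m0]] by blast
  obtain p where p: "eval p h \<noteq> 0" "eval p (g * \<phi> j (\<rho> y0 m0)) \<noteq> 0"
    using exists_common_nonzero[OF cD(1) polys_mult_nonzero[OF g j(2)]] .
  interpret critical_fibre act G scale D \<rho> \<B> J M1 M2 x r u \<phi> h p
    by unfold_locales (rule c, rule p)
  have "\<not> vanishes (\<rho> y0 m0)" using p(2) j(1) by (auto simp: vanishes_def)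
  then obtain m where m: "m \<in> M1" "\<not> vanishes m" and th: "\<And>b. b \<in> \<B> \<Longrightarrow> theta b p m \<in> M2"
    using exists_theta_in_M2[OF m0] by blast
  have "vanishes (\<Sum>i<k. act (\<psi> i m) (v i))"
  proof (rule vanishes_sum)
    fix i assume "i \<in> {..<k}"
    then have i: "i < k" by simp
    have "eval p (\<psi> i m) = 0" using \<psi>[OF i] m(1) th by (auto simp: \<Lambda>_def)
    then show "vanishes (act (\<psi> i m) (v i))" by (rule vanishes_eval_0[OF v[OF i]])
  qed
  from vanishes_add[OF vanishes_M2[OF dual[OF m(1)]] this] have "vanishes (act g m)" by simp
  then have "vanishes m"
    using p(2) m(1) by (auto simp: vanishes_def functionalD(2)[OF cD(3)])
  with m(2) show False ..
qed

end


section \<open>Nilpotency\<close>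

lemma ideal_power_Suc: "k > 0 \<Longrightarrow> ideal_power I (Suc k) = ideal_prod (ideal_power I k) I"
  by (cases k) simp_all

lemma zero_in_ideal_power:
  assumes "0 \<in> I"
  shows "0 \<in> ideal_power I k"
proof (cases k)
  case (Suc l)
  show ?thesis
  proof (cases l)
    case (Suc l')
    have "0 \<in> ideal_prod J I" for J :: "'a set"
      unfolding ideal_prod_def by (auto intro!: exI[of _ "0::nat"])
    with Suc \<open>k = Suc l\<close> show ?thesis by simp
  qed (use Suc assms in simp)
qed simp

context quasi_regular_ideal
begin

text \<open>Induction over the order of \<open>x\<close>: once the claim holds for the derivatives of \<open>x\<close>, the
  element \<open>x\<close> is critical in the above sense.\<close>

lemma annihilates_simple_section:
  assumes "invariant M1" "saturated M1" "invariant M2" "saturated M2" "M2 \<subseteq> M1"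
    and "\<And>X. invariant X \<Longrightarrow> saturated X \<Longrightarrow> M2 \<subseteq> X \<Longrightarrow> X \<subseteq> M1 \<Longrightarrow> X = M2 \<or> X = M1"
  shows "x \<in> J \<Longrightarrow> m \<in> M1 \<Longrightarrow> \<rho> x (\<rho> y m) \<in> M2"
proof (induction x arbitrary: m y rule: locally_nilpotent_induct)
  case zero
  then show ?case using subspace_0[OF invariantD(1)[OF assms(3)]] by (simp add: rep_0)
next
  case (step x)
  interpret critical_element act G scale D \<rho> \<B> J M1 M2 x
  proof unfold_locales
    show "x \<in> J" by (rule step.prems(1))
    show "\<rho> (D i x) (\<rho> y m) \<in> M2" if "m \<in> M1" for m i y
      using J_D[OF step.prems(1)] that by (rule step.IH)
  qed (rule assms; assumption)+
  show ?case using step.prems(2) by (rule x_annihilates)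
qed

text \<open>Induction over the number of generators minus the corank, which grows strictly with \<open>N\<close>.
  The torsion submodule is killed by the whole algebra, and in
  the step, \<open>J\<^sup>2\<close> maps \<open>N\<close> into a maximal saturated invariant submodule \<open>N1\<close> below \<open>N\<close>.\<close>

lemma nilpotent_on_saturated:
  assumes "invariant N" "saturated N"
  shows "\<exists>k>0. \<forall>x\<in>ideal_power J k. \<forall>m\<in>N. \<rho> x m = 0"
  using assms
proof (induction "card G - corank N" arbitrary: N rule: less_induct)
  case less
  note N = less.prems
  have N0: "0 \<in> X" if "invariant X" for X using subspace_0[OF invariantD(1)[OF that]] .
  let ?T = "saturation {0}"
  have T: "invariant ?T" "saturated ?T"
    using invariant_saturation[OF invariant_zero] saturated_saturation by auto
  have TN: "?T \<subseteq> N"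
    using saturatedD[OF N(2)] N0[OF N(1)] by (auto simp: saturation_def)
  show ?case
  proof (cases "?T = N")
    case True
    then have "\<rho> x m = 0" if "m \<in> N" for x m
      using rep_saturation[OF invariant_zero, of m x] that by simp
    then show ?thesis by (intro exI[of _ 1]) simp
  next
    case False
    let ?P = "\<lambda>X. invariant X \<and> saturated X \<and> X \<subset> N"
    have "?P ?T" using T TN False by blast
    then obtain N1 where N1: "?P N1" and least: "\<And>X. ?P X \<Longrightarrow> corank N1 \<le> corank X"
      using ex_has_least_nat[of ?P ?T corank] by blast
    have simple: "X = N1 \<or> X = N" if X: "invariant X" "saturated X" "N1 \<subseteq> X" "X \<subseteq> N" for X
    proof (rule ccontr)
      assume "\<not> (X = N1 \<or> X = N)"
      then have "N1 \<subset> X" "?P X" using X by auto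
      then have "corank X < corank N1"
        using N1 X invariantD(1) by (intro corank_strict_mono) auto
      with least[OF \<open>?P X\<close>] show False by simp
    qed
    have JJ: "\<rho> x (\<rho> y m) \<in> N1" if "x \<in> J" "m \<in> N" for x y m
      using annihilates_simple_section[OF N, of N1] N1 simple that by blast
    have "corank N < corank N1"
      using N1 N invariantD(1) by (intro corank_strict_mono) auto
    moreover have "corank N1 \<le> card G" using N0 N1 by (intro corank(3)) auto
    ultimately have "card G - corank N1 < card G - corank N" by simp
    from less.hyps[OF this] N1 obtain k where k: "k > 0"
      and zero: "\<And>x m. x \<in> ideal_power J k \<Longrightarrow> m \<in> N1 \<Longrightarrow> \<rho> x m = 0" by blast
    have "\<rho> x m = 0" if x: "x \<in> ideal_power J (Suc (Suc k))" and m: "m \<in> N" for x m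
    proof -
      have "\<rho> z (\<rho> y m) = 0" if z: "z \<in> ideal_power J (Suc k)" and y: "y \<in> J" for y z
      proof -
        from z obtain l :: nat and v w where z: "z = (\<Sum>i<l. v i * w i)"
          and vw: "\<forall>i<l. v i \<in> ideal_power J k \<and> w i \<in> J"
          unfolding ideal_power_Suc[OF k] ideal_prod_def by blast
        have "\<rho> z (\<rho> y m) = (\<Sum>i<l. \<rho> (v i) (\<rho> (w i) (\<rho> y m)))"
          by (simp add: z rep_sum rep_mult)
        also have "\<dots> = 0" using vw JJ m by (intro sum.neutral ballI zero) auto
        finally show ?thesis .
      qed
      moreover from x obtain l :: nat and v w where x: "x = (\<Sum>i<l. v i * w i)"
        and vw: "\<forall>i<l. v i \<in> ideal_power J (Suc k) \<and> w i \<in> J"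
        unfolding ideal_power_Suc[OF zero_less_Suc[of k]] ideal_prod_def by blast
      ultimately have "(\<Sum>i<l. \<rho> (v i) (\<rho> (w i) m)) = 0" by (intro sum.neutral ballI) auto
      then show ?thesis by (simp add: x rep_sum rep_mult)
    qed
    then show ?thesis by (intro exI[of _ "Suc (Suc k)"]) blast
  qed
qed

lemma nilpotent_if_faithful:
  assumes "inj \<rho>"
  shows "nilpotent_ideal J"
proof -
  have "saturated UNIV" by (simp add: saturated_def)
  then obtain k where k: "k > 0" "\<And>x m. x \<in> ideal_power J k \<Longrightarrow> \<rho> x m = 0"
    using nilpotent_on_saturated[OF invariant_UNIV] by auto
  have "x = 0" if "x \<in> ideal_power J k" for x
  proof -
    have "\<rho> x = \<rho> 0" using k(2)[OF that] by (auto simp: rep_0)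
    then show ?thesis using assms by (simp add: inj_eq)
  qed
  with k(1) zero_in_ideal_power[OF J_0] show ?thesis
    unfolding nilpotent_ideal_def by (intro exI[of _ k]) auto
qed

end

section \<open>The families given by T-invariant maps\<close>

text \<open>The monomial \<open>T^\<alpha> / \<alpha>!\<close>.  In this normalization the partial derivatives just lower the
  exponent.\<close>

definition divided_power :: "('n::finite \<Rightarrow>\<^sub>0 nat) \<Rightarrow> ('n, 'k::field_char_0) polys"
  where "divided_power \<alpha> =
    Poly_Mapping.single \<alpha> (inverse (\<Prod>i\<in>UNIV. fact (Poly_Mapping.lookup \<alpha> i)))"

lemma partial_deriv_divided_power:
  "partial_deriv i (divided_power (\<alpha> + Poly_Mapping.single i 1)) = (divided_power \<alpha> :: ('n::finite, 'k::field_char_0) polys)"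
proof (rule poly_mapping_eqI)
  fix m
  let ?e = "Poly_Mapping.single i (1::nat)"
  have "(\<Prod>j\<in>UNIV. fact (Poly_Mapping.lookup (\<alpha> + ?e) j)) =
      (\<Prod>j\<in>UNIV. (if j = i then of_nat (Poly_Mapping.lookup \<alpha> i + 1) else 1) * fact (Poly_Mapping.lookup \<alpha> j) :: 'k)"
    by (intro prod.cong) (auto simp: lookup_add lookup_single when_def)
  also have "\<dots> = of_nat (Poly_Mapping.lookup \<alpha> i + 1) * (\<Prod>j\<in>UNIV. fact (Poly_Mapping.lookup \<alpha> j))"
    by (simp add: prod.distrib del: of_nat_add of_nat_Suc)
  finally have fact: "(\<Prod>j\<in>UNIV. fact (Poly_Mapping.lookup (\<alpha> + ?e) j) :: 'k) = \<dots>" .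
  have ne: "of_nat (Poly_Mapping.lookup \<alpha> i + 1) \<noteq> (0 :: 'k)" by (simp del: of_nat_add of_nat_Suc)
  show "Poly_Mapping.lookup (partial_deriv i (divided_power (\<alpha> + ?e) :: ('n, 'k) polys)) m
      = Poly_Mapping.lookup (divided_power \<alpha>) m"
    unfolding lookup_partial_deriv divided_power_def lookup_single fact
    using ne by (auto simp: when_def simp del: of_nat_add of_nat_Suc)
qed

lemma partial_deriv_divided_power_0:
  assumes "Poly_Mapping.lookup \<alpha> i = 0"
  shows "partial_deriv i (divided_power \<alpha>) = (0 :: ('n::finite, 'k::field_char_0) polys)"
proof (rule poly_mapping_eqI)
  fix m
  have "\<alpha> \<noteq> m + Poly_Mapping.single i 1" using assms by (auto simp: lookup_add)
  then show "Poly_Mapping.lookup (partial_deriv i (divided_power \<alpha> :: ('n, 'k) polys)) m = Poly_Mapping.lookup 0 m"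
    unfolding lookup_partial_deriv divided_power_def lookup_single by simp
qed

lemma single_in_augmentation_power:
  fixes \<alpha> :: "'n::finite \<Rightarrow>\<^sub>0 nat" and c :: "'k::comm_ring_1"
  assumes "k \<le> (\<Sum>i\<in>UNIV. Poly_Mapping.lookup \<alpha> i)"
  shows "Poly_Mapping.single \<alpha> c \<in> ideal_power augmentation_ideal k"
  using assms
proof (induction k arbitrary: \<alpha>)
  case (Suc k)
  interpret module "(*) :: ('n, 'k) polys \<Rightarrow> _ \<Rightarrow> _"
    by unfold_locales (simp_all add: algebra_simps)
  have Var: "Var i \<in> (augmentation_ideal :: ('n, 'k) polys set)" for i
    unfolding augmentation_ideal_def by (rule span_base) simp
  obtain i where "Poly_Mapping.lookup \<alpha> i \<noteq> 0"
    using Suc.prems by (metis Suc_neq_Zero le_zero_eq sum.neutral)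
  then obtain \<alpha>' where \<alpha>: "\<alpha> = \<alpha>' + Poly_Mapping.single i 1"
    using exponent_cases[of \<alpha> i] by metis
  have single: "Poly_Mapping.single \<alpha> c = Poly_Mapping.single \<alpha>' c * Var i"
    by (simp add: \<alpha> Var_def mult_single)
  have "k \<le> (\<Sum>i\<in>UNIV. Poly_Mapping.lookup \<alpha>' i)"
    using Suc.prems unfolding \<alpha> by (simp add: lookup_add sum.distrib lookup_single when_def)
  note IH = Suc.IH[OF this]
  show ?case
  proof (cases k)
    case 0
    have "Poly_Mapping.single \<alpha>' c * Var i \<in> (augmentation_ideal :: ('n, 'k) polys set)"
      using Var unfolding augmentation_ideal_def by (rule span_scale)
    then show ?thesis by (simp add: 0 single)
  next
    case (Suc k')
    have "Poly_Mapping.single \<alpha>' c * Var i \<in> ideal_prod (ideal_power augmentation_ideal k) augmentation_ideal"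
      unfolding ideal_prod_def using IH Var
      by (intro CollectI exI[of _ 1] exI[of _ "\<lambda>_. Poly_Mapping.single \<alpha>' c"] exI[of _ "\<lambda>_. Var i"]) simp
    then show ?thesis using Suc by (simp add: single ideal_power_Suc)
  qed
qed simp

lemma finite_exponents_less:
  "finite {\<alpha> :: 'n::finite \<Rightarrow>\<^sub>0 nat. (\<Sum>i\<in>UNIV. Poly_Mapping.lookup \<alpha> i) < k}"
proof (induction k)
  case (Suc k)
  let ?S = "{\<alpha> :: 'n \<Rightarrow>\<^sub>0 nat. (\<Sum>i\<in>UNIV. Poly_Mapping.lookup \<alpha> i) < k}"
  have "{\<alpha> :: 'n \<Rightarrow>\<^sub>0 nat. (\<Sum>i\<in>UNIV. Poly_Mapping.lookup \<alpha> i) < Suc k} \<subseteq>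
      insert 0 (\<Union>i. (\<lambda>\<alpha>. \<alpha> + Poly_Mapping.single i 1) ` ?S)"
  proof clarify
    fix \<alpha> :: "'n \<Rightarrow>\<^sub>0 nat"
    assume less: "(\<Sum>i\<in>UNIV. Poly_Mapping.lookup \<alpha> i) < Suc k"
      and n: "\<alpha> \<notin> (\<Union>i. (\<lambda>\<alpha>. \<alpha> + Poly_Mapping.single i 1) ` ?S)"
    show "\<alpha> = 0"
    proof (rule poly_mapping_eqI, rule ccontr)
      fix i assume "Poly_Mapping.lookup \<alpha> i \<noteq> Poly_Mapping.lookup 0 i"
      then obtain \<alpha>' where \<alpha>: "\<alpha> = \<alpha>' + Poly_Mapping.single i 1"
        using exponent_cases[of \<alpha> i] by (metis lookup_zero)
      then have "\<alpha>' \<in> ?S" using less by (simp add: lookup_add sum.distrib lookup_single when_def)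
      with n \<alpha> show False by blast
    qed
  qed
  then show ?case by (rule finite_subset) (use Suc in simp)
qed simp

text \<open>Continuity of a T-invariant map and of the representation make the family
  locally finite.\<close>

lemma T_invariant_map_locally_finite:
  fixes scale :: "'k::field_char_0 \<Rightarrow> 'a::{ring, topological_ab_group_add, topological_semigroup_mult, t2_space} \<Rightarrow> 'a"
    and D :: "'n::finite \<Rightarrow> 'a \<Rightarrow> 'a"
    and act :: "('n, 'k) polys \<Rightarrow> 'm::ab_group_add \<Rightarrow> 'm"
  assumes R: "TC_representation scale D act \<rho>" and a: "a \<in> T_invariant_maps scale D"
  shows "finite {\<alpha>. \<rho> (a (divided_power \<alpha>)) v \<noteq> 0}"
proof -
  interpret R: TC_representation scale D act \<rho> by fact
  let ?s = "restrict_scalars act"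
  have lin: "Vector_Spaces.linear (restrict_scalars (*)) scale a"
    and cont: "continuous_map polys_topology euclidean a"
    using a by (auto simp: T_invariant_maps_def)
  interpret a: Vector_Spaces.linear "restrict_scalars (*)" scale a by (rule lin)
  have \<rho>0: "\<rho> 0 v = 0" using R.rep_add[of 0 0 v] by simp
  let ?V = "{\<psi>\<in>End ?s. \<psi> v = 0}"
  have "openin (finite_topology ?s) ?V"
    unfolding openin_finite_topology by (auto intro!: exI[of _ "{v}"])
  then have "openin polys_topology {f \<in> topspace polys_topology. (\<rho> \<circ> a) f \<in> ?V}"
    using continuous_map_compose[OF cont R.rep_continuous] by (intro openin_continuous_map_preimage)
  moreover have top: "topspace (polys_topology :: ('n, 'k) polys topology) = UNIV"
    using openin_subset[of polys_topology "UNIV :: ('n, 'k) polys set"]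
    by (auto simp: openin_polys_topology)
  ultimately have "openin polys_topology {f. \<rho> (a f) v = 0}"
    using R.rep_End by simp
  then obtain k where k: "\<And>g. g \<in> ideal_power augmentation_ideal k \<Longrightarrow> \<rho> (a (0 + g)) v = 0"
    unfolding openin_polys_topology using a.zero \<rho>0 by (metis (mono_tags, lifting) mem_Collect_eq)
  have "{\<alpha>. \<rho> (a (divided_power \<alpha>)) v \<noteq> 0} \<subseteq> {\<alpha>. (\<Sum>i\<in>UNIV. Poly_Mapping.lookup \<alpha> i) < k}"
  proof clarify
    fix \<alpha> assume ne: "\<rho> (a (divided_power \<alpha>)) v \<noteq> 0"
    show "(\<Sum>i\<in>UNIV. Poly_Mapping.lookup \<alpha> i) < k"
    proof (rule ccontr)
      assume "\<not> ?thesis"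
      then have "divided_power \<alpha> \<in> ideal_power (augmentation_ideal :: ('n, 'k) polys set) k"
        unfolding divided_power_def by (intro single_in_augmentation_power) simp
      from k[OF this] ne show False by simp
    qed
  qed
  then show ?thesis by (rule finite_subset) (rule finite_exponents_less)
qed

lemma family_module_of_TC_representation:
  fixes scale :: "'k::field_char_0 \<Rightarrow> 'a::{ring, topological_ab_group_add, topological_semigroup_mult, t2_space} \<Rightarrow> 'a"
    and D :: "'n::finite \<Rightarrow> 'a \<Rightarrow> 'a"
    and act :: "('n, 'k) polys \<Rightarrow> 'm::ab_group_add \<Rightarrow> 'm"
  assumes R: "TC_representation scale D act \<rho>" and G: "finite G" "module.span act G = UNIV"
  shows "family_module act G scale D \<rho> ((\<lambda>a \<alpha>. a (divided_power \<alpha>)) ` T_invariant_maps scale D)"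
proof -
  interpret R: TC_representation scale D act \<rho> by fact
  have inv: "Vector_Spaces.linear (restrict_scalars (*)) scale a" "a (partial_deriv i f) = D i (a f)"
    if "a \<in> T_invariant_maps scale D" for a i f
    using that by (auto simp: T_invariant_maps_def)
  show ?thesis
  proof unfold_locales
    fix i :: 'n and x y u v c
    interpret L: Vector_Spaces.linear scale scale "D i" by (rule R.linear_D)
    interpret \<rho>: Vector_Spaces.linear "restrict_scalars act" "restrict_scalars act" "\<rho> x"
      using R.rep_End by (simp add: End_def)
    show "D i (x + y) = D i x + D i y" "D i (scale c x) = scale c (D i x)"
      by (rule L.add, rule L.scale)
    show "D i (x * y) = D i x * y + x * D i y" by (rule R.derivation_D)
    show "\<rho> x (u + v) = \<rho> x u + \<rho> x v" by (rule \<rho>.add)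
    show "\<rho> x (act (Const c) u) = act (Const c) (\<rho> x u)"
      using \<rho>.scale[of c u] by (simp add: restrict_scalars_def)
    show "\<rho> (x + y) u = \<rho> x u + \<rho> y u" by (rule R.rep_add)
    show "\<rho> (scale c x) u = act (Const c) (\<rho> x u)"
      by (simp add: R.rep_scale restrict_scalars_def)
    show "\<rho> (x * y) u = \<rho> x (\<rho> y u)" by (simp add: R.rep_mult)
    show "\<rho> (D i x) u = \<rho> x (act (Var i) u) - act (Var i) (\<rho> x u)" by (rule R.rep_D)
  next
    fix b :: "('n \<Rightarrow>\<^sub>0 nat) \<Rightarrow> 'a" and i \<alpha> v
    assume "b \<in> (\<lambda>a \<alpha>. a (divided_power \<alpha>)) ` T_invariant_maps scale D"
    then obtain a where a: "a \<in> T_invariant_maps scale D" and b: "b = (\<lambda>\<alpha>. a (divided_power \<alpha>))"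
      by blast
    show "D i (b (\<alpha> + Poly_Mapping.single i 1)) = b \<alpha>"
      unfolding b inv(2)[OF a, symmetric] partial_deriv_divided_power ..
    show "D i (b \<alpha>) = 0" if "Poly_Mapping.lookup \<alpha> i = 0"
    proof -
      interpret a: Vector_Spaces.linear "restrict_scalars (*)" scale a by (rule inv(1)[OF a])
      show ?thesis
        unfolding b inv(2)[OF a, symmetric] partial_deriv_divided_power_0[OF that] by (rule a.zero)
    qed
    show "finite {\<alpha>. \<rho> (b \<alpha>) v \<noteq> 0}"
      unfolding b by (rule T_invariant_map_locally_finite[OF R a])
  next
    fix x
    have "x \<in> {a f | a f. a \<in> T_invariant_maps scale D}" using R.generated by blast
    then obtain a f where a: "a \<in> T_invariant_maps scale D" and x: "x = a f" by blast
    interpret a: Vector_Spaces.linear "restrict_scalars (*)" scale a by (rule inv(1)[OF a])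
    let ?k = "\<lambda>\<alpha>. Poly_Mapping.lookup f \<alpha> * (\<Prod>i\<in>UNIV. fact (Poly_Mapping.lookup \<alpha> i))"
    have "?k \<alpha> * inverse (\<Prod>i\<in>UNIV. fact (Poly_Mapping.lookup \<alpha> i)) = Poly_Mapping.lookup f \<alpha>" for \<alpha>
    proof -
      have "(\<Prod>i\<in>UNIV. fact (Poly_Mapping.lookup \<alpha> i)) \<noteq> (0 :: 'k)" by simp
      then show ?thesis by (simp only: mult.assoc right_inverse mult_1_right not_False_eq_True)
    qed
    then have "Poly_Mapping.single \<alpha> (Poly_Mapping.lookup f \<alpha>) = restrict_scalars (*) (?k \<alpha>) (divided_power \<alpha>)" for \<alpha>
      by (simp only: restrict_scalars_def divided_power_def Const_mult_single)
    then have "f = (\<Sum>\<alpha>\<in>Poly_Mapping.keys f. restrict_scalars (*) (?k \<alpha>) (divided_power \<alpha>))"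
      using poly_mapping_sum_monomials[of f] by simp
    then have "x = (\<Sum>\<alpha>\<in>Poly_Mapping.keys f. scale (?k \<alpha>) (a (divided_power \<alpha>)))"
      unfolding x by (metis (no_types, lifting) a.sum a.scale sum.cong)
    then show "\<exists>b\<in>(\<lambda>a \<alpha>. a (divided_power \<alpha>)) ` T_invariant_maps scale D.
        \<exists>S k. finite S \<and> x = (\<Sum>\<alpha>\<in>S. scale (k \<alpha>) (b \<alpha>))"
      using a by (intro bexI[of _ "\<lambda>\<alpha>. a (divided_power \<alpha>)"] exI[of _ "Poly_Mapping.keys f"] exI[of _ ?k]) auto
  qed (rule G)+
qed

theorem theorem5:
  fixes scale :: "'k::{alg_closed_field, field_char_0} \<Rightarrow>
      'a::{ring, topological_ab_group_add, topological_semigroup_mult, t2_space} \<Rightarrow> 'a"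
    and D :: "'n::finite \<Rightarrow> 'a \<Rightarrow> 'a"
    and act :: "('n, 'k) polys \<Rightarrow> 'm::ab_group_add \<Rightarrow> 'm"
    and \<rho> :: "'a \<Rightarrow> 'm \<Rightarrow> 'm"
  assumes "TC_algebra scale D"
    and "module act" and "finitely_generated act"
    and "TC_representation scale D act \<rho>"
    and "inj \<rho>"
  shows "nilpotent_ideal (jacobson_radical :: 'a set)"
proof -
  interpret A: TC_algebra scale D by fact
  obtain G where G: "finite G" "module.span act G = UNIV"
    using assms(3) by (auto simp: finitely_generated_def)
  let ?\<B> = "(\<lambda>a \<alpha>. a (divided_power \<alpha>)) ` T_invariant_maps scale D"
  interpret F: family_module act G scale D \<rho> ?\<B>
    by (rule family_module_of_TC_representation[OF assms(4) G])
  note J = left_idealD[OF left_ideal_jacobson_radical]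
  interpret quasi_regular_ideal act G scale D \<rho> ?\<B> jacobson_radical
  proof unfold_locales
    fix x :: 'a assume x: "x \<in> jacobson_radical"
    show "scale c x \<in> jacobson_radical" for c
      using A.scale_right_distrib A.scale_mult_left A.scale_mult_right x by (rule jacobson_radical_scale)
    show "x * y \<in> jacobson_radical" for y using x by (rule jacobson_radical_right_ideal)
    show "D i x \<in> jacobson_radical" for i
      using A.vector_space_axioms A.scale_mult_left A.scale_mult_right A.linear_D A.derivation_D
        F.derivation_locally_nilpotent x
      by (rule jacobson_radical_derivation)
    show "\<exists>z. z - x - z * x = 0 \<and> z - x - x * z = 0"
      using jacobson_radical_quasi_regular[OF x] by blast
  qed (use J in blast)+
  show ?thesis using assms(5) by (rule nilpotent_if_faithful)
qed

end
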